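(* Let $\mathcal G$ be a connected noncompact metric graph with exactly one halfline and no terminal point, and consider the critical energy ($p=6$). Then $\mu_{\mathcal G}=\mu_{\mathbb R^+}$; $-\infty<\mathcal E_{\mathcal G}(\mu)<0$ for every $\mu\in(\mu_{\mathbb R^+},\mu_{\mathbb R}]$; and $\mathcal E_{\mathcal G}(\mu)$ is attained if and only if $\mu\in(\mu_{\mathbb R^+},\mu_{\mathbb R}]$.
   Context: Metric graphs have finitely many edges and vertices, bounded edges identified with $[0,\ell_e]$ and halflines with $[0,\infty)$ (far endpoints: vertices at infinity). A terminal point is a vertex of degree one that is not a vertex at infinity. $H^1_\mu(\mathcal G)$: continuous functions, $H^1$ on each edge, $\|u\|_2^2=\mu$. $E(u,\mathcal G)=\frac12\int|u'|^2-\frac16\int|u|^6$, $\mathcal E_{\mathcal G}(\mu)=\inf_{H^1_\mu(\mathcal G)}E(\cdot,\mathcal G)$, defined for $\mu>0$. For a graph $X$, $K_X=\sup_{u\in H^1(X),u\ne0}\frac{\|u\|_6^6}{\|u\|_2^4\|u'\|_2^2}$ and $\mu_X=\sqrt{3/K_X}$; $\mu_{\mathbb R}=\pi\sqrt3/2$, $\mu_{\mathbb R^+}=\pi\sqrt3/4$. *)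

theory Defs
  imports "HOL-Analysis.Analysis"
begin

section \<open>Metric graphs\<close>

text \<open>A metric graph: finite vertex set Vs, finite edge set Es, a subset HL of
 halflines. A bounded edge e (in Es - HL) is identified with [0, len e], its endpoint 0
 being src e and its endpoint len e being tgt e (loops and multiple edges allowed).
 A halfline h (in HL) is identified with [0,\<infinity>), its point 0 being the vertex src h;
 its far endpoint is a vertex at infinity and is not an element of Vs.\<close>

record ('v, 'e) mgraph =
  Vs  :: "'v set"
  Es  :: "'e set"
  HL  :: "'e set"
  len :: "'e \<Rightarrow> real"
  src :: "'e \<Rightarrow> 'v"
  tgt :: "'e \<Rightarrow> 'v"

definition wf_mgraph :: "('v, 'e) mgraph \<Rightarrow> bool" where
  "wf_mgraph G \<longleftrightarrow> finite (Vs G) \<and> finite (Es G) \<and> HL G \<subseteq> Es G \<and>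
     (\<forall>e\<in>Es G. src G e \<in> Vs G) \<and>
     (\<forall>e\<in>Es G - HL G. tgt G e \<in> Vs G \<and> len G e > 0)"

text \<open>Parameter domain of an edge.\<close>
definition edom :: "('v, 'e) mgraph \<Rightarrow> 'e \<Rightarrow> real set" where
  "edom G e = (if e \<in> HL G then {0..} else {0..len G e})"

text \<open>Degree of a (finite) vertex; a loop contributes 2.\<close>
definition deg :: "('v, 'e) mgraph \<Rightarrow> 'v \<Rightarrow> nat" where
  "deg G v = card {e\<in>Es G. src G e = v} + card {e\<in>Es G - HL G. tgt G e = v}"

definition has_terminal_point :: "('v, 'e) mgraph \<Rightarrow> bool" where
  "has_terminal_point G \<longleftrightarrow> (\<exists>v\<in>Vs G. deg G v = 1)"

definition adj :: "('v, 'e) mgraph \<Rightarrow> ('v \<times> 'v) set" where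
  "adj G = {(src G e, tgt G e) | e. e \<in> Es G - HL G} \<union> {(tgt G e, src G e) | e. e \<in> Es G - HL G}"

definition mg_connected :: "('v, 'e) mgraph \<Rightarrow> bool" where
  "mg_connected G \<longleftrightarrow> (\<forall>v\<in>Vs G. \<forall>w\<in>Vs G. (v, w) \<in> (adj G)\<^sup>*)"

definition noncompact :: "('v, 'e) mgraph \<Rightarrow> bool" where
  "noncompact G \<longleftrightarrow> HL G \<noteq> {}"

section \<open>Sobolev space H^1\<close>

text \<open>f is in H^1(I) with weak derivative g: f, g square integrable on I and
 f y - f x = integral of g over [x,y] for x \<le> y in I (absolute continuity).\<close>
definition H1_on :: "real set \<Rightarrow> (real \<Rightarrow> real) \<Rightarrow> (real \<Rightarrow> real) \<Rightarrow> bool" where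
  "H1_on I f g \<longleftrightarrow>
     set_integrable lborel I (\<lambda>x. (f x)\<^sup>2) \<and> set_integrable lborel I (\<lambda>x. (g x)\<^sup>2) \<and>
     (\<forall>x\<in>I. \<forall>y\<in>I. x \<le> y \<longrightarrow>
        set_integrable lborel {x..y} g \<and> f y - f x = set_lebesgue_integral lborel {x..y} g)"

text \<open>A function u on G (u e is its restriction to edge e) lying in H^1(G), with
 edgewise weak derivative u'; continuity at the vertices.\<close>
definition in_H1 :: "('v, 'e) mgraph \<Rightarrow> ('e \<Rightarrow> real \<Rightarrow> real) \<Rightarrow> ('e \<Rightarrow> real \<Rightarrow> real) \<Rightarrow> bool" where
  "in_H1 G u u' \<longleftrightarrow>
     (\<forall>e\<in>Es G. H1_on (edom G e) (u e) (u' e)) \<and>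
     (\<exists>\<phi>. (\<forall>e\<in>Es G. u e 0 = \<phi> (src G e)) \<and>
          (\<forall>e\<in>Es G - HL G. u e (len G e) = \<phi> (tgt G e)))"

definition Lp_pow :: "('v, 'e) mgraph \<Rightarrow> nat \<Rightarrow> ('e \<Rightarrow> real \<Rightarrow> real) \<Rightarrow> real" where
  "Lp_pow G p u = (\<Sum>e\<in>Es G. set_lebesgue_integral lborel (edom G e) (\<lambda>x. \<bar>u e x\<bar> ^ p))"

definition mass :: "('v, 'e) mgraph \<Rightarrow> ('e \<Rightarrow> real \<Rightarrow> real) \<Rightarrow> real" where
  "mass G u = Lp_pow G 2 u"

definition energy :: "('v, 'e) mgraph \<Rightarrow> ('e \<Rightarrow> real \<Rightarrow> real) \<Rightarrow> ('e \<Rightarrow> real \<Rightarrow> real) \<Rightarrow> real" where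
  "energy G u u' = Lp_pow G 2 u' / 2 - Lp_pow G 6 u / 6"

definition H1_mu :: "('v, 'e) mgraph \<Rightarrow> real \<Rightarrow> (('e \<Rightarrow> real \<Rightarrow> real) \<times> ('e \<Rightarrow> real \<Rightarrow> real)) set" where
  "H1_mu G \<mu> = {(u, u'). in_H1 G u u' \<and> mass G u = \<mu>}"

text \<open>Ground state energy level, as an extended real (may be -\<infinity>).\<close>
definition gs_level :: "('v, 'e) mgraph \<Rightarrow> real \<Rightarrow> ereal" where
  "gs_level G \<mu> = (INF p\<in>H1_mu G \<mu>. ereal (energy G (fst p) (snd p)))"

definition gs_attained :: "('v, 'e) mgraph \<Rightarrow> real \<Rightarrow> bool" where
  "gs_attained G \<mu> \<longleftrightarrow> (\<exists>p\<in>H1_mu G \<mu>. ereal (energy G (fst p) (snd p)) = gs_level G \<mu>)"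

text \<open>Sharp Gagliardo-Nirenberg constant K_G (extended real) and critical mass.\<close>
definition GN_const :: "('v, 'e) mgraph \<Rightarrow> ereal" where
  "GN_const G = (SUP p\<in>{(u, u'). in_H1 G u u' \<and> mass G u > 0}.
      ereal (Lp_pow G 6 (fst p) / ((mass G (fst p))\<^sup>2 * Lp_pow G 2 (snd p))))"

definition crit_mass :: "('v, 'e) mgraph \<Rightarrow> real" where
  "crit_mass G = sqrt (3 / real_of_ereal (GN_const G))"

definition mu_R :: real where "mu_R = pi * sqrt 3 / 2"
definition mu_Rplus :: real where "mu_Rplus = pi * sqrt 3 / 4"

end

theory Submission
  imports Defs "HOL-Complex_Analysis.Great_Picard" "HOL-Real_Asymp.Real_Asymp"
begin

text \<open>
  No rearrangements are used. For \<open>0 \<le> u \<le> N\<close> put \<open>V t = t\<^sup>2 (N\<^sup>4 - t\<^sup>4) / 3\<close>; then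
  \<open>2 E(u) = \<integral> (u'\<^sup>2 + V(u)) - N\<^sup>4 \<mu> / 3\<close>, and \<open>u'\<^sup>2 + V(u) \<ge> 2 \<bar>\<Psi>(u)'\<bar>\<close> for the primitive \<open>\<Psi>\<close> of the
  square root of \<open>V\<close>. Hence the energy is bounded below by the number of times \<open>u\<close> attains each
  value. With \<open>N = M = max u\<close> one has \<open>4 \<Psi>(M) = M\<^sup>4 \<mu>\<^sub>R / 3\<close>, and \<open>\<mu>\<^sub>R\<^sub>+ = \<mu>\<^sub>R / 2\<close>.

  Every value below \<open>M\<close> is attained, since \<open>G\<close> is connected and \<open>u\<close> vanishes at infinity. As there
  is no terminal point, two intervals start at the peak, and one of them can be deleted without
  losing values; taking \<open>N\<close> slightly larger than \<open>M\<close> yields \<open>E(u) > 0\<close> at mass \<open>\<mu>\<^sub>R\<^sub>+\<close>.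

  Let \<open>a\<close> be the largest of the minima of \<open>u\<close> over all halves of bounded edges. The values in
  \<open>(a, M)\<close> are attained twice, so \<open>2 E \<ge> - C a\<^sup>2 M\<^sup>2\<close> for masses up to \<open>\<mu>\<^sub>R\<close>. Moreover \<open>u \<ge> a\<close> on a
  whole half edge, which costs \<open>c a\<^sup>2 M\<^sup>4\<close> and outweighs the loss unless \<open>a\<close> is exponentially small in
  \<open>M\<^sup>2\<close>. Hence functions of energy below a fixed negative number are uniformly bounded, and a
  minimizing sequence converges pointwise. On a remote part of the halfline the same estimate shows
  that the energy lost at infinity is not negative, so the limit has at most the infimal energy and
  at most the given mass; multiplying it by a constant \<open>c \<ge> 1\<close> gives a ground state. Solitons
  on the halfline, extended by a constant, provide the upper bounds.
\<close>

section \<open>Absolutely continuous functions\<close>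

text \<open>\<open>V\<close> is the potential whose zero-energy orbit is the soliton of height
  \<open>N\<close>: there \<open>|u'|\<close> equals the square root of \<open>V(u)\<close>, so the
  calibration is sharp. A value taken twice is paid for as on the line, a value taken once as on the
  halfline; hence the two thresholds \<open>mu_R\<close> and half of it. Two routes descend from the
  peak, but the second end at a vertex may belong to the same edge, when that edge is a loop. Half
  edges keep the routes disjoint in this case, which is why minima over halves are used. Maxima are
  not bounded at energy level 0: at mass \<open>mu_R\<close>, ever more concentrated solitons placed
  on the halfline have energies tending to 0. Only energies below a fixed negative number bound the
  maximum, and the negative infimum supplies such a number. Its sign also excludes a zero limit and
  ensures that the final multiplication by \<open>c\<close> does not raise the energy.\<close>

lemma set_integral_subset_le:
  fixes f :: "real \<Rightarrow> real"
  assumes "set_integrable lborel A f" "B \<in> sets lborel" "B \<subseteq> A" "\<And>x. x \<in> A \<Longrightarrow> 0 \<le> f x"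
  shows "(LINT x:B|lborel. f x) \<le> (LINT x:A|lborel. f x)"
  unfolding set_lebesgue_integral_def
proof (rule integral_mono)
  show "integrable lborel (\<lambda>x. indicat_real B x *\<^sub>R f x)"
    using set_integrable_subset[OF assms(1-3)] by (simp add: set_integrable_def)
  show "integrable lborel (\<lambda>x. indicat_real A x *\<^sub>R f x)"
    using assms(1) by (simp add: set_integrable_def)
qed (use assms in \<open>auto split: split_indicator\<close>)

lemma set_integral_nonneg':
  fixes f :: "real \<Rightarrow> real"
  assumes "\<And>x. x \<in> A \<Longrightarrow> 0 \<le> f x"
  shows "0 \<le> (LINT x:A|lborel. f x)"
  unfolding set_lebesgue_integral_def
  by (rule integral_nonneg_AE) (use assms in \<open>auto split: split_indicator\<close>)

lemma set_integral_split2: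
  fixes f :: "real \<Rightarrow> real"
  assumes "set_integrable lborel A f" "\<And>x. x \<in> A \<Longrightarrow> 0 \<le> f x"
    and "B \<in> sets lborel" "C \<in> sets lborel" "B \<subseteq> A" "C \<subseteq> A" "B \<inter> C \<subseteq> {p}"
  shows "(LINT x:B|lborel. f x) + (LINT x:C|lborel. f x) \<le> (LINT x:A|lborel. f x)"
proof -
  have ae: "AE x in lborel. \<not> (x \<in> B \<and> x \<in> C)"
    by (rule AE_I'[of "{p}"]) (use assms(7) in auto)
  have "(LINT x:B|lborel. f x) + (LINT x:C|lborel. f x) = (LINT x:B \<union> C|lborel. f x)"
    by (rule set_integral_Un_AE[symmetric, OF ae])
       (use assms in \<open>auto intro: set_integrable_subset\<close>)
  also have "\<dots> \<le> (LINT x:A|lborel. f x)"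
    by (rule set_integral_subset_le) (use assms in auto)
  finally show ?thesis .
qed

lemma set_integral_Icc_add:
  fixes f :: "real \<Rightarrow> real"
  assumes "a \<le> b" "b \<le> c" "set_integrable lborel {a..c} f"
  shows "(LINT x:{a..c}|lborel. f x) = (LINT x:{a..b}|lborel. f x) + (LINT x:{b..c}|lborel. f x)"
proof -
  have ae: "AE x in lborel. \<not> (x \<in> {a..b} \<and> x \<in> {b..c})"
    by (rule AE_I'[of "{b}"]) auto
  have "{a..c} = {a..b} \<union> {b..c}" using assms by auto
  moreover have "set_integrable lborel {a..b} f" "set_integrable lborel {b..c} f"
    using assms by (auto intro!: set_integrable_subset[OF assms(3)])
  ultimately show ?thesis
    using set_integral_Un_AE[OF ae, of f] by auto
qed

lemma set_integral_atLeast_add: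
  fixes f :: "real \<Rightarrow> real"
  assumes "a \<le> b" "set_integrable lborel {a..} f"
  shows "(LINT x:{a..}|lborel. f x) = (LINT x:{a..b}|lborel. f x) + (LINT x:{b..}|lborel. f x)"
proof -
  have ae: "AE x in lborel. \<not> (x \<in> {a..b} \<and> x \<in> {b..})"
    by (rule AE_I'[of "{b}"]) auto
  have "{a..} = {a..b} \<union> {b..}" using assms by auto
  moreover have "set_integrable lborel {a..b} f" "set_integrable lborel {b..} f"
    using assms by (auto intro!: set_integrable_subset[OF assms(2)])
  ultimately show ?thesis
    using set_integral_Un_AE[OF ae, of f] by auto
qed

lemma set_integral_Icc_const:
  fixes c :: real
  assumes "a \<le> b"
  shows "set_integrable lborel {a..b} (\<lambda>x. c)" "(LINT x:{a..b}|lborel. c) = (b - a) * c"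
proof -
  show "set_integrable lborel {a..b} (\<lambda>x. c)"
    by (rule borel_integrable_atLeastAtMost') simp
  show "(LINT x:{a..b}|lborel. c) = (b - a) * c"
    using assms by (subst set_integral_const) auto
qed

text \<open>The quadratic in \<open>c\<close> is least at \<open>c = A / d\<close>; for
  \<open>d = 0\<close> it is affine in \<open>c\<close> and can stay nonnegative only if
  \<open>A = 0\<close>. Applied to the integral of \<open>(g - c)^2\<close>, this is the
  Cauchy-Schwarz inequality.\<close>

lemma discriminant_nonpos:
  fixes A B d :: real
  assumes "\<And>c. 0 \<le> B - 2 * c * A + c\<^sup>2 * d" "0 \<le> d"
  shows "A\<^sup>2 \<le> d * B"
proof (cases "d = 0")
  case True
  have "A = 0"
  proof (rule ccontr)
    assume "A \<noteq> 0"
    \<comment> \<open>This \<open>c\<close> gives the affine expression the value -1.\<close>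
    with assms(1)[of "(B + 1) / (2 * A)"] True show False by simp
  qed
  then show ?thesis using True by simp
next
  case False
  with assms have d: "d > 0" by simp
  have "0 \<le> d * (B - 2 * (A / d) * A + (A / d)\<^sup>2 * d)"
    using assms(1)[of "A / d"] d by (intro mult_nonneg_nonneg) auto
  also have "\<dots> = d * B - A\<^sup>2"
    using d by (simp add: field_simps power2_eq_square)
  finally show ?thesis by simp
qed

lemma set_integral_Cauchy_Schwarz_Icc:
  fixes g :: "real \<Rightarrow> real"
  assumes "x \<le> y" "set_integrable lborel {x..y} g" "set_integrable lborel {x..y} (\<lambda>t. (g t)\<^sup>2)"
  shows "(LINT t:{x..y}|lborel. g t)\<^sup>2 \<le> (y - x) * (LINT t:{x..y}|lborel. (g t)\<^sup>2)"
proof (rule discriminant_nonpos)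
  fix c :: real
  note c = set_integral_Icc_const[OF assms(1)]
  have "0 \<le> (LINT t:{x..y}|lborel. (g t - c)\<^sup>2)"
    by (rule set_integral_nonneg') simp
  also have "\<dots> = (LINT t:{x..y}|lborel. (g t)\<^sup>2 - (2 * c) * g t + c\<^sup>2)"
    by (simp add: power2_diff algebra_simps)
  also have "\<dots> = (LINT t:{x..y}|lborel. (g t)\<^sup>2) - 2 * c * (LINT t:{x..y}|lborel. g t) + (y - x) * c\<^sup>2"
    using assms c by (simp)
  finally show "0 \<le> (LINT t:{x..y}|lborel. (g t)\<^sup>2) - 2 * c * (LINT t:{x..y}|lborel. g t) + c\<^sup>2 * (y - x)"
    by (simp add: mult.commute)
qed (use assms in simp)

text \<open>The fundamental-theorem clause of \<open>H1_on\<close> on its own. It restricts to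
  subsets and can be verified for limits, while the square integrals are controlled
  separately.\<close>

definition AC_on :: "real set \<Rightarrow> (real \<Rightarrow> real) \<Rightarrow> (real \<Rightarrow> real) \<Rightarrow> bool" where
  "AC_on I f g \<longleftrightarrow> (\<forall>x\<in>I. \<forall>y\<in>I. x \<le> y \<longrightarrow>
     set_integrable lborel {x..y} g \<and> f y - f x = (LINT t:{x..y}|lborel. g t))"

lemma H1_on_iff:
  "H1_on I f g \<longleftrightarrow> set_integrable lborel I (\<lambda>x. (f x)\<^sup>2) \<and> set_integrable lborel I (\<lambda>x. (g x)\<^sup>2) \<and> AC_on I f g"
  unfolding H1_on_def AC_on_def by simp

lemma AC_onD:
  assumes "AC_on I f g" "x \<in> I" "y \<in> I" "x \<le> y"
  shows "set_integrable lborel {x..y} g" "f y - f x = (LINT t:{x..y}|lborel. g t)"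
  using assms unfolding AC_on_def by auto

lemma AC_on_subset: "AC_on I f g \<Longrightarrow> J \<subseteq> I \<Longrightarrow> AC_on J f g"
  unfolding AC_on_def by blast

lemma Icc_subset_interval:
  fixes I :: "real set"
  assumes "is_interval I" "x \<in> I" "y \<in> I"
  shows "{x..y} \<subseteq> I"
proof
  fix z assume "z \<in> {x..y}"
  then show "z \<in> I" using mem_is_interval_1_I[OF assms] by simp
qed

lemma AC_on_Holder_le:
  assumes "AC_on I f g" "set_integrable lborel I (\<lambda>x. (g x)\<^sup>2)" "is_interval I" "x \<in> I" "y \<in> I" "x \<le> y"
  shows "(f y - f x)\<^sup>2 \<le> (y - x) * (LINT t:I|lborel. (g t)\<^sup>2)"
proof -
  have sub: "{x..y} \<subseteq> I" using assms by (intro Icc_subset_interval)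
  have "(f y - f x)\<^sup>2 \<le> (y - x) * (LINT t:{x..y}|lborel. (g t)\<^sup>2)"
    using AC_onD[OF assms(1,4,5,6)] set_integral_Cauchy_Schwarz_Icc[OF assms(6), of g]
      set_integrable_subset[OF assms(2) _ sub] by simp
  also have "\<dots> \<le> (y - x) * (LINT t:I|lborel. (g t)\<^sup>2)"
    using assms sub by (intro mult_left_mono set_integral_subset_le) auto
  finally show ?thesis .
qed

text \<open>A bound \<open>T\<close> in place of the norm makes the modulus of continuity uniform
  along a sequence, as the convergence argument for minimizing sequences requires.\<close>

lemma AC_on_Holder:
  assumes "AC_on I f g" "set_integrable lborel I (\<lambda>x. (g x)\<^sup>2)" "is_interval I" "x \<in> I" "y \<in> I"
    and "(LINT t:I|lborel. (g t)\<^sup>2) \<le> T"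
  shows "\<bar>f y - f x\<bar> \<le> sqrt (\<bar>y - x\<bar> * T)"
proof -
  have "(f y - f x)\<^sup>2 \<le> \<bar>y - x\<bar> * (LINT t:I|lborel. (g t)\<^sup>2)"
  proof (cases "x \<le> y")
    case True then show ?thesis using AC_on_Holder_le[OF assms(1,2,3,4,5)] by simp
  next
    case False then show ?thesis
      using AC_on_Holder_le[OF assms(1,2,3,5,4)] by (simp add: power2_commute[of "f y"])
  qed
  also have "\<dots> \<le> \<bar>y - x\<bar> * T" using assms(6) by (intro mult_left_mono) auto
  finally show ?thesis
    using real_le_rsqrt[of "\<bar>f y - f x\<bar>"] by simp
qed

lemma AC_on_continuous:
  assumes "AC_on I f g" "set_integrable lborel I (\<lambda>x. (g x)\<^sup>2)" "is_interval I"
  shows "continuous_on I f"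
  unfolding continuous_on_def
proof
  fix x assume x: "x \<in> I"
  define T where "T = (LINT t:I|lborel. (g t)\<^sup>2)"
  have "((\<lambda>y. sqrt (\<bar>y - x\<bar> * T)) \<longlongrightarrow> sqrt (\<bar>x - x\<bar> * T)) (at x within I)"
    by (intro tendsto_intros)
  then have "((\<lambda>y. sqrt (\<bar>y - x\<bar> * T)) \<longlongrightarrow> 0) (at x within I)" by simp
  then have "((\<lambda>y. f y - f x) \<longlongrightarrow> 0) (at x within I)"
  proof (rule Lim_null_comparison[rotated])
    show "\<forall>\<^sub>F y in at x within I. norm (f y - f x) \<le> sqrt (\<bar>y - x\<bar> * T)"
      unfolding eventually_at_filter T_def
      using AC_on_Holder[OF assms x _ order.refl] by (intro always_eventually) simp
  qed
  then show "(f \<longlongrightarrow> f x) (at x within I)" by (simp add: LIM_zero_iff)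
qed

section \<open>Chain rule and calibration inequality\<close>

lemma set_integrable_continuous_mult:
  fixes h g :: "real \<Rightarrow> real"
  assumes h: "continuous_on {x..y} h" and g: "set_integrable lborel {x..y} g"
  shows "set_integrable lborel {x..y} (\<lambda>t. h t * g t)"
proof -
  have "compact (h ` {x..y})" using h by (intro compact_continuous_image) auto
  then have "bounded (h ` {x..y})" by (rule compact_imp_bounded)
  then obtain C where "\<forall>u\<in>h ` {x..y}. norm u \<le> C"
    unfolding bounded_iff by blast
  then have C: "\<And>t. t \<in> {x..y} \<Longrightarrow> \<bar>h t\<bar> \<le> C" by simp
  have hm: "(\<lambda>t. indicator {x..y} t *\<^sub>R h t) \<in> borel_measurable borel"
    using h by (intro borel_measurable_continuous_on_indicator) auto
  have gm: "(\<lambda>t. indicator {x..y} t *\<^sub>R g t) \<in> borel_measurable borel"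
    using g by (auto simp: set_integrable_def dest: borel_measurable_integrable)
  show ?thesis
  proof (rule set_integrable_bound)
    show "set_integrable lborel {x..y} (\<lambda>t. C * g t)" using g by simp
    have eq: "(\<lambda>t. indicator {x..y} t *\<^sub>R (h t * g t))
        = (\<lambda>t. (indicator {x..y} t *\<^sub>R h t) * (indicator {x..y} t *\<^sub>R g t))"
      by (auto split: split_indicator)
    show "set_borel_measurable lborel {x..y} (\<lambda>t. h t * g t)"
      unfolding set_borel_measurable_def eq using hm gm by measurable
    show "AE t in lborel. t \<in> {x..y} \<longrightarrow> norm (h t * g t) \<le> norm (C * g t)"
    proof (rule AE_I2, rule impI)
      fix t assume t: "t \<in> {x..y}"
      have "\<bar>h t\<bar> \<le> \<bar>C\<bar>" using C[OF t] by linarith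
      then show "norm (h t * g t) \<le> norm (C * g t)"
        by (auto simp: abs_mult intro!: mult_right_mono)
    qed
  qed
qed

text \<open>On a short interval the mean value theorem replaces the factor \<open>F (f t)\<close> by a constant up to
  \<open>\<epsilon>\<close>; these local estimates add up, so no differentiation theorem for \<open>f\<close> is needed.\<close>

lemma AC_on_chain_rule:
  fixes f g F \<Phi> :: "real \<Rightarrow> real"
  assumes xy: "x \<le> y" and ac: "AC_on {x..y} f g" and fc: "continuous_on {x..y} f"
    and rng: "f ` {x..y} \<subseteq> {A..B}" and Fc: "continuous_on {A..B} F"
    and mvt: "\<And>s t. A \<le> s \<Longrightarrow> s < t \<Longrightarrow> t \<le> B \<Longrightarrow> \<exists>\<xi>\<in>{s..t}. \<Phi> t - \<Phi> s = F \<xi> * (t - s)"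
  shows "set_integrable lborel {x..y} (\<lambda>t. F (f t) * g t)"
    and "\<Phi> (f y) - \<Phi> (f x) = (LINT t:{x..y}|lborel. F (f t) * g t)"
proof -
  have gi: "set_integrable lborel {x..y} g" using AC_onD[OF ac] xy by simp
  have Ffc: "continuous_on {x..y} (\<lambda>t. F (f t))"
    using continuous_on_compose2[OF Fc fc rng] .
  show int: "set_integrable lborel {x..y} (\<lambda>t. F (f t) * g t)"
    by (rule set_integrable_continuous_mult[OF Ffc gi])
  define D where "D = (\<lambda>s t. \<Phi> (f t) - \<Phi> (f s) - (LINT \<tau>:{s..t}|lborel. F (f \<tau>) * g \<tau>))"
  define K where "K = (\<lambda>s t. (LINT \<tau>:{s..t}|lborel. \<bar>g \<tau>\<bar>))"
  have ga: "set_integrable lborel {x..y} (\<lambda>t. \<bar>g t\<bar>)" using gi by (rule set_integrable_abs)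
  \<comment> \<open>\<open>f\<close> may decrease, so the mean value form is needed for both orders
    of the endpoints.\<close>
  have mvt': "\<exists>\<xi>. min s t \<le> \<xi> \<and> \<xi> \<le> max s t \<and> \<Phi> t - \<Phi> s = F \<xi> * (t - s)"
    if st: "s \<in> {A..B}" "t \<in> {A..B}" for s t
  proof (cases s t rule: linorder_cases)
    case less then show ?thesis using mvt[of s t] st by fastforce
  next
    case greater
    then obtain \<xi> where "\<xi> \<in> {t..s}" "\<Phi> s - \<Phi> t = F \<xi> * (s - t)" using mvt[of t s] st by auto
    then show ?thesis using greater by (intro exI[of _ \<xi>]) (auto simp: algebra_simps)
  qed auto
  have main: "\<bar>D x y\<bar> \<le> \<epsilon> * K x y" if e: "\<epsilon> > 0" for \<epsilon>
  proof -
    have "uniformly_continuous_on {x..y} (\<lambda>t. F (f t))"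
      using Ffc by (intro compact_uniformly_continuous) auto
    then obtain d where d: "d > 0" and
      dd: "\<And>s t. s \<in> {x..y} \<Longrightarrow> t \<in> {x..y} \<Longrightarrow> \<bar>t - s\<bar> < d \<Longrightarrow> \<bar>F (f t) - F (f s)\<bar> < \<epsilon>"
      unfolding uniformly_continuous_on_def dist_real_def using e by blast
    \<comment> \<open>The restriction to subintervals of \<open>{x..y}\<close> makes
      \<open>P\<close> vacuous elsewhere, because the bisection principle asks for \<open>P\<close>
      on all short intervals around a point.\<close>
    define P where "P = (\<lambda>s t. x \<le> s \<and> s \<le> t \<and> t \<le> y \<longrightarrow> \<bar>D s t\<bar> \<le> \<epsilon> * K s t)"
    have "P x y"
      using xy
    proof (rule Bolzano[where P = P])
      fix a b c assume trans: "P a b" "P b c" "a \<le> b" "b \<le> c"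
      show "P a c" unfolding P_def
      proof
        assume H: "x \<le> a \<and> a \<le> c \<and> c \<le> y"
        have i1: "set_integrable lborel {a..c} (\<lambda>t. F (f t) * g t)" "set_integrable lborel {a..c} (\<lambda>t. \<bar>g t\<bar>)"
          using H int ga by (auto intro!: set_integrable_subset[of _ "{x..y}"])
        have "D a c = D a b + D b c" "K a c = K a b + K b c"
          unfolding D_def K_def using trans(3,4) i1 by (simp_all add: set_integral_Icc_add[of a b c])
        moreover have "\<bar>D a b\<bar> \<le> \<epsilon> * K a b" "\<bar>D b c\<bar> \<le> \<epsilon> * K b c"
          using trans H unfolding P_def by auto
        ultimately show "\<bar>D a c\<bar> \<le> \<epsilon> * K a c"
          using abs_triangle_ineq[of "D a b" "D b c"] by (simp add: distrib_left)
      qed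
    next
      fix z assume "x \<le> z" "z \<le> y"
      show "\<exists>d>0. \<forall>a b. a \<le> z \<and> z \<le> b \<and> b - a < d \<longrightarrow> P a b" unfolding P_def
      proof (intro exI[of _ d] conjI allI impI d)
        fix a b assume ab: "a \<le> z \<and> z \<le> b \<and> b - a < d" and H: "x \<le> a \<and> a \<le> b \<and> b \<le> y"
        have sub: "{a..b} \<subseteq> {x..y}" using H by auto
        have fab: "f a \<in> {A..B}" "f b \<in> {A..B}"
          by (rule subsetD[OF rng], use H in simp)+
        obtain \<xi> where xi: "min (f a) (f b) \<le> \<xi>" "\<xi> \<le> max (f a) (f b)" "\<Phi> (f b) - \<Phi> (f a) = F \<xi> * (f b - f a)"
          using mvt'[OF fab] by auto
        have cab: "continuous_on {a..b} f" using continuous_on_subset[OF fc sub] .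
        \<comment> \<open>By the intermediate value theorem the mean point is itself a value of
          \<open>f\<close> on \<open>{a..b}\<close>; uniform continuity of \<open>F o f\<close> then
          bounds \<open>F \<xi> - F (f t)\<close> by \<open>\<epsilon>\<close>.\<close>
        have "\<exists>r\<ge>a. r \<le> b \<and> f r = \<xi>"
        proof (cases "f a \<le> f b")
          case True then show ?thesis using IVT'[of f a \<xi> b] xi H cab by auto
        next
          case False then show ?thesis using IVT2'[of f b \<xi> a] xi H cab by auto
        qed
        then obtain r where r: "r \<in> {a..b}" "f r = \<xi>" by auto
        have gab: "set_integrable lborel {a..b} g" "f b - f a = (LINT t:{a..b}|lborel. g t)"
          using AC_onD[OF ac, of a b] H by auto
        have i1: "set_integrable lborel {a..b} (\<lambda>t. F (f t) * g t)" "set_integrable lborel {a..b} (\<lambda>t. \<bar>g t\<bar>)"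
          using sub int ga by (auto intro!: set_integrable_subset[of _ "{x..y}"])
        have i2: "set_integrable lborel {a..b} (\<lambda>t. F \<xi> * g t - F (f t) * g t)"
          using gab i1 by simp
        have "D a b = (LINT t:{a..b}|lborel. F \<xi> * g t - F (f t) * g t)"
          unfolding D_def xi gab(2) using gab i1 by simp
        also have "\<bar>\<dots>\<bar> \<le> (LINT t:{a..b}|lborel. \<bar>F \<xi> * g t - F (f t) * g t\<bar>)"
          unfolding set_lebesgue_integral_def
          by (rule order_trans[OF integral_abs_bound]) (simp add: abs_mult)
        also have "\<dots> \<le> (LINT t:{a..b}|lborel. \<epsilon> * \<bar>g t\<bar>)"
        proof (rule set_integral_mono)
          fix t assume t: "t \<in> {a..b}"
          have "\<bar>F (f r) - F (f t)\<bar> < \<epsilon>"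
            using t r ab sub by (intro dd) auto
          then have "\<bar>(F \<xi> - F (f t)) * g t\<bar> \<le> \<epsilon> * \<bar>g t\<bar>"
            unfolding abs_mult r using r by (intro mult_right_mono) auto
          then show "\<bar>F \<xi> * g t - F (f t) * g t\<bar> \<le> \<epsilon> * \<bar>g t\<bar>" by (simp add: algebra_simps)
        qed (use i1 i2 in \<open>auto intro: set_integrable_abs\<close>)
        also have "\<dots> = \<epsilon> * K a b" unfolding K_def by simp
        finally show "\<bar>D a b\<bar> \<le> \<epsilon> * K a b" .
      qed
    qed
    then show ?thesis using xy unfolding P_def by auto
  qed
  have K0: "0 \<le> K x y" unfolding K_def by (rule set_integral_nonneg') simp
  have "\<bar>D x y\<bar> \<le> 0 + e" if "e > 0" for e
  proof -
    have "\<bar>D x y\<bar> \<le> e / (K x y + 1) * K x y" using K0 that by (intro main) auto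
    also have "\<dots> \<le> e" using K0 that by (simp add: field_simps)
    finally show ?thesis by simp
  qed
  then have "\<bar>D x y\<bar> \<le> 0" by (rule field_le_epsilon)
  then show "\<Phi> (f y) - \<Phi> (f x) = (LINT t:{x..y}|lborel. F (f t) * g t)"
    unfolding D_def by simp
qed

text \<open>The elementary bound \<open>2 |a b| \<le> a^2 + b^2\<close> is applied to
  \<open>F (f t)\<close> and \<open>g t\<close>, whose product is the derivative of
  \<open>\<Phi> o f\<close>. Nothing is lost when \<open>|g| = F o f\<close>, which is the equation
  of the soliton for the slope used below.\<close>

lemma calibration_le:
  fixes f g F \<Phi> :: "real \<Rightarrow> real"
  assumes xy: "x \<le> y" and ac: "AC_on {x..y} f g" and fc: "continuous_on {x..y} f"
    and g2: "set_integrable lborel {x..y} (\<lambda>t. (g t)\<^sup>2)"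
    and rng: "f ` {x..y} \<subseteq> {A..B}" and Fc: "continuous_on {A..B} F"
    and mvt: "\<And>s t. A \<le> s \<Longrightarrow> s < t \<Longrightarrow> t \<le> B \<Longrightarrow> \<exists>\<xi>\<in>{s..t}. \<Phi> t - \<Phi> s = F \<xi> * (t - s)"
  shows "2 * \<bar>\<Phi> (f y) - \<Phi> (f x)\<bar> \<le> (LINT t:{x..y}|lborel. (g t)\<^sup>2 + (F (f t))\<^sup>2)"
proof -
  note cr = AC_on_chain_rule[OF xy ac fc rng Fc mvt]
  have "continuous_on {x..y} (\<lambda>t. (F (f t))\<^sup>2)"
    using continuous_on_compose2[OF Fc fc rng] by (intro continuous_intros)
  then have F2: "set_integrable lborel {x..y} (\<lambda>t. (F (f t))\<^sup>2)"
    by (rule borel_integrable_atLeastAtMost')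
  have "\<bar>\<Phi> (f y) - \<Phi> (f x)\<bar> = \<bar>LINT t:{x..y}|lborel. F (f t) * g t\<bar>"
    using cr(2) by simp
  also have "\<dots> \<le> (LINT t:{x..y}|lborel. \<bar>F (f t) * g t\<bar>)"
    unfolding set_lebesgue_integral_def
    by (rule order_trans[OF integral_abs_bound]) (simp add: abs_mult)
  also have "\<dots> \<le> (LINT t:{x..y}|lborel. ((g t)\<^sup>2 + (F (f t))\<^sup>2) / 2)"
  proof (rule set_integral_mono)
    fix t
    have "0 \<le> (\<bar>g t\<bar> - \<bar>F (f t)\<bar>)\<^sup>2" by simp
    then show "\<bar>F (f t) * g t\<bar> \<le> ((g t)\<^sup>2 + (F (f t))\<^sup>2) / 2"
      by (simp add: power2_diff abs_mult algebra_simps)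
  qed (use cr(1) g2 F2 in \<open>auto intro: set_integrable_abs\<close>)
  also have "\<dots> = (LINT t:{x..y}|lborel. (g t)\<^sup>2 + (F (f t))\<^sup>2) / 2" by simp
  finally show ?thesis by simp
qed

text \<open>The absolute value is the limit of the smooth functions \<open>sqrt (t^2 + e^2)\<close>,
  whose derivatives are bounded by 1 and converge to \<open>sgn\<close>, including the value 0 at 0.
  The chain rule for these passes to the limit by dominated convergence.\<close>

lemma AC_on_abs:
  assumes ac: "AC_on I f g" and g2: "set_integrable lborel I (\<lambda>x. (g x)\<^sup>2)" and I: "is_interval I"
  shows "AC_on I (\<lambda>x. \<bar>f x\<bar>) (\<lambda>x. sgn (f x) * g x)"
  unfolding AC_on_def
proof (intro ballI impI)
  fix x y assume x: "x \<in> I" and y: "y \<in> I" and xy: "x \<le> y"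
  have sub: "{x..y} \<subseteq> I" using Icc_subset_interval[OF I x y] .
  have ac': "AC_on {x..y} f g" using AC_on_subset[OF ac sub] .
  have fc: "continuous_on {x..y} f"
    using AC_on_continuous[OF ac g2 I] sub by (rule continuous_on_subset)
  have gi: "set_integrable lborel {x..y} g" using AC_onD[OF ac x y xy] by simp
  have "bounded (f ` {x..y})" using fc by (intro compact_imp_bounded compact_continuous_image) auto
  then obtain C where "\<forall>u\<in>f ` {x..y}. norm u \<le> C"
    unfolding bounded_iff by blast
  then have "\<bar>f t\<bar> \<le> C" if "t \<in> {x..y}" for t using that by simp
  then have rng: "f ` {x..y} \<subseteq> {-C..C}" unfolding abs_le_iff by force
  define e where "e = (\<lambda>n::nat. 1 / (real n + 1))"
  have e0: "e n > 0" for n unfolding e_def by simp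
  have elim: "e \<longlonglongrightarrow> 0" unfolding e_def by real_asymp
  define Ph where "Ph = (\<lambda>n t. sqrt (t\<^sup>2 + (e n)\<^sup>2))"
  define F where "F = (\<lambda>n t. t / sqrt (t\<^sup>2 + (e n)\<^sup>2))"
  have pos: "t\<^sup>2 + (e n)\<^sup>2 > 0" for n t using e0[of n] by (simp add: add_nonneg_pos)
  have der: "(Ph n has_real_derivative F n t) (at t)" for n t
    unfolding Ph_def F_def using pos[of t n]
    by (auto intro!: derivative_eq_intros simp: field_simps)
  have mvt: "\<exists>\<xi>\<in>{s..t}. Ph n t - Ph n s = F n \<xi> * (t - s)"
    if "-C \<le> s" and st: "s < t" and "t \<le> C" for s t n
  proof -
    obtain z where "z > s" "z < t" "Ph n t - Ph n s = (t - s) * F n z"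
      using MVT2[OF st, of "Ph n" "F n"] der by blast
    then show ?thesis by (intro bexI[of _ z]) auto
  qed
  have Fc: "continuous_on {-C..C} (F n)" for n
    unfolding F_def
  proof (intro continuous_intros ballI)
    fix t show "sqrt (t\<^sup>2 + (e n)\<^sup>2) \<noteq> 0" using e0[of n] by simp
  qed
  have eq: "Ph n (f y) - Ph n (f x) = (LINT t:{x..y}|lborel. F n (f t) * g t)" for n
    by (rule AC_on_chain_rule(2)[OF xy ac' fc rng Fc mvt])
  have int: "set_integrable lborel {x..y} (\<lambda>t. F n (f t) * g t)" for n
    by (rule AC_on_chain_rule(1)[OF xy ac' fc rng Fc mvt])
  have Flim: "(\<lambda>n. F n t) \<longlonglongrightarrow> sgn t" for t
  proof (cases "t = 0")
    case False
    have "(\<lambda>n. F n t) \<longlonglongrightarrow> t / sqrt (t\<^sup>2 + 0\<^sup>2)"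
      unfolding F_def by (intro tendsto_intros elim) (use False in simp)
    then show ?thesis using False by (simp add: real_sgn_eq)
  qed (simp add: F_def)
  have Fb: "\<bar>F n t\<bar> \<le> 1" for n t
  proof -
    have "\<bar>t\<bar> \<le> sqrt (t\<^sup>2 + (e n)\<^sup>2)" by (rule real_le_rsqrt) simp
    then show ?thesis unfolding F_def using pos[of t n] by (simp add: divide_le_eq)
  qed
  have gm: "(\<lambda>t. indicator {x..y} t *\<^sub>R g t) \<in> borel_measurable lborel"
    using gi by (auto simp: set_integrable_def dest: borel_measurable_integrable)
  have fm: "(\<lambda>t. indicator {x..y} t *\<^sub>R f t) \<in> borel_measurable borel"
    using fc by (intro borel_measurable_continuous_on_indicator) auto
  have sm: "(\<lambda>t. indicator {x..y} t *\<^sub>R (sgn (f t) * g t)) \<in> borel_measurable lborel"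
  proof -
    have "(\<lambda>t. indicator {x..y} t *\<^sub>R (sgn (f t) * g t))
       = (\<lambda>t. sgn (indicator {x..y} t *\<^sub>R f t) * (indicator {x..y} t *\<^sub>R g t))"
      by (auto split: split_indicator)
    then show ?thesis using gm fm by simp
  qed
  have d1: "integrable lborel (\<lambda>t. \<bar>indicator {x..y} t *\<^sub>R g t\<bar>)"
    using gi by (simp add: set_integrable_def)
  have d2: "AE t in lborel. norm (indicator {x..y} t *\<^sub>R (F n (f t) * g t)) \<le> \<bar>indicator {x..y} t *\<^sub>R g t\<bar>" for n
  proof (rule AE_I2)
    fix t
    have "\<bar>F n (f t)\<bar> * \<bar>g t\<bar> \<le> 1 * \<bar>g t\<bar>" by (intro mult_right_mono Fb) simp
    then show "norm (indicator {x..y} t *\<^sub>R (F n (f t) * g t)) \<le> \<bar>indicator {x..y} t *\<^sub>R g t\<bar>"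
      by (simp add: abs_mult split: split_indicator)
  qed
  have d3: "AE t in lborel. (\<lambda>n. indicator {x..y} t *\<^sub>R (F n (f t) * g t)) \<longlonglongrightarrow> indicator {x..y} t *\<^sub>R (sgn (f t) * g t)"
    by (intro AE_I2 tendsto_intros Flim)
  have d4: "(\<lambda>t. indicat_real {x..y} t *\<^sub>R (F n (f t) * g t)) \<in> borel_measurable lborel" for n
    using int[of n] unfolding set_integrable_def by (rule borel_measurable_integrable)
  have D: "integrable lborel (\<lambda>t. indicator {x..y} t *\<^sub>R (sgn (f t) * g t)) \<and>
     (\<lambda>n. LINT t|lborel. indicator {x..y} t *\<^sub>R (F n (f t) * g t)) \<longlonglongrightarrow>
     (LINT t|lborel. indicator {x..y} t *\<^sub>R (sgn (f t) * g t))"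
    using integrable_dominated_convergence[OF sm d4 d1 d3 d2] integral_dominated_convergence[OF sm d4 d1 d3 d2]
    by (rule conjI)
  have lhs: "(\<lambda>n. Ph n (f y) - Ph n (f x)) \<longlonglongrightarrow> sqrt ((f y)\<^sup>2 + 0\<^sup>2) - sqrt ((f x)\<^sup>2 + 0\<^sup>2)"
    unfolding Ph_def by (intro tendsto_intros elim)
  have "sqrt ((f y)\<^sup>2 + 0\<^sup>2) - sqrt ((f x)\<^sup>2 + 0\<^sup>2) = (LINT t:{x..y}|lborel. sgn (f t) * g t)"
    using D unfolding set_lebesgue_integral_def
    by (intro LIMSEQ_unique[OF lhs]) (simp only: eq set_lebesgue_integral_def)
  then show "set_integrable lborel {x..y} (\<lambda>x. sgn (f x) * g x) \<and>
     \<bar>f y\<bar> - \<bar>f x\<bar> = (LINT t:{x..y}|lborel. sgn (f t) * g t)"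
    using D unfolding set_integrable_def by simp
qed

section \<open>Pointwise bounds and decay at infinity\<close>

lemma continuous_integral_low_point:
  fixes f :: "real \<Rightarrow> real"
  assumes "x < y" "continuous_on {x..y} f"
  obtains z where "z \<in> {x..y}" "(y - x) * (f z)\<^sup>2 \<le> (LINT t:{x..y}|lborel. (f t)\<^sup>2)"
proof -
  have c2: "continuous_on {x..y} (\<lambda>t. (f t)\<^sup>2)" using assms by (intro continuous_intros)
  obtain z where z: "z \<in> {x..y}" "\<And>t. t \<in> {x..y} \<Longrightarrow> (f z)\<^sup>2 \<le> (f t)\<^sup>2"
    using continuous_attains_inf[OF _ _ c2] assms by fastforce
  have "(y - x) * (f z)\<^sup>2 = (LINT t:{x..y}|lborel. (f z)\<^sup>2)"
    using assms by (simp add: set_integral_Icc_const)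
  also have "\<dots> \<le> (LINT t:{x..y}|lborel. (f t)\<^sup>2)"
    using z assms set_integral_Icc_const borel_integrable_atLeastAtMost'[OF c2]
    by (intro set_integral_mono) auto
  finally show ?thesis using that z by blast
qed

text \<open>Somewhere \<open>(f z)^2\<close> is at most its mean over the interval, and every other
  point is reached from there at a Hoelder cost. On unit intervals moving to infinity both terms
  vanish, which yields the decay of \<open>H1_on\<close> functions.\<close>

lemma AC_on_sup_bound:
  assumes "AC_on {p..p+l} f g" "set_integrable lborel {p..p+l} (\<lambda>t. (g t)\<^sup>2)" "l > 0" "x \<in> {p..p+l}"
  shows "\<bar>f x\<bar> \<le> sqrt ((LINT t:{p..p+l}|lborel. (f t)\<^sup>2) / l) + sqrt (l * (LINT t:{p..p+l}|lborel. (g t)\<^sup>2))"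
proof -
  define T where "T = (LINT t:{p..p+l}|lborel. (g t)\<^sup>2)"
  have T0: "T \<ge> 0" unfolding T_def by (rule set_integral_nonneg') simp
  have c: "continuous_on {p..p+l} f" by (rule AC_on_continuous[OF assms(1,2)]) (rule is_interval_cc)
  obtain z where z: "z \<in> {p..p+l}" "(p + l - p) * (f z)\<^sup>2 \<le> (LINT t:{p..p+l}|lborel. (f t)\<^sup>2)"
    using continuous_integral_low_point[OF _ c] assms(3) by auto
  have 1: "\<bar>f z\<bar> \<le> sqrt ((LINT t:{p..p+l}|lborel. (f t)\<^sup>2) / l)"
    using z assms(3) by (intro real_le_rsqrt) (simp add: field_simps)
  have "\<bar>f x - f z\<bar> \<le> sqrt (\<bar>x - z\<bar> * T)"
    by (rule AC_on_Holder[OF assms(1,2) is_interval_cc z(1) assms(4)]) (simp add: T_def)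
  also have "\<dots> \<le> sqrt (l * T)"
    using T0 z(1) assms(4) by (intro real_sqrt_le_mono mult_right_mono) (auto simp: abs_le_iff)
  finally show ?thesis using 1 unfolding T_def by linarith
qed

lemma H1_on_atLeast_tendsto_0:
  assumes "H1_on {a..} f g"
  shows "(f \<longlongrightarrow> 0) at_top"
proof -
  have f2: "set_integrable lborel {a..} (\<lambda>t. (f t)\<^sup>2)" and g2: "set_integrable lborel {a..} (\<lambda>t. (g t)\<^sup>2)"
    and ac: "AC_on {a..} f g" using assms by (auto simp: H1_on_iff)
  \<comment> \<open>The integral over a sliding unit window is the difference of two quantities with
    the same limit.\<close>
  have lim: "((\<lambda>x. LINT t:{x..x+1}|lborel. h t) \<longlongrightarrow> 0) at_top"
    if h: "set_integrable lborel {a..} h" for h :: "real \<Rightarrow> real"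
  proof -
    note L = tendsto_set_lebesgue_integral_at_top[of a lborel h, OF _ h]
    have L1: "((\<lambda>b. LINT t:{a..b}|lborel. h t) \<longlongrightarrow> (LINT t:{a..}|lborel. h t)) at_top" by (rule L) simp
    have L2: "((\<lambda>b. LINT t:{a..b+1}|lborel. h t) \<longlongrightarrow> (LINT t:{a..}|lborel. h t)) at_top"
      by (rule filterlim_compose[OF L1]) real_asymp
    have "((\<lambda>b. (LINT t:{a..b+1}|lborel. h t) - (LINT t:{a..b}|lborel. h t)) \<longlongrightarrow> 0) at_top"
      using tendsto_diff[OF L2 L1] by simp
    then show ?thesis
    proof (rule Lim_transform_eventually)
      show "\<forall>\<^sub>F b in at_top. (LINT t:{a..b+1}|lborel. h t) - (LINT t:{a..b}|lborel. h t) = (LINT t:{b..b+1}|lborel. h t)"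
        using eventually_ge_at_top[of a]
      proof eventually_elim
        case (elim b)
        have "set_integrable lborel {a..b+1} h" using h by (rule set_integrable_subset) auto
        then show ?case using set_integral_Icc_add[of a b "b+1" h] elim by simp
      qed
    qed
  qed
  have "((\<lambda>x. sqrt ((LINT t:{x..x+1}|lborel. (f t)\<^sup>2) / 1) + sqrt (1 * (LINT t:{x..x+1}|lborel. (g t)\<^sup>2))) \<longlongrightarrow> sqrt (0/1) + sqrt (1*0)) at_top"
    by (intro tendsto_intros lim f2 g2) auto
  then have "((\<lambda>x. sqrt ((LINT t:{x..x+1}|lborel. (f t)\<^sup>2) / 1) + sqrt (1 * (LINT t:{x..x+1}|lborel. (g t)\<^sup>2))) \<longlongrightarrow> 0) at_top"
    by simp
  then show ?thesis
  proof (rule Lim_null_comparison[rotated])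
    show "\<forall>\<^sub>F x in at_top. norm (f x) \<le> sqrt ((LINT t:{x..x+1}|lborel. (f t)\<^sup>2) / 1) + sqrt (1 * (LINT t:{x..x+1}|lborel. (g t)\<^sup>2))"
      using eventually_ge_at_top[of a]
    proof eventually_elim
      case (elim x)
      have "{x..x+1} \<subseteq> {a..}" using elim by auto
      then show ?case
        using AC_on_sup_bound[of x 1 f g x] AC_on_subset[OF ac] set_integrable_subset[OF g2] by simp
    qed
  qed
qed

lemma continuous_attains_max_atLeast:
  fixes f :: "real \<Rightarrow> real"
  assumes c: "continuous_on {a..} f" and lim: "(f \<longlongrightarrow> 0) at_top" and nn: "\<And>x. x \<ge> a \<Longrightarrow> f x \<ge> 0"
  obtains x where "x \<ge> a" "\<And>y. y \<ge> a \<Longrightarrow> f y \<le> f x"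
proof (cases "\<exists>z\<ge>a. f z > 0")
  case False
  then have "f y \<le> f a" if "y \<ge> a" for y using nn[of a] that by force
  then show ?thesis using that[of a] by simp
next
  case True
  then obtain z where z: "z \<ge> a" "f z > 0" by blast
  have "eventually (\<lambda>y. f y < f z) at_top" using order_tendstoD(2)[OF lim z(2)] .
  then obtain R where R: "\<And>y. y \<ge> R \<Longrightarrow> f y < f z" unfolding eventually_at_top_linorder by blast
  have zR: "z < R" using R[of z] by force
  have "continuous_on {a..R} f" using c by (rule continuous_on_subset) auto
  then obtain x where x: "x \<in> {a..R}" "\<And>y. y \<in> {a..R} \<Longrightarrow> f y \<le> f x"
    using continuous_attains_sup[of "{a..R}" f] z zR by fastforce
  have "f z \<le> f x" using x(2)[of z] z zR by simp
  then have "f y \<le> f x" if "y \<ge> a" for y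
    using x(2)[of y] R[of y] that by (cases "y \<le> R") auto
  then show ?thesis using that x by auto
qed

section \<open>Calibrating primitives\<close>

definition Prim :: "(real \<Rightarrow> real) \<Rightarrow> real \<Rightarrow> real" where
  "Prim F t = integral {0..t} F"

lemma Prim_has_derivative:
  assumes "continuous_on {0..B} F" "0 < t" "t < B"
  shows "(Prim F has_real_derivative F t) (at t)"
proof -
  have "(Prim F has_real_derivative F t) (at t within {0..B})"
    unfolding Prim_def[abs_def] by (rule integral_has_real_derivative) (use assms in auto)
  then show ?thesis using assms by (simp add: at_within_Icc_at)
qed

lemma continuous_on_Prim:
  assumes "continuous_on {0..B} F"
  shows "continuous_on {0..B} (Prim F)"
  unfolding Prim_def[abs_def]
  by (rule DERIV_continuous_on, rule integral_has_real_derivative[OF assms])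

text \<open>The mean value form covers the endpoints 0 and \<open>B\<close>, where the primitive is
  differentiable only from one side. It is the shape of the hypothesis of the chain rule.\<close>

lemma Prim_mvt:
  assumes c: "continuous_on {0..B} F" and "0 \<le> s" "s < t" "t \<le> B"
  shows "\<exists>\<xi>\<in>{s..t}. Prim F t - Prim F s = F \<xi> * (t - s)"
proof -
  have "continuous_on {s..t} (Prim F)" using continuous_on_Prim[OF c] by (rule continuous_on_subset) (use assms in auto)
  then obtain l z where z: "s < z" "z < t" "DERIV (Prim F) z :> l" "Prim F t - Prim F s = (t - s) * l"
    using MVT[OF \<open>s < t\<close>, of "Prim F"] Prim_has_derivative[OF c] assms
    by (metis le_less_trans less_le_trans real_differentiable_def)
  moreover have "(Prim F has_real_derivative F z) (at z)" using Prim_has_derivative[OF c, of z] z assms by simp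
  ultimately show ?thesis by (metis DERIV_unique atLeastAtMost_iff less_imp_le mult.commute)
qed

lemma Prim_mono:
  assumes "continuous_on {0..B} F" "\<And>t. t \<in> {0..B} \<Longrightarrow> F t \<ge> 0" "0 \<le> s" "s \<le> t" "t \<le> B"
  shows "Prim F s \<le> Prim F t"
proof (cases "s = t")
  case False
  then obtain x where "x \<in> {s..t}" "Prim F t - Prim F s = F x * (t - s)"
    using Prim_mvt[OF assms(1), of s t] assms by auto
  moreover from this have "F x * (t - s) \<ge> 0" using assms(2)[of x] assms(3-5) by (intro mult_nonneg_nonneg) auto
  ultimately show ?thesis by linarith
qed simp

lemma Prim_0 [simp]: "Prim F 0 = 0"
  unfolding Prim_def by simp

text \<open>The square root of \<open>V\<close>. A soliton of height \<open>N\<close>, a multiple of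
  the square root of a hyperbolic secant, solves \<open>|u'| = soliton_slope N u\<close>.\<close>

definition soliton_slope :: "real \<Rightarrow> real \<Rightarrow> real" where
  "soliton_slope N t = t * sqrt ((N^4 - t^4) / 3)"

lemma continuous_on_soliton_slope: "continuous_on S (soliton_slope N)"
  unfolding soliton_slope_def by (intro continuous_intros) auto

lemma soliton_slope_nonneg: "0 \<le> t \<Longrightarrow> t \<le> N \<Longrightarrow> 0 \<le> soliton_slope N t"
  unfolding soliton_slope_def using power_mono[of t N 4] by (intro mult_nonneg_nonneg) auto

lemma soliton_slope_sq:
  assumes "0 \<le> t" "t \<le> N"
  shows "(soliton_slope N t)\<^sup>2 = t\<^sup>2 * (N^4 - t^4) / 3"
  unfolding soliton_slope_def using power_mono[of t N 4] assms by (simp add: power_mult_distrib)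

lemma soliton_slope_le:
  assumes "0 \<le> t"
  shows "soliton_slope N t \<le> t * N\<^sup>2 / sqrt 3"
proof -
  have "sqrt ((N^4 - t^4) / 3) \<le> sqrt (N^4 / 3)"
    by (intro real_sqrt_le_mono divide_right_mono) auto
  also have "sqrt (N^4 / 3) = N\<^sup>2 / sqrt 3"
  proof -
    have "N^4 = (N\<^sup>2)\<^sup>2" by simp
    then show ?thesis by (simp only: real_sqrt_divide real_sqrt_abs) simp
  qed
  finally show ?thesis unfolding soliton_slope_def using mult_left_mono[OF _ assms] by fastforce
qed

lemma Prim_soliton_le:
  assumes "0 \<le> s"
  shows "Prim (soliton_slope N) s \<le> s\<^sup>2 * N\<^sup>2 / (2 * sqrt 3)"
proof -
  define c where "c = N\<^sup>2 / sqrt 3"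
  have I: "((\<lambda>t. t * c) has_integral (s\<^sup>2 * (c / 2) - 0\<^sup>2 * (c / 2))) {0..s}"
    using assms by (intro fundamental_theorem_of_calculus)
      (auto simp: has_real_derivative_iff_has_vector_derivative[symmetric] intro!: derivative_eq_intros)
  have "Prim (soliton_slope N) s \<le> integral {0..s} (\<lambda>t. t * c)"
    unfolding Prim_def
  proof (rule integral_le)
    show "soliton_slope N integrable_on {0..s}"
      by (intro integrable_continuous_real continuous_on_soliton_slope)
    show "soliton_slope N t \<le> t * c" if "t \<in> {0..s}" for t
      using soliton_slope_le[of t N] that by (simp add: c_def)
  qed (use I in auto)
  then show ?thesis using integral_unique[OF I] by (simp add: c_def)
qed

text \<open>The substitution \<open>s = t^2 / N^2\<close> leads to the integral of
  \<open>sqrt (1 - s^2)\<close>. Since \<open>arcsin\<close> is not differentiable at 1, derivatives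
  are taken only in the interior. The case \<open>M < N\<close> is needed at the critical mass,
  where \<open>N\<close> is perturbed.\<close>

lemma Prim_soliton:
  assumes N: "0 < N" and M: "0 \<le> M" "M \<le> N"
  shows "Prim (soliton_slope N) M = N^4 / (4 * sqrt 3) *
    (arcsin (M\<^sup>2 / N\<^sup>2) + M\<^sup>2 / N\<^sup>2 * sqrt (1 - (M\<^sup>2 / N\<^sup>2)\<^sup>2))"
proof -
  define H where "H = (\<lambda>t. N^4 / (4 * sqrt 3) * (arcsin (t\<^sup>2 / N\<^sup>2) + t\<^sup>2 / N\<^sup>2 * sqrt (1 - (t\<^sup>2 / N\<^sup>2)\<^sup>2)))"
  have r: "t\<^sup>2 / N\<^sup>2 \<le> 1" if "0 \<le> t" "t \<le> M" for t
    using that M N by (simp add: power_mono)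
  have c: "continuous_on {0..M} H"
    unfolding H_def
    by (intro continuous_intros) (use N r in \<open>auto simp: order_trans[of "-1" 0]\<close>)
  have d: "(H has_vector_derivative soliton_slope N t) (at t)" if t: "t \<in> {0<..<M}" for t
  proof -
    define s where "s = t\<^sup>2 / N\<^sup>2"
    have s: "0 < s" "s < 1" unfolding s_def using t M N by (auto simp: power_strict_mono)
    then have s2: "s\<^sup>2 < 1" by (simp add: power_less_one_iff abs_square_less_1)
    define w where "w = sqrt (1 - s\<^sup>2)"
    have w: "w > 0" "w\<^sup>2 = 1 - s\<^sup>2" unfolding w_def using s2 by auto
    have ds: "((\<lambda>t. t\<^sup>2 / N\<^sup>2) has_real_derivative 2 * t / N\<^sup>2) (at t)"
      by (rule DERIV_cdivide) (auto intro!: derivative_eq_intros)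
    have dg: "((\<lambda>s. arcsin s + s * sqrt (1 - s\<^sup>2)) has_real_derivative 2 * w) (at s)"
    proof -
      have "((\<lambda>s. arcsin s + s * sqrt (1 - s\<^sup>2)) has_real_derivative
         inverse w + (w + s * ((- (2 * s)) * (inverse w / 2)))) (at s)"
        using s s2 unfolding w_def by (auto intro!: derivative_eq_intros simp: field_simps)
      moreover have "inverse w + (w + s * ((- (2 * s)) * (inverse w / 2))) = 2 * w"
        using w by (simp add: field_simps power2_eq_square)
      ultimately show ?thesis by (simp only:)
    qed
    have "((\<lambda>t. arcsin (t\<^sup>2 / N\<^sup>2) + t\<^sup>2 / N\<^sup>2 * sqrt (1 - (t\<^sup>2 / N\<^sup>2)\<^sup>2)) has_real_derivative 2 * w * (2 * t / N\<^sup>2)) (at t)"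
      using DERIV_chain2[OF dg[unfolded s_def] ds] by simp
    then have "(H has_real_derivative N^4 / (4 * sqrt 3) * (2 * w * (2 * t / N\<^sup>2))) (at t)"
      unfolding H_def by (rule DERIV_cmult)
    moreover have "N^4 / (4 * sqrt 3) * (2 * w * (2 * t / N\<^sup>2)) = soliton_slope N t"
    proof -
      have "(N\<^sup>2 * w / sqrt 3)\<^sup>2 = (N^4 - t^4) / 3"
        using N by (simp add: power_mult_distrib power_divide w(2)) (simp add: s_def field_simps)
      then have "sqrt ((N^4 - t^4) / 3) = N\<^sup>2 * w / sqrt 3"
        using w by (intro real_sqrt_unique) auto
      then show ?thesis unfolding soliton_slope_def using N
        by (simp add: field_simps power4_eq_xxxx power2_eq_square)
    qed
    ultimately show ?thesis by (simp add: has_real_derivative_iff_has_vector_derivative)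
  qed
  have "(soliton_slope N has_integral H M - H 0) {0..M}"
    by (rule fundamental_theorem_of_calculus_interior[OF M(1) c d])
  then show ?thesis unfolding Prim_def by (simp add: integral_unique H_def)
qed

lemma Prim_soliton_peak:
  assumes "M > 0"
  shows "Prim (soliton_slope M) M = M^4 * pi / (8 * sqrt 3)"
  using Prim_soliton[of M M] assms by (simp add: field_simps)

text \<open>For \<open>t \<ge> a\<close> the factor \<open>1 - a\<^sup>2 / t\<^sup>2\<close> leaves \<open>a\<^sup>2 (M\<^sup>4 - t\<^sup>4) / 3\<close> of the potential unused; on a
  half edge with \<open>u \<ge> a\<close> this is the gain that beats the logarithmic loss in the primitive.\<close>

definition damped_slope :: "real \<Rightarrow> real \<Rightarrow> real \<Rightarrow> real" where
  "damped_slope a M t = max 0 (t - a\<^sup>2 / max t a) * sqrt ((M^4 - t^4) / 3)"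

text \<open>\<open>max t a\<close> keeps the quotient bounded near 0, and the outer
  \<open>max\<close> makes the slope vanish for \<open>t \<le> a\<close>; the two regimes match at
  \<open>t = a\<close>.\<close>

lemma continuous_on_damped_slope: "a > 0 \<Longrightarrow> continuous_on S (damped_slope a M)"
  unfolding damped_slope_def by (intro continuous_intros) auto

lemma damped_slope_nonneg: "0 \<le> t \<Longrightarrow> t \<le> M \<Longrightarrow> 0 \<le> damped_slope a M t"
  unfolding damped_slope_def using power_mono[of t M 4] by (intro mult_nonneg_nonneg) auto

text \<open>The second claim rests on
  \<open>(t - a^2 / t)^2 + a^2 = t^2 - a^2 (1 - a^2 / t^2)\<close>, which is at most
  \<open>t^2\<close> once \<open>a \<le> t\<close>.\<close>

lemma damped_slope_sq_le:
  assumes a: "0 < a" and t: "0 \<le> t" "t \<le> M"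
  shows "(damped_slope a M t)\<^sup>2 \<le> t\<^sup>2 * (M^4 - t^4) / 3"
    and "a \<le> t \<Longrightarrow> (damped_slope a M t)\<^sup>2 + a\<^sup>2 * (M^4 - t^4) / 3 \<le> t\<^sup>2 * (M^4 - t^4) / 3"
proof -
  have p: "t^4 \<le> M^4" using t by (simp add: power_mono)
  have sq: "(damped_slope a M t)\<^sup>2 = (max 0 (t - a\<^sup>2 / max t a))\<^sup>2 * ((M^4 - t^4) / 3)"
    unfolding damped_slope_def using p by (simp add: power_mult_distrib)
  have "0 \<le> a\<^sup>2 / max t a" using a by (intro divide_nonneg_nonneg) auto
  then have "(max 0 (t - a\<^sup>2 / max t a))\<^sup>2 \<le> t\<^sup>2" using t by (intro power_mono) auto
  then have "(max 0 (t - a\<^sup>2 / max t a))\<^sup>2 * ((M^4 - t^4) / 3) \<le> t\<^sup>2 * ((M^4 - t^4) / 3)"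
    using p by (intro mult_right_mono) auto
  then show "(damped_slope a M t)\<^sup>2 \<le> t\<^sup>2 * (M^4 - t^4) / 3" using sq by simp
  assume at: "a \<le> t"
  have tp: "t > 0" using a at by simp
  have a2: "a\<^sup>2 \<le> t\<^sup>2" using a at by (simp add: power_mono)
  then have "a\<^sup>2 / t \<le> t" using tp by (simp add: divide_le_eq power2_eq_square)
  then have mx: "max 0 (t - a\<^sup>2 / max t a) = t - a\<^sup>2 / t" using at by (simp add: max_def)
  have "(t - a\<^sup>2 / t)\<^sup>2 + a\<^sup>2 = t\<^sup>2 - a\<^sup>2 * (1 - a\<^sup>2 / t\<^sup>2)"
    using tp by (simp add: field_simps power2_eq_square)
  also have "\<dots> \<le> t\<^sup>2" using a2 tp by (simp add: divide_le_eq)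
  finally have "((t - a\<^sup>2 / t)\<^sup>2 + a\<^sup>2) * ((M^4 - t^4) / 3) \<le> t\<^sup>2 * ((M^4 - t^4) / 3)"
    using p by (intro mult_right_mono) auto
  then show "(damped_slope a M t)\<^sup>2 + a\<^sup>2 * (M^4 - t^4) / 3 \<le> t\<^sup>2 * (M^4 - t^4) / 3"
    unfolding sq mx by (simp add: distrib_right)
qed

text \<open>Above \<open>a\<close> the two slopes differ by at most
  \<open>a^2 M^2 / (sqrt 3 t)\<close>, whose integral is the logarithmic term; \<open>H\<close>
  compensates for it and is therefore increasing. The remaining loss is the part of the soliton
  primitive below \<open>a\<close>.\<close>

lemma Prim_damped_ge:
  assumes a: "0 < a" "a \<le> M"
  shows "Prim (damped_slope a M) M - Prim (damped_slope a M) a \<ge>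
    M^4 * pi / (8 * sqrt 3) - a\<^sup>2 * M\<^sup>2 / (2 * sqrt 3) - a\<^sup>2 * M\<^sup>2 / sqrt 3 * ln (M / a)"
proof -
  define H where "H = (\<lambda>t. Prim (damped_slope a M) t - Prim (soliton_slope M) t + a\<^sup>2 * M\<^sup>2 / sqrt 3 * ln t)"
  note c1 = continuous_on_damped_slope[OF a(1), of "{0..M}" M] and c2 = continuous_on_soliton_slope[of "{0..M}" M]
  have "H a \<le> H M"
  proof (rule DERIV_nonneg_imp_increasing_open[OF a(2)])
    have sub: "{a..M} \<subseteq> {0..M}" using a by auto
    show "continuous_on {a..M} H" unfolding H_def
      by (intro continuous_intros continuous_on_subset[OF continuous_on_Prim[OF c1] sub] continuous_on_subset[OF continuous_on_Prim[OF c2] sub]) (use a in auto)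
    fix t assume t: "a < t" "t < M"
    have t0: "t > 0" using t a by simp
    have "(H has_real_derivative damped_slope a M t - soliton_slope M t + a\<^sup>2 * M\<^sup>2 / sqrt 3 * (1 / t)) (at t)"
      unfolding H_def
      by (intro DERIV_add DERIV_diff DERIV_cmult Prim_has_derivative[OF c1] Prim_has_derivative[OF c2] DERIV_ln_divide) (use t t0 in auto)
    moreover have "damped_slope a M t - soliton_slope M t + a\<^sup>2 * M\<^sup>2 / sqrt 3 * (1 / t) \<ge> 0"
    proof -
      have "sqrt ((M^4 - t^4) / 3) \<le> M\<^sup>2 / sqrt 3"
        using soliton_slope_le[of t M] t0 unfolding soliton_slope_def
        by (simp add: field_simps mult_le_cancel_left_pos)
      then have "a\<^sup>2 / t * sqrt ((M^4 - t^4) / 3) \<le> a\<^sup>2 / t * (M\<^sup>2 / sqrt 3)"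
        using t0 by (intro mult_left_mono) auto
      moreover have "(t - a\<^sup>2 / t) * sqrt ((M^4 - t^4) / 3) \<le> damped_slope a M t"
        unfolding damped_slope_def using t power_mono[of t M 4] t0 by (intro mult_right_mono) auto
      ultimately show ?thesis unfolding soliton_slope_def by (simp add: algebra_simps)
    qed
    ultimately show "\<exists>y. (H has_real_derivative y) (at t) \<and> 0 \<le> y" by blast
  qed
  moreover have "Prim (soliton_slope M) a \<le> a\<^sup>2 * M\<^sup>2 / (2 * sqrt 3)" using a by (intro Prim_soliton_le) auto
  moreover have "Prim (soliton_slope M) M = M^4 * pi / (8 * sqrt 3)" using a by (intro Prim_soliton_peak) auto
  moreover have "a\<^sup>2 * M\<^sup>2 / sqrt 3 * ln (M / a) = a\<^sup>2 * M\<^sup>2 / sqrt 3 * ln M - a\<^sup>2 * M\<^sup>2 / sqrt 3 * ln a"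
    using a by (simp add: ln_div right_diff_distrib)
  ultimately show ?thesis unfolding H_def by linarith
qed

section \<open>Lower semicontinuity of the Dirichlet integral\<close>

text \<open>The bound is required only eventually, so that it can be used along tails of
  subsequences.\<close>

lemma Fatou_real:
  fixes f :: "nat \<Rightarrow> 'a \<Rightarrow> real"
  assumes int: "\<And>i. integrable M (f i)" and nn: "\<And>i x. 0 \<le> f i x" and Fm: "F \<in> borel_measurable M"
    and lim: "AE x in M. (\<lambda>i. f i x) \<longlonglongrightarrow> F x" and C: "eventually (\<lambda>i. integral\<^sup>L M (f i) \<le> C) sequentially"
  shows "integrable M F" "integral\<^sup>L M F \<le> C"
proof -
  have Fnn: "AE x in M. 0 \<le> F x"
    using lim by eventually_elim (auto intro: LIMSEQ_le_const nn)
  have [measurable]: "\<And>i. f i \<in> borel_measurable M" using int by auto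
  have "(\<integral>\<^sup>+x. ennreal (F x) \<partial>M) = (\<integral>\<^sup>+x. liminf (\<lambda>i. ennreal (f i x)) \<partial>M)"
  proof (rule nn_integral_cong_AE)
    show "AE x in M. ennreal (F x) = liminf (\<lambda>i. ennreal (f i x))"
      using lim
    proof eventually_elim
      case (elim x)
      then have "(\<lambda>i. ennreal (f i x)) \<longlonglongrightarrow> ennreal (F x)" by (rule tendsto_ennrealI)
      then show ?case by (simp add: lim_imp_Liminf)
    qed
  qed
  also have "\<dots> \<le> liminf (\<lambda>i. \<integral>\<^sup>+x. ennreal (f i x) \<partial>M)"
    by (rule nn_integral_liminf) measurable
  also have "\<dots> = liminf (\<lambda>i. ennreal (integral\<^sup>L M (f i)))"
    using int nn by (simp add: nn_integral_eq_integral)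
  also have "\<dots> \<le> ennreal C"
  proof -
    have "liminf (\<lambda>i. ennreal (integral\<^sup>L M (f i))) \<le> liminf (\<lambda>i::nat. ennreal C)"
      by (rule Liminf_mono) (use C in \<open>auto elim!: eventually_mono intro: ennreal_leI\<close>)
    then show ?thesis by (simp add: Liminf_const)
  qed
  finally have le: "(\<integral>\<^sup>+x. ennreal (F x) \<partial>M) \<le> ennreal C" .
  have fin: "(\<integral>\<^sup>+x. ennreal (F x) \<partial>M) < \<infinity>" 
    using le_less_trans[OF le ennreal_less_top] by simp
  show i: "integrable M F"
    by (rule integrableI_nonneg[OF Fm Fnn fin])
  have C0: "0 \<le> C"
  proof -
    obtain i where "integral\<^sup>L M (f i) \<le> C" using C eventually_happens'[OF sequentially_bot] by blast
    moreover have "0 \<le> integral\<^sup>L M (f i)" using nn by simp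
    ultimately show ?thesis by simp
  qed
  have "ennreal (integral\<^sup>L M F) \<le> ennreal C"
    using le nn_integral_eq_integral[OF i Fnn] by simp
  then show "integral\<^sup>L M F \<le> C" using C0 by simp
qed

text \<open>The left side is at most \<open>|a - b| (|a| + |b|)\<close>, and Young's inequality with
  weight \<open>e\<close> separates the factors. After integration, small differences in
  \<open>L^2\<close> give small differences of signed squares in \<open>L^1\<close>.\<close>

lemma abs_signed_square_diff_le:
  fixes a b e :: real
  assumes "e > 0"
  shows "\<bar>a * \<bar>a\<bar> - b * \<bar>b\<bar>\<bar> \<le> (a - b)\<^sup>2 / e + e * (a\<^sup>2 + b\<^sup>2)"
proof -
  have 1: "\<bar>a * \<bar>a\<bar> - b * \<bar>b\<bar>\<bar> \<le> \<bar>a - b\<bar> * (\<bar>a\<bar> + \<bar>b\<bar>)"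
  proof -
    have "a * \<bar>a\<bar> - b * \<bar>b\<bar> = (a - b) * \<bar>a\<bar> + b * (\<bar>a\<bar> - \<bar>b\<bar>)" by (simp add: algebra_simps)
    then have "\<bar>a * \<bar>a\<bar> - b * \<bar>b\<bar>\<bar> \<le> \<bar>a - b\<bar> * \<bar>a\<bar> + \<bar>b\<bar> * \<bar>\<bar>a\<bar> - \<bar>b\<bar>\<bar>"
      by (metis abs_abs abs_mult abs_triangle_ineq)
    moreover have "\<bar>b\<bar> * \<bar>\<bar>a\<bar> - \<bar>b\<bar>\<bar> \<le> \<bar>b\<bar> * \<bar>a - b\<bar>"
      by (rule mult_left_mono) (rule abs_triangle_ineq3, simp)
    ultimately show ?thesis by (simp add: algebra_simps)
  qed
  define d where "d = \<bar>a - b\<bar>"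
  define s where "s = \<bar>a\<bar> + \<bar>b\<bar>"
  have "0 \<le> (d - e * s / 2)\<^sup>2" by simp
  then have "d * s * e \<le> d\<^sup>2 + e\<^sup>2 * s\<^sup>2 / 4" by (simp add: power2_eq_square algebra_simps)
  then have "d * s \<le> d\<^sup>2 / e + e * (s\<^sup>2 / 4)" using assms by (simp add: field_simps power2_eq_square)
  moreover have "s\<^sup>2 / 4 \<le> a\<^sup>2 + b\<^sup>2"
  proof -
    have "0 \<le> (\<bar>a\<bar> - \<bar>b\<bar>)\<^sup>2" by simp
    then have "2 * (\<bar>a\<bar> * \<bar>b\<bar>) \<le> a\<^sup>2 + b\<^sup>2" unfolding power2_diff by simp
    moreover have "s\<^sup>2 = a\<^sup>2 + b\<^sup>2 + 2 * (\<bar>a\<bar> * \<bar>b\<bar>)" unfolding s_def power2_sum by simp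
    moreover have "0 \<le> a\<^sup>2 + b\<^sup>2" by simp
    ultimately show ?thesis by linarith
  qed
  then have "e * (s\<^sup>2 / 4) \<le> e * (a\<^sup>2 + b\<^sup>2)" using assms by (intro mult_left_mono) auto
  moreover have "d\<^sup>2 / e = (a - b)\<^sup>2 / e" unfolding d_def by simp
  ultimately show ?thesis using 1[folded d_def s_def] by linarith
qed

section \<open>Completeness of the space of square integrable functions\<close>

lemma integrable_square_diff:
  fixes f g :: "'a \<Rightarrow> real"
  assumes [measurable]: "f \<in> borel_measurable M" "g \<in> borel_measurable M"
    and "integrable M (\<lambda>x. (f x)\<^sup>2)" "integrable M (\<lambda>x. (g x)\<^sup>2)"
  shows "integrable M (\<lambda>x. (f x - g x)\<^sup>2)"
proof (rule Bochner_Integration.integrable_bound)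
  show "integrable M (\<lambda>x. 2 * (f x)\<^sup>2 + 2 * (g x)\<^sup>2)" using assms by simp
  show "AE x in M. norm ((f x - g x)\<^sup>2) \<le> norm (2 * (f x)\<^sup>2 + 2 * (g x)\<^sup>2)"
  proof (rule AE_I2)
    fix x
    have "(f x - g x)\<^sup>2 + (f x + g x)\<^sup>2 = 2 * (f x)\<^sup>2 + 2 * (g x)\<^sup>2"
      by (simp add: power2_diff power2_sum)
    moreover have "0 \<le> (f x + g x)\<^sup>2" "0 \<le> (f x - g x)\<^sup>2" by simp_all
    ultimately show "norm ((f x - g x)\<^sup>2) \<le> norm (2 * (f x)\<^sup>2 + 2 * (g x)\<^sup>2)"
      unfolding real_norm_def by linarith
  qed
qed measurable

text \<open>The signed squares \<open>g \<bar>g\<bar>\<close> form a Cauchy sequence in \<open>L\<^sup>1\<close>, which reduces completeness of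
  \<open>L\<^sup>2\<close> to the almost everywhere convergence of an \<open>L\<^sup>1\<close>-Cauchy subsequence.\<close>

lemma L2_Cauchy_limit:
  fixes g :: "nat \<Rightarrow> 'a \<Rightarrow> real"
  assumes m [measurable]: "\<And>n. g n \<in> borel_measurable M"
    and int: "\<And>n. integrable M (\<lambda>x. (g n x)\<^sup>2)" and bd: "\<And>n. (LINT x|M. (g n x)\<^sup>2) \<le> B"
    and cauchy: "\<And>e. e > 0 \<Longrightarrow> \<exists>N. \<forall>i\<ge>N. \<forall>j\<ge>N. (LINT x|M. (g i x - g j x)\<^sup>2) \<le> e"
  obtains h where "h \<in> borel_measurable M" "integrable M (\<lambda>x. (h x)\<^sup>2)"
    "\<forall>C. eventually (\<lambda>n. (LINT x|M. (g n x)\<^sup>2) \<le> C) sequentially \<longrightarrow> (LINT x|M. (h x)\<^sup>2) \<le> C"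
    "(\<lambda>n. LINT x|M. (g n x - h x)\<^sup>2) \<longlonglongrightarrow> 0" "\<forall>n. integrable M (\<lambda>x. (g n x - h x)\<^sup>2)"
proof -
  have dint: "integrable M (\<lambda>x. (g i x - g j x)\<^sup>2)" for i j
    by (rule integrable_square_diff) (use int in auto)
  define s where "s = (\<lambda>n x. g n x * \<bar>g n x\<bar>)"
  have [measurable]: "s n \<in> borel_measurable M" for n unfolding s_def by measurable
  have sint: "integrable M (s n)" for n
    by (rule Bochner_Integration.integrable_bound[OF int[of n]]) (auto simp: s_def abs_mult power2_eq_square)
  have B0: "0 \<le> B" 
  proof -
    have "0 \<le> (LINT x|M. (g 0 x)\<^sup>2)" by simp
    then show ?thesis using bd[of 0] by linarith
  qed
  have "\<exists>N. \<forall>i\<ge>N. \<forall>j\<ge>N. (LINT x|M. norm (s i x - s j x)) < e" if e: "e > 0" for e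
  proof -
    \<comment> \<open>With this weight the term \<open>d * (B + B)\<close> is at most
      \<open>e / 2\<close>, and the tolerance \<open>e * d / 4\<close> for the square differences
      turns the other term into \<open>e / 4\<close>.\<close>
    define d where "d = e / (4 * (B + 1))"
    have d: "d > 0" unfolding d_def using e B0 by simp
    obtain N where N: "\<And>i j. i \<ge> N \<Longrightarrow> j \<ge> N \<Longrightarrow> (LINT x|M. (g i x - g j x)\<^sup>2) \<le> e * d / 4"
      using cauchy[of "e * d / 4"] e d by auto
    have "(LINT x|M. norm (s i x - s j x)) < e" if ij: "i \<ge> N" "j \<ge> N" for i j
    proof -
      have "(LINT x|M. norm (s i x - s j x)) \<le> (LINT x|M. (g i x - g j x)\<^sup>2 / d + d * ((g i x)\<^sup>2 + (g j x)\<^sup>2))"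
      proof (rule integral_mono)
        show "integrable M (\<lambda>x. norm (s i x - s j x))" using sint by auto
        show "integrable M (\<lambda>x. (g i x - g j x)\<^sup>2 / d + d * ((g i x)\<^sup>2 + (g j x)\<^sup>2))"
          using dint int by auto
        show "norm (s i x - s j x) \<le> (g i x - g j x)\<^sup>2 / d + d * ((g i x)\<^sup>2 + (g j x)\<^sup>2)" for x
          unfolding s_def real_norm_def using d by (rule abs_signed_square_diff_le)
      qed
      also have "\<dots> = (LINT x|M. (g i x - g j x)\<^sup>2) / d + d * ((LINT x|M. (g i x)\<^sup>2) + (LINT x|M. (g j x)\<^sup>2))"
        using dint int by simp
      also have "\<dots> \<le> (e * d / 4) / d + d * (B + B)"
        using N[OF ij] d bd[of i] bd[of j] by (intro add_mono divide_right_mono mult_left_mono) auto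
      also have "\<dots> \<le> e / 4 + e / 2"
      proof -
        have "d * (B + B) = e / 2 * (B / (B + 1))" unfolding d_def using B0 by (simp add: field_simps)
        also have "\<dots> \<le> e / 2 * 1" using e B0 by (intro mult_left_mono) auto
        finally have "d * (B + B) \<le> e / 2" by simp
        moreover have "(e * d / 4) / d = e / 4" using d by simp
        ultimately show ?thesis by linarith
      qed
      finally show ?thesis using e by simp
    qed
    then show ?thesis by blast
  qed
  then obtain r where r: "strict_mono r" and aec: "AE x in M. Cauchy (\<lambda>i. s (r i) x)"
    by (rule cauchy_L1_AE_cauchy_subseq[OF sint])
  have gs: "g n x = sgn (s n x) * sqrt \<bar>s n x\<bar>" for n x
    unfolding s_def by (cases "g n x" "0::real" rule: linorder_cases) (simp_all add: abs_mult sgn_mult real_sqrt_mult)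
  \<comment> \<open>The signed square root is \<open>root 2\<close>, extended oddly to negative
    arguments; its continuity carries the convergence of \<open>s\<close> back to
    \<open>g\<close>.\<close>
  have sq_cont: "continuous_on UNIV (\<lambda>t::real. sgn t * sqrt \<bar>t\<bar>)"
  proof -
    have eq: "(\<lambda>t::real. sgn t * sqrt \<bar>t\<bar>) = (\<lambda>t. root 2 t)"
    proof
      fix t :: real show "sgn t * sqrt \<bar>t\<bar> = root 2 t"
        by (cases "t \<ge> 0") (auto simp: sqrt_def sgn_real_def real_root_minus)
    qed
    show ?thesis unfolding eq by (intro continuous_intros)
  qed
  define h where "h = (\<lambda>x. lim (\<lambda>i. g (r i) x))"
  have aeh: "AE x in M. (\<lambda>i. g (r i) x) \<longlonglongrightarrow> h x"
    using aec
  proof eventually_elim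
    case (elim x)
    then obtain l where "(\<lambda>i. s (r i) x) \<longlonglongrightarrow> l" using Cauchy_convergent convergent_def by blast
    then have "(\<lambda>i. sgn (s (r i) x) * sqrt \<bar>s (r i) x\<bar>) \<longlonglongrightarrow> sgn l * sqrt \<bar>l\<bar>"
      using continuous_on_tendsto_compose[OF sq_cont] by auto
    then have "convergent (\<lambda>i. g (r i) x)" unfolding gs[symmetric] convergent_def by blast
    then show ?case unfolding h_def by (simp add: convergent_LIMSEQ_iff)
  qed
  have hm [measurable]: "h \<in> borel_measurable M" unfolding h_def by measurable
  have rinf: "filterlim r sequentially sequentially" using r by (rule filterlim_subseq)
  have h2: "integrable M (\<lambda>x. (h x)\<^sup>2) \<and> (LINT x|M. (h x)\<^sup>2) \<le> C"
    if "eventually (\<lambda>n. (LINT x|M. (g n x)\<^sup>2) \<le> C) sequentially" for C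
  proof -
    have "AE x in M. (\<lambda>i. (g (r i) x)\<^sup>2) \<longlonglongrightarrow> (h x)\<^sup>2"
      using aeh by eventually_elim (intro tendsto_intros)
    moreover have "eventually (\<lambda>i. (LINT x|M. (g (r i) x)\<^sup>2) \<le> C) sequentially"
      using eventually_compose_filterlim[OF that rinf] .
    ultimately show ?thesis
      using Fatou_real[of M "\<lambda>i x. (g (r i) x)\<^sup>2" "\<lambda>x. (h x)\<^sup>2" C] int by auto
  qed
  have hi: "integrable M (\<lambda>x. (h x)\<^sup>2)" using h2[of B] bd by auto
  have di: "integrable M (\<lambda>x. (g n x - h x)\<^sup>2)" for n
    by (rule integrable_square_diff) (use int hi in auto)
  \<comment> \<open>Fatou with \<open>n\<close> fixed and the second index running along the
    subsequence turns the Cauchy property into convergence to \<open>h\<close>.\<close>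
  have dle: "(LINT x|M. (g n x - h x)\<^sup>2) \<le> e"
    if "\<And>j. j \<ge> N \<Longrightarrow> (LINT x|M. (g n x - g j x)\<^sup>2) \<le> e" for n N e
  proof (rule Fatou_real(2)[of M "\<lambda>i x. (g n x - g (r i) x)\<^sup>2"])
    show "AE x in M. (\<lambda>i. (g n x - g (r i) x)\<^sup>2) \<longlonglongrightarrow> (g n x - h x)\<^sup>2"
      using aeh by eventually_elim (intro tendsto_intros)
    have "eventually (\<lambda>j. (LINT x|M. (g n x - g j x)\<^sup>2) \<le> e) sequentially"
      using that eventually_sequentially by blast
    then show "eventually (\<lambda>i. (LINT x|M. (g n x - g (r i) x)\<^sup>2) \<le> e) sequentially"
      using eventually_compose_filterlim[OF _ rinf] by blast
  qed (use dint in auto)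
  have lim0: "(\<lambda>n. LINT x|M. (g n x - h x)\<^sup>2) \<longlonglongrightarrow> 0"
  proof (rule LIMSEQ_I)
    fix e :: real assume e: "e > 0"
    obtain N where N: "\<And>i j. i \<ge> N \<Longrightarrow> j \<ge> N \<Longrightarrow> (LINT x|M. (g i x - g j x)\<^sup>2) \<le> e / 2"
      using cauchy[of "e / 2"] e by auto
    have "norm ((LINT x|M. (g n x - h x)\<^sup>2) - 0) < e" if "n \<ge> N" for n
    proof -
      have "(LINT x|M. (g n x - h x)\<^sup>2) \<le> e / 2" by (rule dle[of N]) (rule N[OF that])
      moreover have "0 \<le> (LINT x|M. (g n x - h x)\<^sup>2)" by simp
      ultimately show ?thesis using e by simp
    qed
    then show "\<exists>N. \<forall>n\<ge>N. norm ((LINT x|M. (g n x - h x)\<^sup>2) - 0) < e" by blast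
  qed
  show ?thesis by (rule that[OF hm hi _ lim0]) (use h2 di in auto)
qed

section \<open>Weak derivatives on edge domains\<close>

definition edge_interval :: "real set \<Rightarrow> bool" where
  "edge_interval I \<longleftrightarrow> (\<exists>a b. I = {a..b}) \<or> (\<exists>a. I = {a..})"

lemma edge_intervalD:
  assumes "edge_interval I"
  shows "is_interval I" "I \<in> sets lborel" "I \<in> sets borel"
  using assms unfolding edge_interval_def by (auto simp: is_interval_cc is_interval_ci)

text \<open>Square integrability speaks of \<open>g^2\<close> and says nothing about the sign of
  \<open>g\<close>. Measurability of \<open>g\<close> itself comes from its integrability over
  compact intervals, which exhaust a halfline.\<close>

lemma AC_on_deriv_measurable:
  assumes I: "edge_interval I" and ac: "AC_on I f g"
  shows "(\<lambda>x. indicat_real I x * g x) \<in> borel_measurable borel"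
  using I unfolding edge_interval_def
proof (elim disjE exE)
  fix a b assume I: "I = {a..b}"
  show ?thesis
  proof (cases "a \<le> b")
    case True
    then have "set_integrable lborel {a..b} g" using AC_onD[OF ac, of a b] I by simp
    then show ?thesis unfolding set_integrable_def I using borel_measurable_integrable by fastforce
  qed (simp add: I)
next
  fix a assume I: "I = {a..}"
  show ?thesis
  proof (rule borel_measurable_LIMSEQ_real)
    fix n :: nat
    have "set_integrable lborel {a..a + real n} g" using AC_onD[OF ac, of a "a + real n"] I by simp
    then show "(\<lambda>x. indicat_real {a..a + real n} x * g x) \<in> borel_measurable borel"
      unfolding set_integrable_def using borel_measurable_integrable by fastforce
  next
    fix x
    show "(\<lambda>n. indicat_real {a..a + real n} x * g x) \<longlonglongrightarrow> indicat_real I x * g x"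
    proof (rule tendsto_eventually)
      obtain N :: nat where N: "x - a < real N" using reals_Archimedean2 by blast
      have "indicat_real {a..a + real n} x * g x = indicat_real I x * g x" if "n \<ge> N" for n
      proof -
        have "real N \<le> real n" using that by simp
        then show ?thesis using N unfolding I by (auto simp: indicator_def)
      qed
      then show "\<forall>\<^sub>F n in sequentially. indicat_real {a..a + real n} x * g x = indicat_real I x * g x"
        unfolding eventually_sequentially by blast
    qed
  qed
qed

lemma AC_on_midpoint:
  assumes "AC_on I p q" "AC_on I p' q'"
  shows "AC_on I (\<lambda>x. (p x + p' x) / 2) (\<lambda>x. (q x + q' x) / 2)"
  unfolding AC_on_def
proof (intro ballI impI)
  fix x y assume xy: "x \<in> I" "y \<in> I" "x \<le> y"
  show "set_integrable lborel {x..y} (\<lambda>x. (q x + q' x) / 2) \<and>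
     (p y + p' y) / 2 - (p x + p' x) / 2 = (LINT t:{x..y}|lborel. (q t + q' t) / 2)"
    using AC_onD[OF assms(1) xy] AC_onD[OF assms(2) xy] by (simp add: field_simps)
qed

lemma set_integral_square_parallelogram:
  assumes I: "edge_interval I" and q: "AC_on I p q" "set_integrable lborel I (\<lambda>x. (q x)\<^sup>2)"
    and q': "AC_on I p' q'" "set_integrable lborel I (\<lambda>x. (q' x)\<^sup>2)"
  shows "set_integrable lborel I (\<lambda>x. (q x - q' x)\<^sup>2)"
    and "set_integrable lborel I (\<lambda>x. ((q x + q' x) / 2)\<^sup>2)"
    and "(LINT x:I|lborel. (q x - q' x)\<^sup>2) = 2 * (LINT x:I|lborel. (q x)\<^sup>2) + 2 * (LINT x:I|lborel. (q' x)\<^sup>2)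
           - 4 * (LINT x:I|lborel. ((q x + q' x) / 2)\<^sup>2)"
proof -
  have sq: "indicat_real I x *\<^sub>R a\<^sup>2 = (indicat_real I x * a)\<^sup>2" for a x :: real
    by (auto split: split_indicator)
  note m = AC_on_deriv_measurable[OF I q(1)] AC_on_deriv_measurable[OF I q'(1)]
  have "integrable lborel (\<lambda>x. (indicat_real I x * q x - indicat_real I x * q' x)\<^sup>2)"
  proof (rule integrable_square_diff)
    show "integrable lborel (\<lambda>x. (indicat_real I x * q x)\<^sup>2)" "integrable lborel (\<lambda>x. (indicat_real I x * q' x)\<^sup>2)"
      using q(2) q'(2) by (simp_all only: set_integrable_def sq)
  qed (use m in simp_all)
  then show d: "set_integrable lborel I (\<lambda>x. (q x - q' x)\<^sup>2)"
    by (simp only: set_integrable_def sq right_diff_distrib)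
  have eq: "((q x + q' x) / 2)\<^sup>2 = (q x)\<^sup>2 / 2 + (q' x)\<^sup>2 / 2 - (q x - q' x)\<^sup>2 / 4" for x
    by (simp add: power2_eq_square field_simps)
  show "set_integrable lborel I (\<lambda>x. ((q x + q' x) / 2)\<^sup>2)"
    unfolding eq using q q' d by (intro set_integral_add set_integral_diff) auto
  have "(LINT x:I|lborel. ((q x + q' x) / 2)\<^sup>2)
    = (LINT x:I|lborel. (q x)\<^sup>2) / 2 + (LINT x:I|lborel. (q' x)\<^sup>2) / 2 - (LINT x:I|lborel. (q x - q' x)\<^sup>2) / 4"
    unfolding eq using q q' d by (simp add: set_integral_diff set_integral_add)
  then show "(LINT x:I|lborel. (q x - q' x)\<^sup>2) = 2 * (LINT x:I|lborel. (q x)\<^sup>2) + 2 * (LINT x:I|lborel. (q' x)\<^sup>2)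
           - 4 * (LINT x:I|lborel. ((q x + q' x) / 2)\<^sup>2)" by simp
qed

text \<open>Instead of extracting a weakly convergent subsequence of derivatives, take derivatives of
  almost minimal norm among the functions that are close to the limit on a finite set; by the
  parallelogram law they converge strongly.\<close>

lemma AC_on_lower_semicontinuous:
  fixes f g :: "nat \<Rightarrow> real \<Rightarrow> real"
  assumes I: "edge_interval I" and ac: "\<And>n. AC_on I (f n) (g n)"
    and g2: "\<And>n. set_integrable lborel I (\<lambda>x. (g n x)\<^sup>2)" and bd: "\<And>n. (LINT x:I|lborel. (g n x)\<^sup>2) \<le> B"
    and lim: "\<And>x. x \<in> I \<Longrightarrow> (\<lambda>n. f n x) \<longlonglongrightarrow> F x"
  shows "\<exists>D. AC_on I F D \<and> set_integrable lborel I (\<lambda>x. (D x)\<^sup>2) \<and>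
    (\<forall>\<epsilon>>0. eventually (\<lambda>n. (LINT x:I|lborel. (D x)\<^sup>2) - \<epsilon> \<le> (LINT x:I|lborel. (g n x)\<^sup>2)) sequentially)"
proof -
  \<comment> \<open>\<open>A\<close> collects the pairs of a function and its derivative that lie
    within \<open>e\<close> of \<open>F\<close> on \<open>X\<close>, and \<open>d X e\<close> is
    their least squared norm. It grows as the constraint tightens; its supremum \<open>D\<close>
    will bound the squared norm of the derivative of \<open>F\<close>.\<close>
  define A where "A = (\<lambda>X e p q. AC_on I p q \<and> set_integrable lborel I (\<lambda>x. (q x)\<^sup>2) \<and> (\<forall>x\<in>X. \<bar>p x - F x\<bar> \<le> e))"
  define nrm where "nrm = (\<lambda>q::real \<Rightarrow> real. LINT x:I|lborel. (q x)\<^sup>2)"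
  define d where "d = (\<lambda>X e. Inf {nrm q | p q. A X e p q})"
  have nrm0: "0 \<le> nrm q" for q unfolding nrm_def by (rule set_integral_nonneg') simp
  have bdd: "bdd_below {nrm q | p q. A X e p q}" for X e
    by (rule bdd_belowI[of _ 0]) (use nrm0 in auto)
  have ev: "eventually (\<lambda>n. A X e (f n) (g n)) sequentially" if "finite X" "X \<subseteq> I" "e > 0" for X e
  proof -
    have "eventually (\<lambda>n. \<forall>x\<in>X. \<bar>f n x - F x\<bar> \<le> e) sequentially"
    proof (rule eventually_ball_finite[OF that(1)], rule ballI)
      fix x assume "x \<in> X"
      then have "(\<lambda>n. f n x) \<longlonglongrightarrow> F x" using lim that by auto
      then show "eventually (\<lambda>n. \<bar>f n x - F x\<bar> \<le> e) sequentially"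
        using that(3) tendstoD[of "\<lambda>n. f n x" "F x" sequentially e]
        by (auto simp: dist_real_def elim!: eventually_mono)
    qed
    then show ?thesis by eventually_elim (use ac g2 in \<open>auto simp: A_def\<close>)
  qed
  have ex: "\<exists>n. A X e (f n) (g n)" if "finite X" "X \<subseteq> I" "e > 0" for X e
    by (rule eventually_happens'[OF sequentially_bot ev[OF that]])
  have ne: "{nrm q | p q. A X e p q} \<noteq> {}" if X: "finite X" "X \<subseteq> I" "e > 0" for X e
  proof -
    obtain n where "A X e (f n) (g n)" using ex[OF X] by auto
    then have "nrm (g n) \<in> {nrm q | p q. A X e p q}" by auto
    then show ?thesis by auto
  qed
  have dle: "d X e \<le> nrm q" if "A X e p q" for X e p q
    unfolding d_def by (rule cInf_lower[OF _ bdd]) (use that in auto)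
  have dB: "d X e \<le> B" if X: "finite X" "X \<subseteq> I" "e > 0" for X e
  proof -
    obtain n where "A X e (f n) (g n)" using ex[OF X] by auto
    then show ?thesis using dle[of X e "f n" "g n"] bd[of n] unfolding nrm_def by linarith
  qed
  define Ds where "Ds = {d X e | X e. finite X \<and> X \<subseteq> I \<and> e > 0}"
  define D where "D = Sup Ds"
  have "d {} 1 \<in> Ds" unfolding Ds_def by (intro CollectI exI[of _ "{}"] exI[of _ "1::real"]) simp
  then have Dne: "Ds \<noteq> {}" by blast
  have Dbd: "bdd_above Ds" by (rule bdd_aboveI[of _ B]) (use dB in \<open>auto simp: Ds_def\<close>)
  have dD: "d X e \<le> D" if "finite X" "X \<subseteq> I" "e > 0" for X e
    unfolding D_def by (rule cSup_upper[OF _ Dbd]) (use that in \<open>auto simp: Ds_def\<close>)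
  have near: "\<exists>X e. finite X \<and> X \<subseteq> I \<and> e > 0 \<and> D - \<eta> < d X e" if "\<eta> > 0" for \<eta>
  proof -
    have "D - \<eta> < Sup Ds" unfolding D_def using that by simp
    then obtain y where "y \<in> Ds" "D - \<eta> < y" using less_cSup_iff[OF Dne Dbd] by auto
    then show ?thesis unfolding Ds_def by auto
  qed
  have pick: "\<exists>p q. A X e p q \<and> nrm q \<le> D + \<eta>" if X: "finite X" "X \<subseteq> I" "e > 0" and "\<eta> > 0" for X e \<eta>
  proof -
    have "d X e < D + \<eta>" using dD[OF X] that(4) by simp
    then obtain y where "y \<in> {nrm q | p q. A X e p q}" "y < D + \<eta>"
      using cInf_less_iff[OF ne[OF X] bdd] unfolding d_def by auto
    then obtain p q where "A X e p q" "nrm q < D + \<eta>" by auto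
    then show ?thesis by (intro exI[of _ p] exI[of _ q]) simp
  qed
  \<comment> \<open>The midpoint of two admissible functions is admissible, so its squared norm
    exceeds \<open>D - \<eta>\<close>. The parallelogram law leaves at most
    \<open>4 (D + \<eta>) - 4 (D - \<eta>) = 8 \<eta>\<close>.\<close>
  have close: "nrm (\<lambda>x. q x - q' x) \<le> 8 * \<eta>"
    if a: "A X e p q" "A X e p' q'" and n: "nrm q \<le> D + \<eta>" "nrm q' \<le> D + \<eta>" and dd: "D - \<eta> < d X e"
    for X e p q p' q' \<eta>
  proof -
    have aa: "AC_on I p q" "set_integrable lborel I (\<lambda>x. (q x)\<^sup>2)" "AC_on I p' q'" "set_integrable lborel I (\<lambda>x. (q' x)\<^sup>2)"
      using a unfolding A_def by auto
    note pl = set_integral_square_parallelogram[OF I aa]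
    have "A X e (\<lambda>x. (p x + p' x) / 2) (\<lambda>x. (q x + q' x) / 2)"
      unfolding A_def
    proof (intro conjI ballI)
      show "AC_on I (\<lambda>x. (p x + p' x) / 2) (\<lambda>x. (q x + q' x) / 2)" using AC_on_midpoint aa by blast
      fix x assume "x \<in> X"
      then have "\<bar>p x - F x\<bar> \<le> e" "\<bar>p' x - F x\<bar> \<le> e" using a unfolding A_def by auto
      then show "\<bar>(p x + p' x) / 2 - F x\<bar> \<le> e" unfolding abs_le_iff by (simp add: field_simps)
    qed (rule pl)
    then have "d X e \<le> nrm (\<lambda>x. (q x + q' x) / 2)" by (rule dle)
    then show ?thesis using pl(3) n dd unfolding nrm_def by linarith
  qed
  define \<eta> where "\<eta> = (\<lambda>k::nat. 1 / (real k + 1))"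
  have eta: "\<eta> k > 0" for k unfolding \<eta>_def by simp
  have eta_lim: "\<eta> \<longlonglongrightarrow> 0" unfolding \<eta>_def by real_asymp
  have eta_mono: "\<eta> m \<le> \<eta> k" if "k \<le> m" for k m unfolding \<eta>_def using that by (intro divide_left_mono) auto
  have "\<forall>k. \<exists>X e. finite X \<and> X \<subseteq> I \<and> e > 0 \<and> D - \<eta> k < d X e"
    by (intro allI near eta)
  then obtain X e where X: "\<And>k. finite (X k)" "\<And>k. X k \<subseteq> I" "\<And>k. e k > 0" "\<And>k. D - \<eta> k < d (X k) (e k)"
    by metis
  have "\<forall>k. \<exists>p q. A (X k) (e k) p q \<and> nrm q \<le> D + \<eta> k"
    by (intro allI pick X eta)
  then obtain p q where pq: "\<And>k. A (X k) (e k) (p k) (q k)" "\<And>k. nrm (q k) \<le> D + \<eta> k" by metis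
  have A_mono: "A X' e' p q" if "A X e p q" "X' \<subseteq> X" "e \<le> e'" for X X' e e' p q
    unfolding A_def
  proof (intro conjI ballI)
    fix x assume "x \<in> X'"
    then have "\<bar>p x - F x\<bar> \<le> e" using that unfolding A_def by auto
    then show "\<bar>p x - F x\<bar> \<le> e'" using that(3) by simp
  qed (use that(1) in \<open>auto simp: A_def\<close>)
  have qac: "AC_on I (p k) (q k)" "set_integrable lborel I (\<lambda>x. (q k x)\<^sup>2)" for k
    using pq(1)[of k] unfolding A_def by auto
  have cmp: "nrm (\<lambda>x. q k x - r x) \<le> 8 * \<eta> k"
    if "A Y \<epsilon> s r" "X k \<subseteq> Y" "\<epsilon> \<le> e k" "nrm r \<le> D + \<eta> k" for k Y \<epsilon> s r
    by (rule close[OF pq(1) A_mono[OF that(1-3)] pq(2) that(4) X(4)])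
  have tri: "nrm (\<lambda>x. u x - w x) \<le> 2 * nrm (\<lambda>x. u x - v x) + 2 * nrm (\<lambda>x. w x - v x)"
    if "AC_on I p1 u" "set_integrable lborel I (\<lambda>x. (u x)\<^sup>2)" "AC_on I p2 v" "set_integrable lborel I (\<lambda>x. (v x)\<^sup>2)"
       "AC_on I p3 w" "set_integrable lborel I (\<lambda>x. (w x)\<^sup>2)" for p1 p2 p3 u v w
  proof -
    note i1 = set_integral_square_parallelogram(1)[OF I that(1,2,3,4)]
    note i2 = set_integral_square_parallelogram(1)[OF I that(5,6,3,4)]
    note i3 = set_integral_square_parallelogram(1)[OF I that(1,2,5,6)]
    have "nrm (\<lambda>x. u x - w x) \<le> (LINT x:I|lborel. 2 * (u x - v x)\<^sup>2 + 2 * (w x - v x)\<^sup>2)"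
      unfolding nrm_def
    proof (rule set_integral_mono[OF i3])
      show "set_integrable lborel I (\<lambda>x. 2 * (u x - v x)\<^sup>2 + 2 * (w x - v x)\<^sup>2)" using i1 i2 by auto
      fix x
      have "0 \<le> ((u x - v x) + (w x - v x))\<^sup>2" by simp
      then show "(u x - w x)\<^sup>2 \<le> 2 * (u x - v x)\<^sup>2 + 2 * (w x - v x)\<^sup>2"
        by (simp add: power2_eq_square algebra_simps)
    qed
    then show ?thesis unfolding nrm_def using i1 i2 by simp
  qed
  have cauchy: "nrm (\<lambda>x. q k x - q m x) \<le> 32 * \<eta> j" if "k \<ge> j" "m \<ge> j" for k m j
  proof -
    \<comment> \<open>Constraints for \<open>k\<close> and \<open>m\<close> are not nested; both
      derivatives are compared with an almost minimal one for the union of the two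
      constraints.\<close>
    have "\<exists>s r. A (X k \<union> X m) (min (e k) (e m)) s r \<and> nrm r \<le> D + min (\<eta> k) (\<eta> m)"
      by (rule pick) (use X eta in auto)
    then obtain s r where r: "A (X k \<union> X m) (min (e k) (e m)) s r" "nrm r \<le> D + min (\<eta> k) (\<eta> m)" by blast
    have 1: "nrm (\<lambda>x. q k x - r x) \<le> 8 * \<eta> k" by (rule cmp[OF r(1)]) (use r(2) in auto)
    have 2: "nrm (\<lambda>x. q m x - r x) \<le> 8 * \<eta> m" by (rule cmp[OF r(1)]) (use r(2) in auto)
    have rr: "AC_on I s r" "set_integrable lborel I (\<lambda>x. (r x)\<^sup>2)" using r(1) unfolding A_def by auto
    have "nrm (\<lambda>x. q k x - q m x) \<le> 2 * (8 * \<eta> k) + 2 * (8 * \<eta> m)"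
      using tri[OF qac[of k] rr qac[of m]] 1 2 by linarith
    then show ?thesis using eta_mono[OF that(1)] eta_mono[OF that(2)] by linarith
  qed
  have sq: "indicat_real I x *\<^sub>R a\<^sup>2 = (indicat_real I x * a)\<^sup>2" for a x :: real
    by (auto split: split_indicator)
  define qq where "qq = (\<lambda>k x. indicat_real I x * q k x)"
  have nq: "nrm (q k) = (LINT x|lborel. (qq k x)\<^sup>2)" for k
    unfolding nrm_def set_lebesgue_integral_def sq qq_def ..
  have nd: "nrm (\<lambda>x. q k x - q m x) = (LINT x|lborel. (qq k x - qq m x)\<^sup>2)" for k m
    unfolding nrm_def set_lebesgue_integral_def sq qq_def by (simp add: right_diff_distrib)
  have qm: "qq k \<in> borel_measurable lborel" for k
    unfolding qq_def using AC_on_deriv_measurable[OF I qac(1)] by simp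
  have qi: "integrable lborel (\<lambda>x. (qq k x)\<^sup>2)" for k
    using qac(2)[of k] unfolding set_integrable_def sq qq_def .
  have qb: "(LINT x|lborel. (qq k x)\<^sup>2) \<le> D + 1" for k
  proof -
    have "\<eta> 0 = 1" unfolding \<eta>_def by simp
    then show ?thesis using pq(2)[of k] nq[of k] eta_mono[of 0 k] by linarith
  qed
  have qc: "\<exists>N. \<forall>i\<ge>N. \<forall>j\<ge>N. (LINT x|lborel. (qq i x - qq j x)\<^sup>2) \<le> \<epsilon>" if "\<epsilon> > 0" for \<epsilon>
  proof -
    have "eventually (\<lambda>k. \<eta> k < \<epsilon> / 32) sequentially" using that by (intro order_tendstoD(2)[OF eta_lim]) simp
    then obtain N where N: "\<eta> N < \<epsilon> / 32" using eventually_happens'[OF sequentially_bot] by blast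
    show ?thesis
    proof (intro exI[of _ N] allI impI)
      fix i j assume "i \<ge> N" "j \<ge> N"
      then show "(LINT x|lborel. (qq i x - qq j x)\<^sup>2) \<le> \<epsilon>" using cauchy[of N i j] N unfolding nd by simp
    qed
  qed
  obtain h where h: "h \<in> borel_measurable lborel" "integrable lborel (\<lambda>x. (h x)\<^sup>2)"
    "\<forall>C. eventually (\<lambda>n. (LINT x|lborel. (qq n x)\<^sup>2) \<le> C) sequentially \<longrightarrow> (LINT x|lborel. (h x)\<^sup>2) \<le> C"
    "(\<lambda>n. LINT x|lborel. (qq n x - h x)\<^sup>2) \<longlonglongrightarrow> 0" "\<forall>n. integrable lborel (\<lambda>x. (qq n x - h x)\<^sup>2)"
    by (rule L2_Cauchy_limit[OF qm qi qb qc])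
  have hI: "set_integrable lborel I (\<lambda>x. (h x)\<^sup>2)"
  proof -
    have "set_integrable lborel UNIV (\<lambda>x. (h x)\<^sup>2)" using h(2) by (simp add: set_integrable_def)
    then show ?thesis by (rule set_integrable_subset) (use edge_intervalD[OF I] in auto)
  qed
  have hD: "nrm h \<le> D + \<epsilon>" if "\<epsilon> > 0" for \<epsilon>
  proof -
    have "eventually (\<lambda>k. \<eta> k < \<epsilon>) sequentially" using order_tendstoD(2)[OF eta_lim that] .
    then have "eventually (\<lambda>k. (LINT x|lborel. (qq k x)\<^sup>2) \<le> D + \<epsilon>) sequentially"
    proof eventually_elim
      case (elim k)
      then show ?case using pq(2)[of k] nq[of k] by linarith
    qed
    then have "(LINT x|lborel. (h x)\<^sup>2) \<le> D + \<epsilon>" using h(3) by blast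
    moreover have "nrm h \<le> (LINT x:UNIV|lborel. (h x)\<^sup>2)" unfolding nrm_def
      by (rule set_integral_subset_le) (use h(2) edge_intervalD[OF I] in \<open>auto simp: set_integrable_def\<close>)
    ultimately show ?thesis by (simp add: set_lebesgue_integral_def)
  qed
  have hAC: "AC_on I F h"
    unfolding AC_on_def
  proof (intro ballI impI)
    fix x y assume x: "x \<in> I" and y: "y \<in> I" and xy: "x \<le> y"
    have sub: "{x..y} \<subseteq> I" by (rule Icc_subset_interval) (use edge_intervalD[OF I] x y in auto)
    have hi: "set_integrable lborel {x..y} h"
    proof (rule set_integrable_bound)
      show "set_integrable lborel {x..y} (\<lambda>t. 1 + (h t)\<^sup>2)"
        using set_integral_Icc_const(1)[OF xy] set_integrable_subset[OF hI _ sub] by auto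
      show "set_borel_measurable lborel {x..y} h" unfolding set_borel_measurable_def using h(1) by measurable
      show "AE t in lborel. t \<in> {x..y} \<longrightarrow> norm (h t) \<le> norm (1 + (h t)\<^sup>2)"
      proof (intro AE_I2 impI)
        fix t
        have "0 \<le> (\<bar>h t\<bar> - 1)\<^sup>2" by simp
        then have "2 * \<bar>h t\<bar> \<le> 1 + (h t)\<^sup>2" unfolding power2_diff by simp
        then show "norm (h t) \<le> norm (1 + (h t)\<^sup>2)" by simp
      qed
    qed
    have qxy: "set_integrable lborel {x..y} (q k)" for k using AC_onD[OF qac(1) x y xy] by simp
    \<comment> \<open>\<open>s k\<close> is in addition forced towards \<open>F\<close> at the two
      points \<open>x\<close> and \<open>y\<close>, while its derivative \<open>r k\<close> stays
      within \<open>8 * \<eta> k\<close> of \<open>q k\<close>. Thus the same limit \<open>h\<close>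
      serves as derivative for every pair of points.\<close>
    have "\<forall>k. \<exists>s r. A (X k \<union> {x, y}) (min (e k) (\<eta> k)) s r \<and> nrm r \<le> D + \<eta> k"
      by (intro allI pick eta) (use X eta x y in auto)
    then obtain s r where sr: "\<And>k. A (X k \<union> {x, y}) (min (e k) (\<eta> k)) (s k) (r k)" "\<And>k. nrm (r k) \<le> D + \<eta> k"
      by metis
    have rac: "AC_on I (s k) (r k)" "set_integrable lborel I (\<lambda>x. (r k x)\<^sup>2)" for k using sr(1)[of k] unfolding A_def by auto
    have rxy: "set_integrable lborel {x..y} (r k)" "s k y - s k x = (LINT t:{x..y}|lborel. r k t)" for k
      using AC_onD[OF rac(1) x y xy] by auto
    have slim: "(\<lambda>k. s k z) \<longlonglongrightarrow> F z" if "z \<in> {x, y}" for z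
    proof (rule LIM_zero_cancel, rule Lim_null_comparison[OF _ eta_lim])
      show "eventually (\<lambda>k. norm (s k z - F z) \<le> \<eta> k) sequentially"
        using sr(1) that unfolding A_def by (intro always_eventually) auto
    qed
    have CS: "\<bar>(LINT t:{x..y}|lborel. u t) - (LINT t:{x..y}|lborel. v t)\<bar> \<le> sqrt ((y - x) * c)"
      if "set_integrable lborel {x..y} u" "set_integrable lborel {x..y} v"
        "set_integrable lborel I (\<lambda>t. (u t - v t)\<^sup>2)" "nrm (\<lambda>t. u t - v t) \<le> c" for u v c
    proof -
      have i: "set_integrable lborel {x..y} (\<lambda>t. (u t - v t)\<^sup>2)"
        using that(3) by (rule set_integrable_subset) (use sub in auto)
      have "((LINT t:{x..y}|lborel. u t) - (LINT t:{x..y}|lborel. v t))\<^sup>2 = (LINT t:{x..y}|lborel. u t - v t)\<^sup>2"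
        using that by simp
      also have "\<dots> \<le> (y - x) * (LINT t:{x..y}|lborel. (u t - v t)\<^sup>2)"
        using that i xy by (intro set_integral_Cauchy_Schwarz_Icc) auto
      also have "\<dots> \<le> (y - x) * c"
      proof (rule mult_left_mono)
        have "(LINT t:{x..y}|lborel. (u t - v t)\<^sup>2) \<le> nrm (\<lambda>t. u t - v t)" unfolding nrm_def
          by (rule set_integral_subset_le) (use that(3) sub in auto)
        then show "(LINT t:{x..y}|lborel. (u t - v t)\<^sup>2) \<le> c" using that(4) by linarith
      qed (use xy in simp)
      finally show ?thesis
        using real_le_rsqrt[of "\<bar>(LINT t:{x..y}|lborel. u t) - (LINT t:{x..y}|lborel. v t)\<bar>"] by simp
    qed
    have L1: "(\<lambda>k. (LINT t:{x..y}|lborel. q k t) - (LINT t:{x..y}|lborel. r k t)) \<longlonglongrightarrow> 0"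
    proof (rule Lim_null_comparison)
      show "eventually (\<lambda>k. norm ((LINT t:{x..y}|lborel. q k t) - (LINT t:{x..y}|lborel. r k t)) \<le> sqrt ((y - x) * (8 * \<eta> k))) sequentially"
      proof (intro always_eventually allI)
        fix k
        have "nrm (\<lambda>x. q k x - r k x) \<le> 8 * \<eta> k" by (rule cmp[OF sr(1)]) (use sr(2) in auto)
        then show "norm ((LINT t:{x..y}|lborel. q k t) - (LINT t:{x..y}|lborel. r k t)) \<le> sqrt ((y - x) * (8 * \<eta> k))"
          unfolding real_norm_def
          by (intro CS qxy rxy set_integral_square_parallelogram(1)[OF I qac rac])
      qed
      have "(\<lambda>k. sqrt ((y - x) * (8 * \<eta> k))) \<longlonglongrightarrow> sqrt ((y - x) * (8 * 0))" by (intro tendsto_intros eta_lim)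
      then show "(\<lambda>k. sqrt ((y - x) * (8 * \<eta> k))) \<longlonglongrightarrow> 0" by simp
    qed
    have hsq: "set_integrable lborel I (\<lambda>t. (q k t - h t)\<^sup>2)" "nrm (\<lambda>t. q k t - h t) \<le> (LINT x|lborel. (qq k x - h x)\<^sup>2)" for k
    proof -
      have U: "set_integrable lborel UNIV (\<lambda>x. (qq k x - h x)\<^sup>2)" using h(5) by (simp add: set_integrable_def)
      have i: "set_integrable lborel I (\<lambda>x. (qq k x - h x)\<^sup>2)" by (rule set_integrable_subset[OF U]) (use edge_intervalD[OF I] in auto)
      then show j: "set_integrable lborel I (\<lambda>t. (q k t - h t)\<^sup>2)"
        by (rule set_integrable_cong[THEN iffD1, rotated -1]) (auto simp: qq_def)
      have "nrm (\<lambda>t. q k t - h t) = (LINT t:I|lborel. (qq k t - h t)\<^sup>2)" unfolding nrm_def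
        by (rule set_lebesgue_integral_cong) (use edge_intervalD[OF I] in \<open>auto simp: qq_def\<close>)
      also have "\<dots> \<le> (LINT t:UNIV|lborel. (qq k t - h t)\<^sup>2)"
        by (rule set_integral_subset_le[OF U]) (use edge_intervalD[OF I] in auto)
      finally show "nrm (\<lambda>t. q k t - h t) \<le> (LINT x|lborel. (qq k x - h x)\<^sup>2)" by (simp add: set_lebesgue_integral_def)
    qed
    have L2: "(\<lambda>k. (LINT t:{x..y}|lborel. q k t) - (LINT t:{x..y}|lborel. h t)) \<longlonglongrightarrow> 0"
    proof (rule Lim_null_comparison)
      show "eventually (\<lambda>k. norm ((LINT t:{x..y}|lborel. q k t) - (LINT t:{x..y}|lborel. h t)) \<le> sqrt ((y - x) * (LINT x|lborel. (qq k x - h x)\<^sup>2))) sequentially"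
        unfolding real_norm_def by (intro always_eventually allI CS qxy hi hsq)
      have "(\<lambda>k. sqrt ((y - x) * (LINT x|lborel. (qq k x - h x)\<^sup>2))) \<longlonglongrightarrow> sqrt ((y - x) * 0)" by (intro tendsto_intros h)
      then show "(\<lambda>k. sqrt ((y - x) * (LINT x|lborel. (qq k x - h x)\<^sup>2))) \<longlonglongrightarrow> 0" by simp
    qed
    have "(\<lambda>k. LINT t:{x..y}|lborel. r k t) \<longlonglongrightarrow> (LINT t:{x..y}|lborel. h t)"
      using tendsto_diff[OF L2 L1] by (simp add: LIM_zero_iff)
    moreover have "(\<lambda>k. LINT t:{x..y}|lborel. r k t) \<longlonglongrightarrow> F y - F x"
      unfolding rxy(2)[symmetric] by (intro tendsto_intros slim) auto
    ultimately have "F y - F x = (LINT t:{x..y}|lborel. h t)" using LIMSEQ_unique by blast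
    then show "set_integrable lborel {x..y} h \<and> F y - F x = (LINT t:{x..y}|lborel. h t)" using hi by blast
  qed
  have "eventually (\<lambda>n. nrm h - \<epsilon> \<le> nrm (g n)) sequentially" if e0: "\<epsilon> > 0" for \<epsilon>
  proof -
    \<comment> \<open>A constraint with \<open>d Y \<epsilon>'\<close> close to \<open>D\<close> is
      eventually met by \<open>f n\<close>, so the squared norm of \<open>g n\<close> is then at
      least \<open>d Y \<epsilon>'\<close>.\<close>
    obtain Y \<epsilon>' where Y: "finite Y" "Y \<subseteq> I" "\<epsilon>' > 0" "D - \<epsilon> / 2 < d Y \<epsilon>'" using near[of "\<epsilon> / 2"] e0 by auto
    from ev[OF Y(1-3)] show ?thesis
    proof eventually_elim
      case (elim n)
      then show ?case using dle[OF elim] Y(4) hD[of "\<epsilon> / 2"] e0 by simp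
    qed
  qed
  then show ?thesis unfolding nrm_def by (intro exI[of _ h] conjI allI impI hAC hI)
qed

section \<open>Graphs with one halfline and no terminal point\<close>

lemma sum_ge_two:
  fixes f :: "'a \<Rightarrow> real"
  assumes "finite A" "a \<in> A" "b \<in> A" "a \<noteq> b" "\<And>x. x \<in> A \<Longrightarrow> 0 \<le> f x"
  shows "f a + f b \<le> sum f A"
proof -
  have "sum f {a, b} \<le> sum f A" using assms by (intro sum_mono2) auto
  then show ?thesis using assms(4) by simp
qed

locale one_halfline_graph =
  fixes G :: "('v, 'e) mgraph"
  assumes wf: "wf_mgraph G" and conn: "mg_connected G" and HL1: "card (HL G) = 1"
    and no_terminal: "\<not> has_terminal_point G"
begin

definition h :: 'e where "h = the_elem (HL G)"

lemma HL_eq: "HL G = {h}"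
proof -
  obtain x where "HL G = {x}" using HL1 by (rule card_1_singletonE)
  then show ?thesis unfolding h_def by simp
qed

lemma finite_Es: "finite (Es G)" and h_in_Es: "h \<in> Es G"
  and src_in_Vs: "e \<in> Es G \<Longrightarrow> src G e \<in> Vs G"
  and tgt_in_Vs: "e \<in> Es G \<Longrightarrow> e \<noteq> h \<Longrightarrow> tgt G e \<in> Vs G"
  and len_pos: "e \<in> Es G \<Longrightarrow> e \<noteq> h \<Longrightarrow> len G e > 0"
  using wf HL_eq unfolding wf_mgraph_def by auto

lemma edom_h: "edom G h = {0..}" and edom_bounded: "e \<noteq> h \<Longrightarrow> edom G e = {0..len G e}"
  unfolding edom_def HL_eq by auto

lemma edge_interval_edom: "edge_interval (edom G e)"
  unfolding edom_def edge_interval_def by auto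

lemmas is_interval_edom = edge_intervalD(1)[OF edge_interval_edom]
  and sets_edom = edge_intervalD(2)[OF edge_interval_edom]

lemma zero_in_edom: "e \<in> Es G \<Longrightarrow> 0 \<in> edom G e"
  using len_pos[of e] edom_bounded[of e] edom_h by (cases "e = h") auto

lemma edom_nonneg: "x \<in> edom G e \<Longrightarrow> 0 \<le> x"
  unfolding edom_def by (auto split: if_splits)

lemma Icc_subset_edom: "x \<in> edom G e \<Longrightarrow> y \<in> edom G e \<Longrightarrow> {x..y} \<subseteq> edom G e"
  by (rule Icc_subset_interval[OF is_interval_edom])

lemma deg_ne_1: "v \<in> Vs G \<Longrightarrow> deg G v \<noteq> 1"
  using no_terminal unfolding has_terminal_point_def by auto

text \<open>The degree counts ends rather than edges. The second alternative therefore permits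
  \<open>e' = e\<close>: for a loop the other end at the vertex is its own.\<close>

lemma other_end_src:
  assumes "e \<in> Es G"
  shows "(\<exists>e'\<in>Es G. e' \<noteq> e \<and> src G e' = src G e) \<or> (\<exists>e'\<in>Es G. e' \<noteq> h \<and> tgt G e' = src G e)"
proof (rule ccontr)
  assume "\<not> ?thesis"
  then have 1: "{e'\<in>Es G. src G e' = src G e} = {e}" and 2: "{e'\<in>Es G - HL G. tgt G e' = src G e} = {}"
    using assms HL_eq by auto
  have "deg G (src G e) = 1" unfolding deg_def 1 2 by simp
  then show False using deg_ne_1[OF src_in_Vs[OF assms]] by simp
qed

lemma other_end_tgt:
  assumes "e \<in> Es G" "e \<noteq> h"
  shows "(\<exists>e'\<in>Es G. src G e' = tgt G e) \<or> (\<exists>e'\<in>Es G. e' \<noteq> h \<and> e' \<noteq> e \<and> tgt G e' = tgt G e)"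
proof (rule ccontr)
  assume "\<not> ?thesis"
  then have 1: "{e'\<in>Es G. src G e' = tgt G e} = {}" and 2: "{e'\<in>Es G - HL G. tgt G e' = tgt G e} = {e}"
    using assms HL_eq by auto
  have "deg G (tgt G e) = 1" unfolding deg_def 1 2 by simp
  then show False using deg_ne_1[OF tgt_in_Vs[OF assms]] by simp
qed

text \<open>A second end must meet the vertex of \<open>h\<close>, and it cannot come from another
  halfline.\<close>

lemma ex_bounded_edge: "\<exists>e\<in>Es G. e \<noteq> h"
  using other_end_src[OF h_in_Es] by auto

section \<open>Functions in \<open>H^1\<close> of the graph\<close>

lemma in_H1_edge:
  assumes "in_H1 G u u'" "e \<in> Es G"
  shows "H1_on (edom G e) (u e) (u' e)" "set_integrable lborel (edom G e) (\<lambda>x. (u e x)\<^sup>2)"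
    "set_integrable lborel (edom G e) (\<lambda>x. (u' e x)\<^sup>2)" "AC_on (edom G e) (u e) (u' e)"
    "continuous_on (edom G e) (u e)"
proof -
  show *: "H1_on (edom G e) (u e) (u' e)" using assms unfolding in_H1_def by simp
  then show "set_integrable lborel (edom G e) (\<lambda>x. (u e x)\<^sup>2)" "set_integrable lborel (edom G e) (\<lambda>x. (u' e x)\<^sup>2)"
    "AC_on (edom G e) (u e) (u' e)" by (simp_all add: H1_on_iff)
  then show "continuous_on (edom G e) (u e)" using AC_on_continuous is_interval_edom by blast
qed

lemma in_H1_vertex:
  assumes "in_H1 G u u'"
  obtains \<phi> where "\<And>e. e \<in> Es G \<Longrightarrow> u e 0 = \<phi> (src G e)"
    "\<And>e. e \<in> Es G \<Longrightarrow> e \<noteq> h \<Longrightarrow> u e (len G e) = \<phi> (tgt G e)"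
proof -
  obtain \<phi> where "\<forall>e\<in>Es G. u e 0 = \<phi> (src G e)" "\<forall>e\<in>Es G - HL G. u e (len G e) = \<phi> (tgt G e)"
    using assms unfolding in_H1_def by blast
  then show ?thesis using that[of \<phi>] HL_eq by auto
qed

lemma set_integrable_bounded_by_square:
  assumes H: "in_H1 G u u'" and e: "e \<in> Es G" and c: "continuous_on (edom G e) k"
    and b: "\<And>x. x \<in> edom G e \<Longrightarrow> \<bar>k x\<bar> \<le> C * (u e x)\<^sup>2"
  shows "set_integrable lborel (edom G e) k"
proof (rule set_integrable_bound)
  show "set_integrable lborel (edom G e) (\<lambda>x. C * (u e x)\<^sup>2)" using in_H1_edge[OF H e] by simp
  have "set_borel_measurable borel (edom G e) k"
    using c edge_intervalD[OF edge_interval_edom] by (intro set_measurable_continuous_on)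
  then show "set_borel_measurable lborel (edom G e) k" by (simp add: set_borel_measurable_def)
  show "AE x in lborel. x \<in> edom G e \<longrightarrow> norm (k x) \<le> norm (C * (u e x)\<^sup>2)"
    using b by (intro AE_I2 impI) (auto intro: order_trans[OF _ abs_ge_self])
qed

lemma in_H1_bounded:
  assumes H: "in_H1 G u u'" and e: "e \<in> Es G"
  shows "\<exists>B. \<forall>x\<in>edom G e. \<bar>u e x\<bar> \<le> B"
proof (cases "e = h")
  case True
  have c: "continuous_on {0..} (\<lambda>x. \<bar>u e x\<bar>)" using in_H1_edge(5)[OF H e] True edom_h by (intro continuous_intros) auto
  have "(u e \<longlongrightarrow> 0) at_top" using in_H1_edge(1)[OF H e] True edom_h by (intro H1_on_atLeast_tendsto_0[of 0]) auto
  then have "((\<lambda>x. \<bar>u e x\<bar>) \<longlongrightarrow> 0) at_top" by (rule tendsto_rabs_zero)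
  then obtain x where "\<And>y. y \<ge> 0 \<Longrightarrow> \<bar>u e y\<bar> \<le> \<bar>u e x\<bar>"
    using continuous_attains_max_atLeast[OF c] by auto
  then show ?thesis using True edom_h by (intro exI[of _ "\<bar>u e x\<bar>"]) auto
next
  case False
  have "continuous_on {0..len G e} (u e)" using in_H1_edge(5)[OF H e] edom_bounded[OF False] by simp
  then have "bounded (u e ` {0..len G e})" by (intro compact_imp_bounded compact_continuous_image) auto
  then obtain B where "\<forall>y\<in>u e ` {0..len G e}. norm y \<le> B" unfolding bounded_iff by blast
  then show ?thesis using edom_bounded[OF False] by (intro exI[of _ B]) auto
qed

lemma in_H1_integrable_power6:
  assumes H: "in_H1 G u u'" and e: "e \<in> Es G"
  shows "set_integrable lborel (edom G e) (\<lambda>x. (u e x)^6)"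
proof -
  obtain B where B: "\<And>x. x \<in> edom G e \<Longrightarrow> \<bar>u e x\<bar> \<le> B" using in_H1_bounded[OF H e] by blast
  show ?thesis
  proof (rule set_integrable_bounded_by_square[OF H e])
    show "continuous_on (edom G e) (\<lambda>x. (u e x)^6)" using in_H1_edge(5)[OF H e] by (intro continuous_intros)
    fix x assume "x \<in> edom G e"
    then have "\<bar>u e x\<bar>^4 \<le> B^4" using B by (intro power_mono) auto
    then have "\<bar>u e x\<bar>^4 * \<bar>u e x\<bar>^2 \<le> B^4 * \<bar>u e x\<bar>^2" by (intro mult_right_mono) auto
    moreover have "\<bar>(u e x)^6\<bar> = \<bar>u e x\<bar>^4 * \<bar>u e x\<bar>^2" unfolding power_add[symmetric] by (simp add: power_abs)
    ultimately show "\<bar>(u e x)^6\<bar> \<le> B^4 * (u e x)\<^sup>2" by simp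
  qed
qed

lemma Lp_pow_even:
  assumes "even p"
  shows "Lp_pow G p u = (\<Sum>e\<in>Es G. LINT x:edom G e|lborel. (u e x)^p)"
  unfolding Lp_pow_def using assms by (simp add: power_even_abs)

lemma mass_eq: "mass G u = (\<Sum>e\<in>Es G. LINT x:edom G e|lborel. (u e x)\<^sup>2)"
  unfolding mass_def by (rule Lp_pow_even) simp

lemma Lp_pow_even_nonneg: "even p \<Longrightarrow> 0 \<le> Lp_pow G p u"
  unfolding Lp_pow_def by (intro sum_nonneg set_integral_nonneg') simp

lemma Lp_pow_scale:
  "Lp_pow G p (\<lambda>e x. c * u e x) = \<bar>c\<bar>^p * Lp_pow G p u"
  unfolding Lp_pow_def by (simp add: abs_mult power_mult_distrib sum_distrib_left)

lemma in_H1_scale: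
  assumes "in_H1 G u u'"
  shows "in_H1 G (\<lambda>e x. c * u e x) (\<lambda>e x. c * u' e x)"
proof -
  obtain \<phi> where \<phi>: "\<forall>e\<in>Es G. u e 0 = \<phi> (src G e)" "\<forall>e\<in>Es G - HL G. u e (len G e) = \<phi> (tgt G e)"
    using assms unfolding in_H1_def by blast
  have "H1_on (edom G e) (\<lambda>x. c * u e x) (\<lambda>x. c * u' e x)" if "e \<in> Es G" for e
    using in_H1_edge[OF assms that] unfolding H1_on_iff AC_on_def
    by (auto simp: power_mult_distrib right_diff_distrib[symmetric])
  then show ?thesis unfolding in_H1_def using \<phi> by (auto intro!: exI[of _ "\<lambda>v. c * \<phi> v"])
qed

lemma in_H1_abs:
  assumes H: "in_H1 G u u'"
  shows "in_H1 G (\<lambda>e x. \<bar>u e x\<bar>) (\<lambda>e x. sgn (u e x) * u' e x)"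
    and "Lp_pow G 2 (\<lambda>e x. sgn (u e x) * u' e x) \<le> Lp_pow G 2 u'"
    and "Lp_pow G p (\<lambda>e x. \<bar>u e x\<bar>) = Lp_pow G p u"
proof -
  obtain \<phi> where \<phi>: "\<forall>e\<in>Es G. u e 0 = \<phi> (src G e)" "\<forall>e\<in>Es G - HL G. u e (len G e) = \<phi> (tgt G e)"
    using H unfolding in_H1_def by blast
  have ac: "AC_on (edom G e) (\<lambda>x. \<bar>u e x\<bar>) (\<lambda>x. sgn (u e x) * u' e x)" if "e \<in> Es G" for e
    using in_H1_edge[OF H that] is_interval_edom by (intro AC_on_abs)
  have sq: "(sgn (u e x) * u' e x)\<^sup>2 \<le> (u' e x)\<^sup>2" for e x
    by (simp add: power_mult_distrib sgn_real_def)
  have i: "set_integrable lborel (edom G e) (\<lambda>x. (sgn (u e x) * u' e x)\<^sup>2)" if e: "e \<in> Es G" for e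
  proof (rule set_integrable_bound[OF in_H1_edge(3)[OF H e]])
    have "(\<lambda>x. indicat_real (edom G e) x *\<^sub>R (sgn (u e x) * u' e x)\<^sup>2) = (\<lambda>x. (indicat_real (edom G e) x * (sgn (u e x) * u' e x))\<^sup>2)"
      by (auto split: split_indicator)
    then show "set_borel_measurable lborel (edom G e) (\<lambda>x. (sgn (u e x) * u' e x)\<^sup>2)"
      unfolding set_borel_measurable_def using AC_on_deriv_measurable[OF edge_interval_edom ac[OF e]] by simp
  qed (use sq in auto)
  show "in_H1 G (\<lambda>e x. \<bar>u e x\<bar>) (\<lambda>e x. sgn (u e x) * u' e x)"
    unfolding in_H1_def H1_on_iff using in_H1_edge[OF H] i ac \<phi> by (auto intro!: exI[of _ "\<lambda>v. \<bar>\<phi> v\<bar>"])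
  have "Lp_pow G 2 (\<lambda>e x. sgn (u e x) * u' e x) = (\<Sum>e\<in>Es G. LINT x:edom G e|lborel. (sgn (u e x) * u' e x)\<^sup>2)"
    by (rule Lp_pow_even) simp
  also have "\<dots> \<le> (\<Sum>e\<in>Es G. LINT x:edom G e|lborel. (u' e x)\<^sup>2)"
    by (intro sum_mono set_integral_mono i in_H1_edge(3)[OF H] sq)
  also have "\<dots> = Lp_pow G 2 u'" by (rule Lp_pow_even[symmetric]) simp
  finally show "Lp_pow G 2 (\<lambda>e x. sgn (u e x) * u' e x) \<le> Lp_pow G 2 u'" .
  show "Lp_pow G p (\<lambda>e x. \<bar>u e x\<bar>) = Lp_pow G p u" unfolding Lp_pow_def by simp
qed

lemma ex_max:
  assumes H: "in_H1 G u u'" and nn: "\<And>e x. e \<in> Es G \<Longrightarrow> x \<in> edom G e \<Longrightarrow> 0 \<le> u e x"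
  obtains e0 x0 where "e0 \<in> Es G" "x0 \<in> edom G e0" "\<And>e x. e \<in> Es G \<Longrightarrow> x \<in> edom G e \<Longrightarrow> u e x \<le> u e0 x0"
proof -
  have "\<exists>x\<in>edom G e. \<forall>y\<in>edom G e. u e y \<le> u e x" if e: "e \<in> Es G" for e
  proof (cases "e = h")
    case True
    have c: "continuous_on {0..} (u e)" using in_H1_edge(5)[OF H e] True edom_h by auto
    have l: "(u e \<longlongrightarrow> 0) at_top" using in_H1_edge(1)[OF H e] True edom_h by (intro H1_on_atLeast_tendsto_0[of 0]) auto
    have n: "0 \<le> u e x" if "x \<ge> 0" for x using nn[OF e] True edom_h that by auto
    obtain x where "x \<ge> 0" "\<And>y. y \<ge> 0 \<Longrightarrow> u e y \<le> u e x"
      using continuous_attains_max_atLeast[OF c l n] by auto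
    then show ?thesis using True edom_h by auto
  next
    case False
    have "continuous_on {0..len G e} (u e)" using in_H1_edge(5)[OF H e] edom_bounded[OF False] by simp
    then show ?thesis using continuous_attains_sup[of "{0..len G e}" "u e"] edom_bounded[OF False] len_pos[OF e False] by auto
  qed
  then obtain m where m: "\<And>e. e \<in> Es G \<Longrightarrow> m e \<in> edom G e" "\<And>e y. e \<in> Es G \<Longrightarrow> y \<in> edom G e \<Longrightarrow> u e y \<le> u e (m e)"
    by metis
  define S where "S = (\<lambda>e. u e (m e)) ` Es G"
  have S: "finite S" "S \<noteq> {}" unfolding S_def using finite_Es h_in_Es by auto
  obtain e0 where e0: "e0 \<in> Es G" "Max S = u e0 (m e0)" using Max_in[OF S] unfolding S_def by auto
  have mx: "u e (m e) \<le> u e0 (m e0)" if "e \<in> Es G" for e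
    using Max_ge[OF S(1), of "u e (m e)"] that e0(2) unfolding S_def by auto
  show ?thesis by (rule that[OF e0(1) m(1)[OF e0(1)]]) (use mx m(2) in \<open>blast intro: order_trans\<close>)
qed

end

section \<open>Lower bounds for nonnegative functions\<close>

locale nonneg_profile = one_halfline_graph G for G :: "('v, 'e) mgraph" +
  fixes u u' :: "'e \<Rightarrow> real \<Rightarrow> real" and M :: real and e0 :: 'e and x0 :: real
  assumes H: "in_H1 G u u'" and M_pos: "M > 0"
    and u_range: "\<And>e x. e \<in> Es G \<Longrightarrow> x \<in> edom G e \<Longrightarrow> u e x \<in> {0..M}"
    and e0: "e0 \<in> Es G" and x0: "x0 \<in> edom G e0" and peak: "u e0 x0 = M"
begin

text \<open>With \<open>soliton_slope N\<close> for \<open>F\<close> this is the action with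
  potential \<open>V\<close>. A general \<open>F\<close> is kept because the damped slope is used as
  well.\<close>

definition Q :: "(real \<Rightarrow> real) \<Rightarrow> 'e \<Rightarrow> real set \<Rightarrow> real" where
  "Q F e S = (LINT x:S|lborel. (u' e x)\<^sup>2 + (F (u e x))\<^sup>2)"

text \<open>The quadratic bound makes \<open>F (u)^2\<close> integrable on the halfline, where it is
  dominated by a multiple of \<open>u^2\<close>.\<close>

definition calibrating :: "(real \<Rightarrow> real) \<Rightarrow> bool" where
  "calibrating F \<longleftrightarrow> continuous_on {0..M} F \<and> (\<forall>t\<in>{0..M}. 0 \<le> F t) \<and> (\<exists>C. \<forall>t\<in>{0..M}. (F t)\<^sup>2 \<le> C * t\<^sup>2)"

lemma Q_integrable:
  assumes "calibrating F" "e \<in> Es G"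
  shows "set_integrable lborel (edom G e) (\<lambda>x. (F (u e x))\<^sup>2)"
    and "set_integrable lborel (edom G e) (\<lambda>x. (u' e x)\<^sup>2 + (F (u e x))\<^sup>2)"
proof -
  obtain C where C: "\<And>t. t \<in> {0..M} \<Longrightarrow> (F t)\<^sup>2 \<le> C * t\<^sup>2" using assms(1) unfolding calibrating_def by blast
  have "continuous_on (edom G e) (\<lambda>x. F (u e x))"
  proof (rule continuous_on_compose2[OF _ in_H1_edge(5)[OF H assms(2)]])
    show "continuous_on {0..M} F" using assms(1) unfolding calibrating_def by simp
    show "u e ` edom G e \<subseteq> {0..M}" using u_range[OF assms(2)] by blast
  qed
  then have "continuous_on (edom G e) (\<lambda>x. (F (u e x))\<^sup>2)" by (intro continuous_intros)
  then show 1: "set_integrable lborel (edom G e) (\<lambda>x. (F (u e x))\<^sup>2)"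
    by (rule set_integrable_bounded_by_square[OF H assms(2)]) (use C u_range[OF assms(2)] in auto)
  show "set_integrable lborel (edom G e) (\<lambda>x. (u' e x)\<^sup>2 + (F (u e x))\<^sup>2)"
    using 1 in_H1_edge(3)[OF H assms(2)] by (rule set_integral_add(1)[rotated])
qed

lemma Q_nonneg: "0 \<le> Q F e S"
  unfolding Q_def by (rule set_integral_nonneg') simp

lemma Q_mono:
  assumes "calibrating F" "e \<in> Es G" "S \<in> sets lborel" "S \<subseteq> T" "T \<in> sets lborel" "T \<subseteq> edom G e"
  shows "Q F e S \<le> Q F e T"
  unfolding Q_def
  by (rule set_integral_subset_le[OF set_integrable_subset[OF Q_integrable(2)[OF assms(1,2)] assms(5,6)] assms(3,4)]) simp

lemma Q_split:
  assumes "calibrating F" "e \<in> Es G" "S \<in> sets lborel" "T \<in> sets lborel" "U \<in> sets lborel"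
    "S \<subseteq> U" "T \<subseteq> U" "U \<subseteq> edom G e" "S \<inter> T \<subseteq> {p}"
  shows "Q F e S + Q F e T \<le> Q F e U"
  unfolding Q_def
  by (rule set_integral_split2[OF set_integrable_subset[OF Q_integrable(2)[OF assms(1,2)] assms(5,8)] _ assms(3,4,6,7,9)]) simp

lemma Q_segment:
  assumes F: "calibrating F" and e: "e \<in> Es G" and xy: "x \<in> edom G e" "y \<in> edom G e" "x \<le> y"
  shows "2 * \<bar>Prim F (u e y) - Prim F (u e x)\<bar> \<le> Q F e {x..y}"
  unfolding Q_def
proof (rule calibration_le)
  have sub: "{x..y} \<subseteq> edom G e" using xy by (intro Icc_subset_edom)
  show "AC_on {x..y} (u e) (u' e)" using in_H1_edge(4)[OF H e] sub by (rule AC_on_subset)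
  show "continuous_on {x..y} (u e)" using in_H1_edge(5)[OF H e] sub by (rule continuous_on_subset)
  show "set_integrable lborel {x..y} (\<lambda>t. (u' e t)\<^sup>2)"
    using in_H1_edge(3)[OF H e] by (rule set_integrable_subset) (use sub in auto)
  show "u e ` {x..y} \<subseteq> {0..M}" using sub u_range[OF e] by blast
  show "continuous_on {0..M} F" using F unfolding calibrating_def by simp
  then show "\<exists>\<xi>\<in>{s..t}. Prim F t - Prim F s = F \<xi> * (t - s)" if "0 \<le> s" "s < t" "t \<le> M" for s t
    using that by (rule Prim_mvt)
qed (rule xy)

lemma Prim_calibrating_mono:
  assumes "calibrating F" "0 \<le> s" "s \<le> t" "t \<le> M"
  shows "Prim F s \<le> Prim F t"
  using assms(1) unfolding calibrating_def by (intro Prim_mono[of M]) (use assms in auto)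

lemma calibrating_soliton_slope: "M \<le> N \<Longrightarrow> calibrating (soliton_slope N)"
  unfolding calibrating_def
proof (intro conjI ballI exI[of _ "N^4 / 3"])
  assume N: "M \<le> N"
  show "continuous_on {0..M} (soliton_slope N)" by (rule continuous_on_soliton_slope)
  fix t assume t: "t \<in> {0..M}"
  then show "0 \<le> soliton_slope N t" using N by (intro soliton_slope_nonneg) auto
  have "(soliton_slope N t)\<^sup>2 = t\<^sup>2 * (N^4 - t^4) / 3" using t N by (intro soliton_slope_sq) auto
  also have "\<dots> \<le> t\<^sup>2 * N^4 / 3" by (intro divide_right_mono mult_left_mono) auto
  finally show "(soliton_slope N t)\<^sup>2 \<le> N^4 / 3 * t\<^sup>2" by (simp add: mult.commute)
qed

lemma calibrating_damped_slope: "0 < a \<Longrightarrow> calibrating (damped_slope a M)"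
  unfolding calibrating_def
proof (intro conjI ballI exI[of _ "M^4 / 3"])
  assume a: "0 < a"
  show "continuous_on {0..M} (damped_slope a M)" using a by (rule continuous_on_damped_slope)
  fix t assume t: "t \<in> {0..M}"
  then show "0 \<le> damped_slope a M t" by (intro damped_slope_nonneg) auto
  have "(damped_slope a M t)\<^sup>2 \<le> t\<^sup>2 * (M^4 - t^4) / 3" using t a by (intro damped_slope_sq_le(1)) auto
  also have "\<dots> \<le> t\<^sup>2 * M^4 / 3" by (intro divide_right_mono mult_left_mono) auto
  finally show "(damped_slope a M t)\<^sup>2 \<le> M^4 / 3 * t\<^sup>2" by (simp add: mult.commute)
qed

lemma twice_energy_eq:
  assumes N: "M \<le> N"
  shows "2 * energy G u u' = (\<Sum>e\<in>Es G. Q (soliton_slope N) e (edom G e)) - N^4 / 3 * mass G u"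
proof -
  have "Q (soliton_slope N) e (edom G e) = (LINT x:edom G e|lborel. (u' e x)\<^sup>2) + N^4 / 3 * (LINT x:edom G e|lborel. (u e x)\<^sup>2)
      - (LINT x:edom G e|lborel. (u e x)^6) / 3" if e: "e \<in> Es G" for e
  proof -
    note i = in_H1_edge(2,3)[OF H e] in_H1_integrable_power6[OF H e]
    have "Q (soliton_slope N) e (edom G e) = (LINT x:edom G e|lborel. (u' e x)\<^sup>2 + N^4 / 3 * (u e x)\<^sup>2 - (u e x)^6 / 3)"
      unfolding Q_def
    proof (rule set_lebesgue_integral_cong[OF sets_edom], intro allI impI)
      fix x assume "x \<in> edom G e"
      then have "(soliton_slope N (u e x))\<^sup>2 = (u e x)\<^sup>2 * (N^4 - (u e x)^4) / 3"
        using u_range[OF e] N by (intro soliton_slope_sq) force+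
      moreover have "(u e x)\<^sup>2 * (u e x)^4 = (u e x)^6" unfolding power_add[symmetric] by simp
      ultimately show "(u' e x)\<^sup>2 + (soliton_slope N (u e x))\<^sup>2 = (u' e x)\<^sup>2 + N^4 / 3 * (u e x)\<^sup>2 - (u e x)^6 / 3"
        by (simp add: field_simps)
    qed
    then show ?thesis using i by simp
  qed
  then have "(\<Sum>e\<in>Es G. Q (soliton_slope N) e (edom G e)) = Lp_pow G 2 u' + N^4 / 3 * mass G u - Lp_pow G 6 u / 3"
    unfolding mass_eq by (simp add: Lp_pow_even sum.distrib sum_subtractf sum_distrib_left sum_divide_distrib)
  then show ?thesis unfolding energy_def by simp
qed

lemma u_h_tendsto_0: "(u h \<longlongrightarrow> 0) at_top"
  using in_H1_edge(1)[OF H h_in_Es] edom_h by (intro H1_on_atLeast_tendsto_0[of 0]) simp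

lemma ex_low_h: "0 < a \<Longrightarrow> \<exists>y\<ge>z. u h y \<le> a"
proof -
  assume "0 < a"
  then have "eventually (\<lambda>y. u h y < a \<and> z \<le> y) at_top"
    using order_tendstoD(2)[OF u_h_tendsto_0] eventually_ge_at_top by (auto intro: eventually_conj)
  then obtain y where "u h y < a" "z \<le> y" using eventually_happens'[OF trivial_limit_at_top_linorder] by blast
  then show ?thesis by (auto intro: less_imp_le)
qed

section \<open>Attained values and routes descending from the peak\<close>

lemma value_attained:
  assumes t: "0 < t" "t < M"
  shows "\<exists>e\<in>Es G. \<exists>y\<in>edom G e. u e y = t"
proof (rule ccontr)
  assume no: "\<not> ?thesis"
  obtain \<phi> where \<phi>: "\<And>e. e \<in> Es G \<Longrightarrow> u e 0 = \<phi> (src G e)"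
    "\<And>e. e \<in> Es G \<Longrightarrow> e \<noteq> h \<Longrightarrow> u e (len G e) = \<phi> (tgt G e)" using in_H1_vertex[OF H] by metis
  \<comment> \<open>An edge on which \<open>t\<close> is missed stays on one side of
    \<open>t\<close>. Being below \<open>t\<close> then spreads from the far part of the halfline
    through common vertices to the edge of the peak.\<close>
  have same: "u e y < t" if e: "e \<in> Es G" and x: "x \<in> edom G e" and y: "y \<in> edom G e" and lt: "u e x < t" for e x y
  proof (rule ccontr)
    assume "\<not> u e y < t"
    then have ge: "t \<le> u e y" by simp
    have "connected (u e ` edom G e)"
      using in_H1_edge(5)[OF H e] is_interval_edom by (intro connected_continuous_image) (auto simp: is_interval_connected_1)
    then have "t \<in> u e ` edom G e"
      using connectedD_interval[of "u e ` edom G e" "u e x" "u e y" t] x y lt ge by auto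
    then show False using no e by auto
  qed
  obtain z where z: "z \<ge> 0" "u h z \<le> t / 2" using ex_low_h[of "t / 2" 0] t by auto
  then have "\<phi> (src G h) < t" using same[OF h_in_Es, of z 0] edom_h t \<phi>(1)[OF h_in_Es] by simp
  have all: "\<phi> w < t" if "(src G h, w) \<in> (adj G)\<^sup>*" for w
    using that
  proof (induction rule: rtrancl_induct)
    case base show ?case by fact
  next
    case (step v w)
    from step(2) obtain e where e: "e \<in> Es G" "e \<noteq> h" "(v = src G e \<and> w = tgt G e) \<or> (v = tgt G e \<and> w = src G e)"
      unfolding adj_def HL_eq by auto
    have d: "0 \<in> edom G e" "len G e \<in> edom G e" using edom_bounded[OF e(2)] len_pos[OF e(1,2)] by auto
    show ?case using e(3) same[OF e(1) d] same[OF e(1) d(2,1)] \<phi>(1)[OF e(1)] \<phi>(2)[OF e(1,2)] step(3) by auto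
  qed
  have "\<phi> (src G e0) < t"
    using conn src_in_Vs[OF h_in_Es] src_in_Vs[OF e0] unfolding mg_connected_def by (intro all) auto
  then have "u e0 x0 < t" using same[OF e0 zero_in_edom[OF e0] x0] \<phi>(1)[OF e0] by simp
  then show False using peak t by simp
qed

text \<open>Two disjoint routes lead from the peak to values at most \<open>a\<close>, each at a
  cost of at least \<open>2 (Prim F M - Prim F a)\<close>. A route that leaves the edge through a
  vertex continues along another end there, and the two costs telescope in the value at the
  vertex.\<close>

lemma Q_two_routes:
  assumes F: "calibrating F" and a: "0 < a" "a \<le> M"
    and low: "\<And>e. e \<in> Es G \<Longrightarrow> e \<noteq> h \<Longrightarrow> (\<exists>y\<in>{0..len G e / 2}. u e y \<le> a) \<and> (\<exists>y\<in>{len G e / 2..len G e}. u e y \<le> a)"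
  shows "4 * (Prim F M - Prim F a) \<le> (\<Sum>e\<in>Es G. Q F e (edom G e))"
proof -
  define P where "P = Prim F"
  obtain \<phi> where \<phi>: "\<And>e. e \<in> Es G \<Longrightarrow> u e 0 = \<phi> (src G e)"
    "\<And>e. e \<in> Es G \<Longrightarrow> e \<noteq> h \<Longrightarrow> u e (len G e) = \<phi> (tgt G e)" using in_H1_vertex[OF H] by metis
  have Pa: "P (u e y) \<le> P a" if "e \<in> Es G" "y \<in> edom G e" "u e y \<le> a" for e y
    unfolding P_def using u_range[OF that(1,2)] that(3) a by (intro Prim_calibrating_mono[OF F]) auto
  have seg1: "2 * P (u e y) - 2 * P (u e x) \<le> Q F e {x..y}"
    if "e \<in> Es G" "x \<in> edom G e" "y \<in> edom G e" "x \<le> y" for e x y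
    using order_trans[OF mult_left_mono[OF abs_ge_self] Q_segment[OF F that, folded P_def]] by simp
  have seg2: "2 * P (u e x) - 2 * P (u e y) \<le> Q F e {x..y}"
    if "e \<in> Es G" "x \<in> edom G e" "y \<in> edom G e" "x \<le> y" for e x y
    using order_trans[OF mult_left_mono[OF abs_ge_minus_self] Q_segment[OF F that, folded P_def]] by simp
  have down1: "2 * P (u e x) - 2 * P a \<le> Q F e {x..y}"
    if "e \<in> Es G" "x \<in> edom G e" "y \<in> edom G e" "u e y \<le> a" "x \<le> y" for e x y
    using seg2[OF that(1,2,3,5)] Pa[OF that(1,3,4)] by linarith
  have down2: "2 * P (u e x) - 2 * P a \<le> Q F e {y..x}"
    if "e \<in> Es G" "x \<in> edom G e" "y \<in> edom G e" "u e y \<le> a" "y \<le> x" for e x y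
    using seg1[OF that(1,3,2,5)] Pa[OF that(1,3,4)] by linarith
  have whole: "Q F e {x..y} \<le> Q F e (edom G e)" if "e \<in> Es G" "x \<in> edom G e" "y \<in> edom G e" for e x y
    using Icc_subset_edom[OF that(2,3)] sets_edom by (intro Q_mono[OF F that(1)]) auto
  have end_src: "2 * P (\<phi> (src G e)) - 2 * P a \<le> Q F e (edom G e)" if e: "e \<in> Es G" for e
  proof -
    have "\<exists>y\<in>edom G e. u e y \<le> a"
    proof (cases "e = h")
      case True then show ?thesis using ex_low_h[OF a(1), of 0] edom_h by auto
    next
      case False then show ?thesis using low[OF e False] edom_bounded[OF False] len_pos[OF e False] by fastforce
    qed
    then obtain y where y: "y \<in> edom G e" "u e y \<le> a" by blast
    then show ?thesis
      using down1[OF e zero_in_edom[OF e] y edom_nonneg[OF y(1)]] whole[OF e zero_in_edom[OF e] y(1)] \<phi>(1)[OF e] by simp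
  qed
  have end_tgt: "2 * P (\<phi> (tgt G e)) - 2 * P a \<le> Q F e (edom G e)" if e: "e \<in> Es G" "e \<noteq> h" for e
  proof -
    obtain y where y: "y \<in> {len G e / 2..len G e}" "u e y \<le> a" using low[OF e] by blast
    have d: "y \<in> edom G e" "len G e \<in> edom G e" using y(1) edom_bounded[OF e(2)] len_pos[OF e] by auto
    show ?thesis using down2[OF e(1) d(2,1) y(2)] y(1) whole[OF e(1) d] \<phi>(2)[OF e] by simp
  qed
  have two: "Q F e1 (edom G e1) + Q F e2 (edom G e2) \<le> (\<Sum>e\<in>Es G. Q F e (edom G e))"
    if "e1 \<in> Es G" "e2 \<in> Es G" "e1 \<noteq> e2" for e1 e2
    using that finite_Es Q_nonneg by (intro sum_ge_two) auto
  have one: "Q F e (edom G e) \<le> (\<Sum>e\<in>Es G. Q F e (edom G e))" if "e \<in> Es G" for e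
    using that finite_Es Q_nonneg by (intro member_le_sum) auto
  have cat: "Q F e {x..y} + Q F e {y..z} \<le> Q F e {x..z}"
    if "e \<in> Es G" "x \<in> edom G e" "z \<in> edom G e" "x \<le> y" "y \<le> z" for e x y z
    using Icc_subset_edom[OF that(2,3)] that by (intro Q_split[OF F that(1), where p = y]) auto
  have goal: ?thesis if "4 * P M - 4 * P a \<le> (\<Sum>e\<in>Es G. Q F e (edom G e))" using that unfolding P_def by simp
  show ?thesis
  proof (cases "e0 = h")
    case True
    obtain y where y: "y \<ge> x0" "u h y \<le> a" using ex_low_h[OF a(1)] by blast
    have d: "x0 \<in> edom G h" "y \<in> edom G h" "0 \<in> edom G h" "0 \<le> x0" using x0 y True edom_h by auto
    have 1: "2 * P M - 2 * P a \<le> Q F h {x0..y}" using down1[OF h_in_Es d(1,2) y(2,1)] peak True by simp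
    have 2: "2 * P M - 2 * P (\<phi> (src G h)) \<le> Q F h {0..x0}" using seg1[OF h_in_Es d(3,1,4)] peak True \<phi>(1)[OF h_in_Es] by simp
    have 3: "Q F h {0..x0} + Q F h {x0..y} \<le> Q F h (edom G h)"
      using cat[OF h_in_Es d(3,2,4) y(1)] whole[OF h_in_Es d(3,2)] by linarith
    \<comment> \<open>The halfline has only one finite end, so the continuation lies on a bounded
      edge and is disjoint from the outgoing route.\<close>
    have "\<exists>e\<in>Es G. e \<noteq> h \<and> 2 * P (\<phi> (src G h)) - 2 * P a \<le> Q F e (edom G e)"
      using other_end_src[OF h_in_Es] end_src end_tgt by metis
    then obtain e where "e \<in> Es G" "e \<noteq> h" "2 * P (\<phi> (src G h)) - 2 * P a \<le> Q F e (edom G e)" by blast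
    then show ?thesis using 1 2 3 two[OF h_in_Es, of e] by (intro goal) auto
  next
    case False
    define l where "l = len G e0"
    have l: "l > 0" and dom: "edom G e0 = {0..l}" unfolding l_def using len_pos[OF e0 False] edom_bounded[OF False] by auto
    obtain y1 y2 where y1: "y1 \<in> {0..l/2}" "u e0 y1 \<le> a" and y2: "y2 \<in> {l/2..l}" "u e0 y2 \<le> a"
      using low[OF e0 False] unfolding l_def by blast
    have d: "y1 \<in> edom G e0" "y2 \<in> edom G e0" "0 \<in> edom G e0" "l \<in> edom G e0" using y1 y2 dom l by auto
    have x0l: "0 \<le> x0" "x0 \<le> l" using x0 dom by auto
    \<comment> \<open>If the low points of the two halves enclose the peak, both routes stay inside
      the edge. Otherwise one of them leaves through the end on the side of the peak away from both
      low points.\<close>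
    consider "y1 \<le> x0" "x0 \<le> y2" | "x0 < y1" | "y2 < x0" by linarith
    then show ?thesis
    proof cases
      case 1
      have "Q F e0 {y1..x0} + Q F e0 {x0..y2} \<le> Q F e0 (edom G e0)"
        using cat[OF e0 d(1,2) 1] whole[OF e0 d(1,2)] by linarith
      then show ?thesis
        using down2[OF e0 x0 d(1) y1(2) 1(1)] down1[OF e0 x0 d(2) y2(2) 1(2)] one[OF e0] peak by (intro goal) auto
    next
      case 2
      define s where "s = \<phi> (src G e0)"
      have A1: "2 * P M - 2 * P a \<le> Q F e0 {x0..y1}" using down1[OF e0 x0 d(1) y1(2)] 2 peak by simp
      have A2: "2 * P M - 2 * P s \<le> Q F e0 {0..x0}" using seg1[OF e0 d(3) x0 x0l(1)] peak \<phi>(1)[OF e0] unfolding s_def by simp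
      have A3: "Q F e0 {0..x0} + Q F e0 {x0..y1} \<le> Q F e0 {0..y1}" using cat[OF e0 d(3,1) x0l(1)] 2 by simp
      have A4: "Q F e0 {0..y1} \<le> Q F e0 (edom G e0)" using whole[OF e0 d(3,1)] .
      from other_end_src[OF e0] consider
        (o) e where "e \<in> Es G" "e \<noteq> e0" "2 * P s - 2 * P a \<le> Q F e (edom G e)" | (loop) "tgt G e0 = src G e0"
        unfolding s_def using end_src end_tgt by metis
      then show ?thesis
      proof cases
        case o
        then show ?thesis using A1 A2 A3 A4 two[OF e0, of e] by (intro goal) auto
      next
        \<comment> \<open>The route re-enters the same edge at its other end and stops at
          \<open>y2\<close>; since \<open>y1 \<le> l / 2 \<le> y2\<close>, it meets the first
          stretch in at most one point.\<close>
        case loop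
        have "2 * P s - 2 * P a \<le> Q F e0 {y2..l}"
          using down2[OF e0 d(4,2) y2(2)] y2 \<phi>(2)[OF e0 False] loop unfolding s_def l_def by simp
        moreover have "Q F e0 {0..y1} + Q F e0 {y2..l} \<le> Q F e0 (edom G e0)"
          using y1 y2 l dom by (intro Q_split[OF F e0, where p = "l/2"]) auto
        ultimately show ?thesis using A1 A2 A3 one[OF e0] by (intro goal) linarith
      qed
    next
      case 3
      define s where "s = \<phi> (tgt G e0)"
      have us: "u e0 l = s" unfolding s_def l_def using \<phi>(2)[OF e0 False] .
      have A1: "2 * P M - 2 * P a \<le> Q F e0 {y2..x0}" using down2[OF e0 x0 d(2) y2(2)] 3 peak by simp
      have A2: "2 * P M - 2 * P s \<le> Q F e0 {x0..l}" using seg2[OF e0 x0 d(4) x0l(2)] peak us by simp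
      have A3: "Q F e0 {y2..x0} + Q F e0 {x0..l} \<le> Q F e0 {y2..l}" using cat[OF e0 d(2,4) _ x0l(2)] 3 by simp
      have A4: "Q F e0 {y2..l} \<le> Q F e0 (edom G e0)" using whole[OF e0 d(2,4)] .
      from other_end_tgt[OF e0 False] consider
        (o) e where "e \<in> Es G" "e \<noteq> e0" "2 * P s - 2 * P a \<le> Q F e (edom G e)" | (loop) "src G e0 = tgt G e0"
        unfolding s_def using end_src end_tgt by metis
      then show ?thesis
      proof cases
        case o
        then show ?thesis using A1 A2 A3 A4 two[OF e0, of e] by (intro goal) auto
      next
        case loop
        have "2 * P s - 2 * P a \<le> Q F e0 {0..y1}"
          using down1[OF e0 d(3,1) y1(2)] y1 \<phi>(1)[OF e0] loop unfolding s_def by simp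
        moreover have "Q F e0 {0..y1} + Q F e0 {y2..l} \<le> Q F e0 (edom G e0)"
          using y1 y2 l dom by (intro Q_split[OF F e0, where p = "l/2"]) auto
        ultimately show ?thesis using A1 A2 A3 one[OF e0] by (intro goal) linarith
      qed
    qed
  qed
qed

end

section \<open>Positive energy at the critical mass\<close>

context nonneg_profile
begin

lemma right_piece:
  assumes e: "e \<in> Es G" and x: "x \<in> edom G e" "u e x = M" and z: "z \<in> edom G e" "x < z"
  shows "\<exists>r. x < r \<and> r \<le> z \<and> (\<forall>y\<in>{x..r}. M / 2 \<le> u e y)"
proof -
  have "continuous_on {x..z} (u e)"
    using in_H1_edge(5)[OF H e] by (rule continuous_on_subset) (rule Icc_subset_edom[OF x(1) z(1)])
  then obtain d where d: "d > 0" "\<And>y. y \<in> {x..z} \<Longrightarrow> dist y x < d \<Longrightarrow> dist (u e y) (u e x) < M / 2"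
    using M_pos z(2) unfolding continuous_on_iff by (metis atLeastAtMost_iff half_gt_zero less_imp_le order_refl)
  show ?thesis
  proof (intro exI[of _ "min z (x + d / 2)"] conjI ballI)
    fix y assume y: "y \<in> {x..min z (x + d / 2)}"
    then have "dist (u e y) (u e x) < M / 2" using d(1) by (intro d(2)) (auto simp: dist_real_def)
    then show "M / 2 \<le> u e y" using x(2) unfolding dist_real_def by linarith
  qed (use d z in auto)
qed

lemma left_piece:
  assumes e: "e \<in> Es G" and x: "x \<in> edom G e" "u e x = M" and z: "z \<in> edom G e" "z < x"
  shows "\<exists>r. r < x \<and> z \<le> r \<and> (\<forall>y\<in>{r..x}. M / 2 \<le> u e y)"
proof -
  have "continuous_on {z..x} (u e)"
    using in_H1_edge(5)[OF H e] by (rule continuous_on_subset) (rule Icc_subset_edom[OF z(1) x(1)])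
  then obtain d where d: "d > 0" "\<And>y. y \<in> {z..x} \<Longrightarrow> dist y x < d \<Longrightarrow> dist (u e y) (u e x) < M / 2"
    using M_pos z(2) unfolding continuous_on_iff by (metis atLeastAtMost_iff half_gt_zero less_imp_le order_refl)
  show ?thesis
  proof (intro exI[of _ "max z (x - d / 2)"] conjI ballI)
    fix y assume y: "y \<in> {max z (x - d / 2)..x}"
    then have "dist (u e y) (u e x) < M / 2" using d(1) by (intro d(2)) (auto simp: dist_real_def)
    then show "M / 2 \<le> u e y" using x(2) unfolding dist_real_def by linarith
  qed (use d z in auto)
qed

text \<open>The bound \<open>M / 2\<close> keeps \<open>V(u)\<close> away from 0 on the piece as
  soon as \<open>N > M\<close>.\<close>

definition high_piece :: "'e \<Rightarrow> real \<Rightarrow> real \<Rightarrow> bool" where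
  "high_piece e p r \<longleftrightarrow> e \<in> Es G \<and> p < r \<and> {p..r} \<subseteq> edom G e \<and> (\<forall>y\<in>{p..r}. M / 2 \<le> u e y) \<and> (\<exists>y\<in>{p..r}. u e y = M)"

lemma high_piece_src:
  assumes e: "e \<in> Es G" and "u e 0 = M"
  shows "\<exists>r. high_piece e 0 r \<and> (e \<noteq> h \<longrightarrow> r \<le> len G e / 2)"
proof -
  define z where "z = (if e = h then 1 else len G e / 2)"
  have z: "z \<in> edom G e" "0 < z" unfolding z_def using edom_h edom_bounded[of e] len_pos[OF e] by auto
  obtain r where "0 < r" "r \<le> z" "\<forall>y\<in>{0..r}. M / 2 \<le> u e y"
    using right_piece[OF e zero_in_edom[OF e] assms(2) z] by blast
  moreover have "{0..r} \<subseteq> edom G e" if "r \<le> z" using Icc_subset_edom[OF zero_in_edom[OF e] z(1)] that by auto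
  ultimately show ?thesis unfolding high_piece_def
    by (intro exI[of _ r]) (use e assms(2) in \<open>auto simp: z_def split: if_splits intro!: bexI[of _ 0]\<close>)
qed

lemma high_piece_tgt:
  assumes e: "e \<in> Es G" "e \<noteq> h" and "u e (len G e) = M"
  shows "\<exists>p. high_piece e p (len G e) \<and> len G e / 2 \<le> p"
proof -
  have z: "len G e / 2 \<in> edom G e" "len G e / 2 < len G e" "len G e \<in> edom G e"
    using edom_bounded[OF e(2)] len_pos[OF e] by auto
  obtain r where r: "r < len G e" "len G e / 2 \<le> r" "\<forall>y\<in>{r..len G e}. M / 2 \<le> u e y"
    using left_piece[OF e(1) z(3) assms(3) z(1,2)] by blast
  moreover have "{r..len G e} \<subseteq> edom G e" using Icc_subset_edom[OF z(1,3)] r by auto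
  ultimately show ?thesis unfolding high_piece_def
    by (intro exI[of _ r]) (use e assms(3) in \<open>auto intro!: bexI[of _ "len G e"]\<close>)
qed

text \<open>An interior peak has a piece on either side; a peak at a vertex has one at each of two
  ends meeting there. If these are the two ends of a loop, the midpoint separates them, hence the
  control by half the length in \<open>S\<close> and \<open>T\<close>.\<close>

lemma two_high_pieces:
  "\<exists>e1 p1 r1 e2 p2 r2. high_piece e1 p1 r1 \<and> high_piece e2 p2 r2 \<and> (e1 \<noteq> e2 \<or> r1 \<le> p2 \<or> r2 \<le> p1)"
proof -
  obtain \<phi> where \<phi>: "\<And>e. e \<in> Es G \<Longrightarrow> u e 0 = \<phi> (src G e)"
    "\<And>e. e \<in> Es G \<Longrightarrow> e \<noteq> h \<Longrightarrow> u e (len G e) = \<phi> (tgt G e)" using in_H1_vertex[OF H] by metis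
  have S: "\<exists>r. high_piece e 0 r \<and> (e \<noteq> h \<longrightarrow> r \<le> len G e / 2)" if "e \<in> Es G" "\<phi> (src G e) = M" for e
    using high_piece_src \<phi>(1) that by simp
  have T: "\<exists>p. high_piece e p (len G e) \<and> len G e / 2 \<le> p" if "e \<in> Es G" "e \<noteq> h" "\<phi> (tgt G e) = M" for e
    using high_piece_tgt \<phi>(2) that by simp
  have ST: ?thesis if "e1 \<in> Es G" "\<phi> (src G e1) = M" "e2 \<in> Es G" "e2 \<noteq> h" "\<phi> (tgt G e2) = M" for e1 e2
  proof -
    obtain r where r: "high_piece e1 0 r" "e1 \<noteq> h \<longrightarrow> r \<le> len G e1 / 2" using S \<open>e1 \<in> Es G\<close> \<open>\<phi> (src G e1) = M\<close> by blast
    obtain p where p: "high_piece e2 p (len G e2)" "len G e2 / 2 \<le> p"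
      using T \<open>e2 \<in> Es G\<close> \<open>e2 \<noteq> h\<close> \<open>\<phi> (tgt G e2) = M\<close> by blast
    have "e1 \<noteq> e2 \<or> r \<le> p" using r(2) p(2) that(4) by (cases "e1 = e2") auto
    then show ?thesis using r(1) p(1) by blast
  qed
  consider "x0 = 0" | "e0 \<noteq> h" "x0 = len G e0" | "0 < x0" "e0 \<noteq> h \<longrightarrow> x0 < len G e0"
    using x0 edom_nonneg[OF x0] edom_bounded[of e0] by fastforce
  then show ?thesis
  proof cases
    case 1
    then have m: "\<phi> (src G e0) = M" using peak \<phi>(1)[OF e0] by simp
    from other_end_src[OF e0] show ?thesis
    proof (elim disjE bexE conjE)
      fix e' assume e': "e' \<in> Es G" "e' \<noteq> e0" "src G e' = src G e0"
      then obtain r where "high_piece e' 0 r" using S[of e'] m by auto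
      moreover obtain r' where "high_piece e0 0 r'" using S[OF e0 m] by auto
      ultimately show ?thesis using e'(2) by blast
    next
      fix e' assume "e' \<in> Es G" "e' \<noteq> h" "tgt G e' = src G e0"
      then show ?thesis using ST[OF e0 m, of e'] m by simp
    qed
  next
    case 2
    then have m: "\<phi> (tgt G e0) = M" using peak \<phi>(2)[OF e0] by simp
    from other_end_tgt[OF e0 2(1)] show ?thesis
    proof (elim disjE bexE conjE)
      fix e' assume "e' \<in> Es G" "src G e' = tgt G e0"
      then show ?thesis using ST[of e' e0] e0 2(1) m by simp
    next
      fix e' assume e': "e' \<in> Es G" "e' \<noteq> h" "e' \<noteq> e0" "tgt G e' = tgt G e0"
      then obtain p where "high_piece e' p (len G e')" using T[of e'] m by auto
      moreover obtain p' where "high_piece e0 p' (len G e0)" using T[OF e0 2(1) m] by auto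
      ultimately show ?thesis using e'(3) by blast
    qed
  next
    case 3
    define z where "z = (if e0 = h then x0 + 1 else len G e0)"
    have z: "z \<in> edom G e0" "x0 < z" unfolding z_def using 3 x0 edom_h edom_bounded[of e0] by auto
    obtain r where r: "x0 < r" "r \<le> z" "\<forall>y\<in>{x0..r}. M / 2 \<le> u e0 y" using right_piece[OF e0 x0 peak z] by blast
    obtain p where p: "p < x0" "0 \<le> p" "\<forall>y\<in>{p..x0}. M / 2 \<le> u e0 y"
      using left_piece[OF e0 x0 peak zero_in_edom[OF e0] 3(1)] by blast
    have "{x0..r} \<subseteq> edom G e0" using Icc_subset_edom[OF x0 z(1)] r by auto
    then have h1: "high_piece e0 x0 r" unfolding high_piece_def using r e0 peak by (auto intro!: bexI[of _ x0])
    have "{p..x0} \<subseteq> edom G e0" using Icc_subset_edom[OF zero_in_edom[OF e0] x0] p by auto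
    then have h2: "high_piece e0 p x0" unfolding high_piece_def using p e0 peak by (auto intro!: bexI[of _ x0])
    show ?thesis using h1 h2 by blast
  qed
qed

text \<open>The images of the two pieces are intervals with the same top \<open>M\<close>, hence
  nested. The piece with the smaller image can be deleted, since the other one still takes its
  values.\<close>

lemma ex_removable:
  "\<exists>e p r. e \<in> Es G \<and> p < r \<and> {p..r} \<subseteq> edom G e \<and> (\<forall>x\<in>{p..r}. M / 2 \<le> u e x) \<and>
     (\<forall>t. 0 < t \<and> t < M \<longrightarrow> (\<exists>e'\<in>Es G. \<exists>y\<in>edom G e'. u e' y = t \<and> \<not> (e' = e \<and> p < y \<and> y < r)))"
proof -
  have im: "\<exists>c. u e ` {p..r} = {c..M}" if hp: "high_piece e p r" for e p r
  proof -
    have e: "e \<in> Es G" and sub: "{p..r} \<subseteq> edom G e" and pr: "p < r" using hp unfolding high_piece_def by auto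
    have c: "continuous_on {p..r} (u e)" using in_H1_edge(5)[OF H e] sub by (rule continuous_on_subset)
    obtain y where y: "y \<in> {p..r}" "u e y = M" using hp unfolding high_piece_def by auto
    obtain c' d' where cd: "u e ` {p..r} = {c'..d'}" "c' \<le> d'"
      using continuous_image_closed_interval[of p r "u e"] c pr by auto
    have "M \<in> {c'..d'}" using y cd by blast
    moreover have "d' \<in> u e ` {p..r}" using cd by auto
    then have "d' \<le> M" using u_range[OF e] sub by auto
    ultimately have "d' = M" by simp
    then show ?thesis using cd by blast
  qed
  have key: ?thesis if hp: "high_piece e1 p1 r1" "high_piece e2 p2 r2" "e1 \<noteq> e2 \<or> r1 \<le> p2 \<or> r2 \<le> p1"
    and cc: "u e1 ` {p1..r1} = {c1..M}" "u e2 ` {p2..r2} = {c2..M}" "c1 \<le> c2" for e1 p1 r1 e2 p2 r2 c1 c2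
  proof (rule exI[of _ e2], rule exI[of _ p2], rule exI[of _ r2], intro conjI allI impI)
    fix t assume t: "0 < t \<and> t < M"
    then obtain e y where ey: "e \<in> Es G" "y \<in> edom G e" "u e y = t" using value_attained by blast
    show "\<exists>e'\<in>Es G. \<exists>y\<in>edom G e'. u e' y = t \<and> \<not> (e' = e2 \<and> p2 < y \<and> y < r2)"
    proof (cases "e = e2 \<and> p2 < y \<and> y < r2")
      case True
      then have "t \<in> u e2 ` {p2..r2}" using ey by (intro image_eqI[of _ _ y]) auto
      then have "t \<in> u e1 ` {p1..r1}" using cc by auto
      then obtain y' where y': "y' \<in> {p1..r1}" "u e1 y' = t" by auto
      moreover have "e1 \<in> Es G" "y' \<in> edom G e1" using hp(1) y' unfolding high_piece_def by auto
      moreover have "\<not> (e1 = e2 \<and> p2 < y' \<and> y' < r2)" using hp(3) y' by auto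
      ultimately show ?thesis by blast
    qed (use ey in blast)
  qed (use hp(2) in \<open>auto simp: high_piece_def\<close>)
  obtain e1 p1 r1 e2 p2 r2 where hp: "high_piece e1 p1 r1" "high_piece e2 p2 r2" "e1 \<noteq> e2 \<or> r1 \<le> p2 \<or> r2 \<le> p1"
    using two_high_pieces by blast
  obtain c1 c2 where c: "u e1 ` {p1..r1} = {c1..M}" "u e2 ` {p2..r2} = {c2..M}" using im[OF hp(1)] im[OF hp(2)] by blast
  show ?thesis
  proof (cases "c1 \<le> c2")
    case True then show ?thesis using key[OF hp c] by blast
  next
    case False
    have "e2 \<noteq> e1 \<or> r2 \<le> p1 \<or> r1 \<le> p2" using hp(3) by auto
    then show ?thesis using key[OF hp(2,1) _ c(2,1)] False by auto
  qed
qed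

text \<open>By \<open>Q_segment\<close> the image has diameter at most half the action. Placing it
  in an interval of that length prepares a covering argument.\<close>

lemma Prim_image_cover:
  assumes F: "calibrating F" and e: "e \<in> Es G" and S: "S \<in> sets lborel" "is_interval S" "S \<subseteq> edom G e" "S \<noteq> {}"
  shows "\<exists>k. (\<lambda>x. Prim F (u e x)) ` S \<subseteq> {k..k + Q F e S / 2}"
proof -
  define J where "J = (\<lambda>x. Prim F (u e x)) ` S"
  have J: "J \<noteq> {}" unfolding J_def using S by auto
  have dia: "t - Q F e S / 2 \<le> s" if st: "s \<in> J" "t \<in> J" for s t
  proof -
    obtain x y where xy: "x \<in> S" "y \<in> S" "s = Prim F (u e x)" "t = Prim F (u e y)" using st unfolding J_def by blast
    define a where "a = min x y"
    define b where "b = max x y"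
    have ab: "a \<in> S" "b \<in> S" "a \<le> b" unfolding a_def b_def using xy by (auto simp: min_def max_def)
    have "2 * \<bar>Prim F (u e b) - Prim F (u e a)\<bar> \<le> Q F e {a..b}"
      using ab S by (intro Q_segment[OF F e]) auto
    also have "\<dots> \<le> Q F e S" using Icc_subset_interval[OF S(2) ab(1,2)] S by (intro Q_mono[OF F e]) auto
    finally have "2 * \<bar>t - s\<bar> \<le> Q F e S" unfolding a_def b_def xy
      by (cases "x \<le> y") (auto simp: min_def max_def abs_minus_commute)
    then have "\<bar>t - s\<bar> \<le> Q F e S / 2" by simp
    then show ?thesis using abs_ge_self[of "t - s"] by linarith
  qed
  have bd: "bdd_below J" using J dia unfolding bdd_below_def by blast
  have "t \<in> {Inf J..Inf J + Q F e S / 2}" if "t \<in> J" for t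
  proof -
    have "t - Q F e S / 2 \<le> Inf J" by (rule cInf_greatest[OF J]) (rule dia[OF _ that])
    then show ?thesis using cInf_lower[OF that bd] by simp
  qed
  then show ?thesis unfolding J_def by blast
qed

text \<open>By \<open>rem\<close>, the images of the graph without the open removed piece still
  cover the interval from 0 to \<open>Prim F M\<close>. Each image lies in an interval of length
  half its action, so comparing Lebesgue measures gives the bound; no choice of routes is
  involved.\<close>

lemma Q_removable:
  assumes F: "calibrating F" and e: "e \<in> Es G" and pr: "p < r" "{p..r} \<subseteq> edom G e"
    and rem: "\<And>t. 0 < t \<Longrightarrow> t < M \<Longrightarrow> \<exists>e'\<in>Es G. \<exists>y\<in>edom G e'. u e' y = t \<and> \<not> (e' = e \<and> p < y \<and> y < r)"
  shows "2 * Prim F M + Q F e {p..r} \<le> (\<Sum>e\<in>Es G. Q F e (edom G e))"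
proof -
  define SL where "SL = {0..p}"
  define SR where "SR = edom G e \<inter> {r..}"
  have p: "p \<in> edom G e" "r \<in> edom G e" using pr by auto
  have SL: "SL \<in> sets lborel" "is_interval SL" "SL \<subseteq> edom G e" "SL \<noteq> {}"
    unfolding SL_def using Icc_subset_edom[OF zero_in_edom[OF e] p(1)] edom_nonneg[OF p(1)] by (auto simp: is_interval_cc)
  have SR: "SR \<in> sets lborel" "is_interval SR" "SR \<subseteq> edom G e" "SR \<noteq> {}"
    unfolding SR_def using p sets_edom by (auto intro!: is_interval_Int is_interval_edom is_interval_ci)
  obtain kL where kL: "(\<lambda>x. Prim F (u e x)) ` SL \<subseteq> {kL..kL + Q F e SL / 2}" using Prim_image_cover[OF F e SL] by blast
  obtain kR where kR: "(\<lambda>x. Prim F (u e x)) ` SR \<subseteq> {kR..kR + Q F e SR / 2}" using Prim_image_cover[OF F e SR] by blast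
  have "\<exists>k. (\<lambda>x. Prim F (u e' x)) ` edom G e' \<subseteq> {k..k + Q F e' (edom G e') / 2}" if "e' \<in> Es G" for e'
    using Prim_image_cover[OF F that sets_edom is_interval_edom] zero_in_edom[OF that] by auto
  then obtain k where k: "\<And>e'. e' \<in> Es G \<Longrightarrow> (\<lambda>x. Prim F (u e' x)) ` edom G e' \<subseteq> {k e'..k e' + Q F e' (edom G e') / 2}"
    by metis
  define K where "K = (\<Union>e'\<in>Es G - {e}. {k e'..k e' + Q F e' (edom G e') / 2})"
  define KL where "KL = {kL..kL + Q F e SL / 2}"
  define KR where "KR = {kR..kR + Q F e SR / 2}"
  have P0: "0 \<le> Prim F M" using Prim_calibrating_mono[OF F, of 0 M] M_pos by simp
  have cover: "{0<..<Prim F M} \<subseteq> K \<union> (KL \<union> KR)"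
  proof
    fix s assume s: "s \<in> {0<..<Prim F M}"
    have "continuous_on {0..M} (Prim F)" using F unfolding calibrating_def by (intro continuous_on_Prim) simp
    then obtain t where t: "0 \<le> t" "t \<le> M" "Prim F t = s" using IVT'[of "Prim F" 0 s M] s M_pos by auto
    have "t \<noteq> 0" "t \<noteq> M" using t s by auto
    then obtain e' y where ey: "e' \<in> Es G" "y \<in> edom G e'" "u e' y = t" "\<not> (e' = e \<and> p < y \<and> y < r)"
      using rem[of t] t by auto
    show "s \<in> K \<union> (KL \<union> KR)"
    proof (cases "e' = e")
      case False
      then have "s \<in> K" unfolding K_def using k[OF ey(1)] ey t by (intro UN_I[of e']) auto
      then show ?thesis by simp
    next
      case True
      then have "y \<in> SL \<or> y \<in> SR" using ey edom_nonneg[OF ey(2)] unfolding SL_def SR_def by auto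
      then have "s \<in> KL \<or> s \<in> KR" unfolding KL_def KR_def using kL kR ey(3) t(3) True by blast
      then show ?thesis by auto
    qed
  qed
  have cmp: "compact (K \<union> (KL \<union> KR))" unfolding K_def KL_def KR_def
    using finite_Es by (intro compact_Un compact_UN) auto
  have mK: "measure lborel K \<le> (\<Sum>e'\<in>Es G - {e}. Q F e' (edom G e') / 2)"
  proof -
    have "measure lborel K \<le> (\<Sum>e'\<in>Es G - {e}. measure lborel {k e'..k e' + Q F e' (edom G e') / 2})"
      unfolding K_def using finite_Es by (intro measure_UNION_le) auto
    also have "\<dots> = (\<Sum>e'\<in>Es G - {e}. Q F e' (edom G e') / 2)" by (intro sum.cong) (auto simp: Q_nonneg)
    finally show ?thesis .
  qed
  have Km: "K \<in> sets lborel" unfolding K_def by (intro sets.finite_UN) (use finite_Es in auto)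
  have "Prim F M = measure lborel {0<..<Prim F M}" using P0 by simp
  also have "\<dots> \<le> measure lborel (K \<union> (KL \<union> KR))"
    by (rule measure_mono_fmeasurable[OF cover]) (use fmeasurable_compact[OF cmp] in auto)
  also have "\<dots> \<le> measure lborel K + measure lborel (KL \<union> KR)"
    by (rule measure_Un_le[OF Km]) (auto simp: KL_def KR_def)
  also have "measure lborel (KL \<union> KR) \<le> measure lborel KL + measure lborel KR"
    by (rule measure_Un_le) (auto simp: KL_def KR_def)
  finally have main: "2 * Prim F M \<le> (\<Sum>e'\<in>Es G - {e}. Q F e' (edom G e')) + Q F e SL + Q F e SR"
    using mK unfolding KL_def KR_def by (simp add: Q_nonneg sum_divide_distrib[symmetric])
  have "Q F e SL + Q F e {p..r} \<le> Q F e {0..r}"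
    using Icc_subset_edom[OF zero_in_edom[OF e] p(2)] pr edom_nonneg[OF p(1)] unfolding SL_def
    by (intro Q_split[OF F e, where p = p]) auto
  moreover have "Q F e {0..r} + Q F e SR \<le> Q F e (edom G e)"
    using Icc_subset_edom[OF zero_in_edom[OF e] p(2)] SR sets_edom unfolding SR_def
    by (intro Q_split[OF F e, where p = r]) auto
  ultimately show ?thesis using main sum.remove[OF finite_Es e, of "\<lambda>e. Q F e (edom G e)"] by linarith
qed

text \<open>With \<open>N = M\<close> the removed piece might contribute nothing, since
  \<open>V\<close> vanishes where \<open>u = M\<close>; only a nonnegative energy would follow. For
  \<open>N > M\<close> it contributes a definite amount, and the point is that the estimate
  elsewhere deteriorates more slowly.\<close>

lemma energy_pos_of_critical_mass:
  assumes mass: "mass G u = mu_Rplus"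
  shows "0 < energy G u u'"
proof -
  obtain e p r where epr: "e \<in> Es G" "p < r" "{p..r} \<subseteq> edom G e" "\<forall>x\<in>{p..r}. M / 2 \<le> u e x"
    "\<forall>t. 0 < t \<and> t < M \<longrightarrow> (\<exists>e'\<in>Es G. \<exists>y\<in>edom G e'. u e' y = t \<and> \<not> (e' = e \<and> p < y \<and> y < r))"
    using ex_removable by blast
  define k where "k = (r - p) * (M / 2)\<^sup>2 / 3"
  have k: "k > 0" unfolding k_def using epr(2) M_pos by simp
  \<comment> \<open>The loss \<open>b - cos b * sin b\<close> is of third order in \<open>b\<close>,
    the gain \<open>k * (sin b)^2\<close> of second order.\<close>
  have "eventually (\<lambda>b::real. 0 < (cos b * sin b - b) / (2 * sqrt 3) + k * (sin b)\<^sup>2) (at_right 0)"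
    using k by real_asymp
  moreover have "eventually (\<lambda>b::real. b \<in> {0<..<pi / 2}) (at_right 0)"
    by (rule eventually_at_right_real) simp
  ultimately have "eventually (\<lambda>b::real. 0 < (cos b * sin b - b) / (2 * sqrt 3) + k * (sin b)\<^sup>2 \<and> b \<in> {0<..<pi / 2}) (at_right 0)"
    by (rule eventually_conj)
  then obtain b where b: "0 < (cos b * sin b - b) / (2 * sqrt 3) + k * (sin b)\<^sup>2" "0 < b" "b < pi / 2"
    using eventually_happens'[OF trivial_limit_at_right_real] by auto
  have cb: "0 < cos b" "cos b \<le> 1" using b by (auto intro: cos_gt_zero)
  have sb: "0 \<le> sin b" using b by (intro sin_ge_zero) auto
  \<comment> \<open>Setting \<open>M^2 / N^2 = cos b\<close> makes the primitive explicit, because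
    \<open>arcsin (cos b) = pi / 2 - b\<close>.\<close>
  define N where "N = M / sqrt (cos b)"
  have N2: "M\<^sup>2 / N\<^sup>2 = cos b" unfolding N_def using cb M_pos by (simp add: power_divide)
  have sq1: "sqrt (cos b) \<le> 1" using cb by simp
  have MN: "M \<le> N" unfolding N_def using cb M_pos sq1 by (simp add: le_divide_eq mult_left_le)
  have N0: "N > 0" using MN M_pos by simp
  have M4: "M^4 = N^4 * (cos b)\<^sup>2"
  proof -
    have "M\<^sup>2 = cos b * N\<^sup>2" using N2 N0 by (simp add: field_simps)
    then have "(M\<^sup>2)\<^sup>2 = (cos b * N\<^sup>2)\<^sup>2" by simp
    then show ?thesis by (simp add: power_mult_distrib mult.commute)
  qed
  note F = calibrating_soliton_slope[OF MN]
  have Pr: "Prim (soliton_slope N) M = N^4 / (4 * sqrt 3) * (pi / 2 - b + cos b * sin b)"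
  proof -
    have "arcsin (cos b) = pi / 2 - b"
      using arcsin_sin[of "pi / 2 - b"] b by (simp add: sin_diff)
    moreover have "sqrt (1 - (cos b)\<^sup>2) = sin b" using sb by (simp add: sin_squared_eq[symmetric])
    ultimately show ?thesis using Prim_soliton[OF N0 _ MN] M_pos unfolding N2 by simp
  qed
  \<comment> \<open>On the piece \<open>V(u)\<close> is at least
    \<open>(M / 2)^2 (N^4 - M^4) / 3\<close>, and \<open>N^4 - M^4 = N^4 (sin b)^2\<close>.\<close>
  have Qpr: "k * (N^4 * (sin b)\<^sup>2) \<le> Q (soliton_slope N) e {p..r}"
  proof -
    have "k * (N^4 * (sin b)\<^sup>2) = (r - p) * ((M / 2)\<^sup>2 * (N^4 - M^4) / 3)"
    proof -
      have "N^4 * (sin b)\<^sup>2 = N^4 - M^4" unfolding M4 sin_squared_eq by (simp add: algebra_simps)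
      then show ?thesis unfolding k_def by simp
    qed
    also have "\<dots> = (LINT x:{p..r}|lborel. (M / 2)\<^sup>2 * (N^4 - M^4) / 3)"
      by (rule set_integral_Icc_const(2)[symmetric]) (use epr(2) in simp)
    also have "\<dots> \<le> Q (soliton_slope N) e {p..r}"
      unfolding Q_def
    proof (rule set_integral_mono)
      show "set_integrable lborel {p..r} (\<lambda>x. (u' e x)\<^sup>2 + (soliton_slope N (u e x))\<^sup>2)"
        by (rule set_integrable_subset[OF Q_integrable(2)[OF F epr(1)]]) (use epr in auto)
      fix x assume x: "x \<in> {p..r}"
      have ux: "M / 2 \<le> u e x" "u e x \<le> M" using epr x u_range[OF epr(1)] by auto
      have p4: "(u e x)^4 \<le> M^4" "M^4 \<le> N^4" using ux MN M_pos by (auto intro!: power_mono)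
      have "(M / 2)\<^sup>2 * (N^4 - M^4) \<le> (u e x)\<^sup>2 * (N^4 - (u e x)^4)"
        using ux M_pos p4 by (intro mult_mono power_mono) auto
      moreover have "(soliton_slope N (u e x))\<^sup>2 = (u e x)\<^sup>2 * (N^4 - (u e x)^4) / 3"
        using ux M_pos MN by (intro soliton_slope_sq) auto
      moreover have "0 \<le> (u' e x)\<^sup>2" by simp
      ultimately show "(M / 2)\<^sup>2 * (N^4 - M^4) / 3 \<le> (u' e x)\<^sup>2 + (soliton_slope N (u e x))\<^sup>2" by linarith
    qed (rule set_integral_Icc_const(1), use epr(2) in simp)
    finally show ?thesis .
  qed
  have "2 * Prim (soliton_slope N) M + Q (soliton_slope N) e {p..r} \<le> (\<Sum>e\<in>Es G. Q (soliton_slope N) e (edom G e))"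
    by (rule Q_removable[OF F epr(1,2,3)]) (use epr(5) in blast)
  then have "2 * (N^4 / (4 * sqrt 3) * (pi / 2 - b + cos b * sin b)) + k * (N^4 * (sin b)\<^sup>2) - N^4 / 3 * mu_Rplus \<le> 2 * energy G u u'"
    using twice_energy_eq[OF MN, unfolded mass] Qpr unfolding Pr by linarith
  moreover have "2 * (N^4 / (4 * sqrt 3) * (pi / 2 - b + cos b * sin b)) + k * (N^4 * (sin b)\<^sup>2) - N^4 / 3 * mu_Rplus
     = N^4 * ((cos b * sin b - b) / (2 * sqrt 3) + k * (sin b)\<^sup>2)"
  proof -
    have "mu_Rplus / 3 = pi / (4 * sqrt 3)" unfolding mu_Rplus_def
      using real_sqrt_mult_self[of 3] by (simp add: field_simps)
    then have eq: "N^4 / 3 * mu_Rplus = N^4 * (pi / (4 * sqrt 3))" by (metis times_divide_eq_left times_divide_eq_right)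
    show ?thesis unfolding eq by (simp add: field_simps)
  qed
  moreover have "0 < N^4 * ((cos b * sin b - b) / (2 * sqrt 3) + k * (sin b)\<^sup>2)" using b(1) N0 by simp
  ultimately show ?thesis by linarith
qed

end

section \<open>Energy bounds for masses up to \<open>mu_R\<close>\<close>

lemma mu_R_third: "mu_R / 3 = pi / (2 * sqrt 3)"
  unfolding mu_R_def using real_sqrt_mult_self[of 3] by (simp add: field_simps)

text \<open>This expresses that solitons on the line have zero energy: rising to \<open>M\<close>
  and falling again costs \<open>2 Prim\<close> each, balanced by the mass term at mass
  \<open>mu_R\<close>.\<close>

lemma Prim_soliton_peak_mu_R: "M > 0 \<Longrightarrow> 4 * Prim (soliton_slope M) M = M^4 / 3 * mu_R"
proof -
  assume "M > 0"
  then have "4 * Prim (soliton_slope M) M = M^4 * (pi / (2 * sqrt 3))" by (simp add: Prim_soliton_peak)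
  also have "\<dots> = M^4 / 3 * mu_R" unfolding mu_R_third[symmetric] by simp
  finally show ?thesis .
qed

context nonneg_profile
begin

text \<open>The hypothesis of \<open>Q_two_routes\<close> on low points; it holds precisely when
  \<open>a\<close> is at least the largest of the minima over half edges.\<close>

definition low_ends :: "real \<Rightarrow> bool" where
  "low_ends a \<longleftrightarrow> (\<forall>e\<in>Es G. e \<noteq> h \<longrightarrow>
     (\<exists>y\<in>{0..len G e / 2}. u e y \<le> a) \<and> (\<exists>y\<in>{len G e / 2..len G e}. u e y \<le> a))"

text \<open>Routes that stop at level \<open>a\<close> miss an amount
  \<open>4 Prim (soliton_slope M) a\<close>, of order \<open>a^2 M^2\<close>; the rest compensates
  for the mass term.\<close>

lemma energy_ge_low:
  assumes a: "0 < a" "a \<le> M" "low_ends a" and mass: "mass G u \<le> mu_R"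
  shows "- (2 / sqrt 3 * (a\<^sup>2 * M\<^sup>2)) \<le> 2 * energy G u u'"
proof -
  note F = calibrating_soliton_slope[OF order.refl]
  have "4 * (Prim (soliton_slope M) M - Prim (soliton_slope M) a) \<le> (\<Sum>e\<in>Es G. Q (soliton_slope M) e (edom G e))"
    by (rule Q_two_routes[OF F a(1,2)]) (use a(3) in \<open>auto simp: low_ends_def\<close>)
  then have 1: "4 * Prim (soliton_slope M) M - 4 * Prim (soliton_slope M) a \<le> (\<Sum>e\<in>Es G. Q (soliton_slope M) e (edom G e))"
    by (simp add: right_diff_distrib)
  have 2: "4 * Prim (soliton_slope M) a \<le> 2 / sqrt 3 * (a\<^sup>2 * M\<^sup>2)"
    using mult_left_mono[OF Prim_soliton_le[of a M], of 4] a(1) by (simp add: mult.commute)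
  have 3: "M^4 / 3 * mass G u \<le> M^4 / 3 * mu_R" using mass M_pos by (intro mult_left_mono) auto
  show ?thesis using 1 2 3 twice_energy_eq[OF order.refl] Prim_soliton_peak_mu_R[OF M_pos] by linarith
qed

lemma energy_ge_gain:
  assumes a: "0 < a" "a \<le> M" "low_ends a" and mass: "mass G u \<le> mu_R"
    and e1: "e1 \<in> Es G" and pq: "p \<le> q" "{p..q} \<subseteq> edom G e1" and ge: "\<And>x. x \<in> {p..q} \<Longrightarrow> a \<le> u e1 x"
  shows "a\<^sup>2 * M\<^sup>2 * ((M\<^sup>2 * (q - p) - mu_R) / 3 - 4 / sqrt 3 * (1 / 2 + ln (M / a))) \<le> 2 * energy G u u'"
proof -
  note F = calibrating_soliton_slope[OF order.refl] and D = calibrating_damped_slope[OF a(1)]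
  define K where "K = (LINT x:{p..q}|lborel. a\<^sup>2 * (M^4 - (u e1 x)^4) / 3)"
  have sq: "(soliton_slope M t)\<^sup>2 = t\<^sup>2 * (M^4 - t^4) / 3" if "t \<in> {0..M}" for t
    using that by (intro soliton_slope_sq) auto
  have le: "Q (damped_slope a M) e (edom G e) \<le> Q (soliton_slope M) e (edom G e)" if e: "e \<in> Es G" for e
    unfolding Q_def
  proof (rule set_integral_mono[OF Q_integrable(2)[OF D e] Q_integrable(2)[OF F e]])
    fix x assume "x \<in> edom G e"
    then show "(u' e x)\<^sup>2 + (damped_slope a M (u e x))\<^sup>2 \<le> (u' e x)\<^sup>2 + (soliton_slope M (u e x))\<^sup>2"
      using damped_slope_sq_le(1)[OF a(1), of "u e x" M] sq[of "u e x"] u_range[OF e] by force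
  qed
  have cont: "continuous_on {p..q} (u e1)" using in_H1_edge(5)[OF H e1] pq(2) by (rule continuous_on_subset)
  have ki: "set_integrable lborel {p..q} (\<lambda>x. a\<^sup>2 * (M^4 - (u e1 x)^4) / 3)"
    by (intro borel_integrable_atLeastAtMost' continuous_intros cont) auto
  have kind: "indicat_real (edom G e1) x *\<^sub>R (indicat_real {p..q} x * c) = indicat_real {p..q} x *\<^sub>R c" for x c
    using pq(2) by (auto split: split_indicator)
  have ki2: "set_integrable lborel (edom G e1) (\<lambda>x. indicat_real {p..q} x * (a\<^sup>2 * (M^4 - (u e1 x)^4) / 3))"
    using ki unfolding set_integrable_def kind .
  have K2: "K = (LINT x:edom G e1|lborel. indicat_real {p..q} x * (a\<^sup>2 * (M^4 - (u e1 x)^4) / 3))"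
    unfolding K_def set_lebesgue_integral_def kind ..
  have gain: "Q (damped_slope a M) e1 (edom G e1) + K \<le> Q (soliton_slope M) e1 (edom G e1)"
  proof -
    have "Q (damped_slope a M) e1 (edom G e1) + K = (LINT x:edom G e1|lborel. ((u' e1 x)\<^sup>2 + (damped_slope a M (u e1 x))\<^sup>2)
        + indicat_real {p..q} x * (a\<^sup>2 * (M^4 - (u e1 x)^4) / 3))"
      unfolding Q_def K2 by (rule set_integral_add(2)[symmetric, OF Q_integrable(2)[OF D e1] ki2])
    also have "\<dots> \<le> Q (soliton_slope M) e1 (edom G e1)"
      unfolding Q_def
    proof (rule set_integral_mono[OF set_integral_add(1)[OF Q_integrable(2)[OF D e1] ki2] Q_integrable(2)[OF F e1]])
      fix x assume x: "x \<in> edom G e1"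
      have r: "0 \<le> u e1 x" "u e1 x \<le> M" using u_range[OF e1 x] by auto
      have s: "(soliton_slope M (u e1 x))\<^sup>2 = (u e1 x)\<^sup>2 * (M^4 - (u e1 x)^4) / 3" using r by (intro sq) auto
      show "(u' e1 x)\<^sup>2 + (damped_slope a M (u e1 x))\<^sup>2 + indicat_real {p..q} x * (a\<^sup>2 * (M^4 - (u e1 x)^4) / 3)
          \<le> (u' e1 x)\<^sup>2 + (soliton_slope M (u e1 x))\<^sup>2"
      proof (cases "x \<in> {p..q}")
        case True
        then show ?thesis using damped_slope_sq_le(2)[OF a(1) r ge[OF True]] s by simp
      next
        case False
        then show ?thesis using damped_slope_sq_le(1)[OF a(1) r] s by simp
      qed
    qed
    finally show ?thesis .
  qed
  have sum: "(\<Sum>e\<in>Es G. Q (damped_slope a M) e (edom G e)) + K \<le> (\<Sum>e\<in>Es G. Q (soliton_slope M) e (edom G e))"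
  proof -
    have "(\<Sum>e\<in>Es G - {e1}. Q (damped_slope a M) e (edom G e)) \<le> (\<Sum>e\<in>Es G - {e1}. Q (soliton_slope M) e (edom G e))"
      by (intro sum_mono le) auto
    then show ?thesis using gain sum.remove[OF finite_Es e1, of "\<lambda>e. Q (damped_slope a M) e (edom G e)"]
      sum.remove[OF finite_Es e1, of "\<lambda>e. Q (soliton_slope M) e (edom G e)"] by linarith
  qed
  have "4 * (Prim (damped_slope a M) M - Prim (damped_slope a M) a) \<le> (\<Sum>e\<in>Es G. Q (damped_slope a M) e (edom G e))"
    by (rule Q_two_routes[OF D a(1,2)]) (use a(3) in \<open>auto simp: low_ends_def\<close>)
  moreover have "4 * (M^4 * pi / (8 * sqrt 3) - a\<^sup>2 * M\<^sup>2 / (2 * sqrt 3) - a\<^sup>2 * M\<^sup>2 / sqrt 3 * ln (M / a))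
     \<le> 4 * (Prim (damped_slope a M) M - Prim (damped_slope a M) a)"
    using Prim_damped_ge[OF a(1,2)] by (rule mult_left_mono) simp
  moreover have "4 * (M^4 * pi / (8 * sqrt 3) - a\<^sup>2 * M\<^sup>2 / (2 * sqrt 3) - a\<^sup>2 * M\<^sup>2 / sqrt 3 * ln (M / a))
      = M^4 / 3 * mu_R - a\<^sup>2 * M\<^sup>2 * (4 / sqrt 3 * (1 / 2 + ln (M / a)))"
  proof -
    have eq: "M^4 / 3 * mu_R = M^4 * (pi / (2 * sqrt 3))" unfolding mu_R_third[symmetric] by simp
    show ?thesis unfolding eq by (simp add: field_simps)
  qed
  moreover have "a\<^sup>2 * M\<^sup>2 * ((M\<^sup>2 * (q - p) - mu_R) / 3) \<le> K"
  proof -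
    have u2: "set_integrable lborel {p..q} (\<lambda>x. (u e1 x)\<^sup>2)"
      by (rule set_integrable_subset[OF in_H1_edge(2)[OF H e1]]) (use pq in auto)
    have "(LINT x:{p..q}|lborel. (u e1 x)\<^sup>2) \<le> (LINT x:edom G e1|lborel. (u e1 x)\<^sup>2)"
      by (rule set_integral_subset_le[OF in_H1_edge(2)[OF H e1]]) (use pq in auto)
    also have "\<dots> \<le> mass G u" unfolding mass_eq
      by (rule member_le_sum[OF e1 _ finite_Es]) (auto intro: set_integral_nonneg')
    finally have m: "(LINT x:{p..q}|lborel. (u e1 x)\<^sup>2) \<le> mu_R" using mass by simp
    have c: "set_integrable lborel {p..q} (\<lambda>x. M^4 * (a\<^sup>2 / 3))" "(LINT x:{p..q}|lborel. M^4 * (a\<^sup>2 / 3)) = (q - p) * (M^4 * (a\<^sup>2 / 3))"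
      by (rule set_integral_Icc_const[OF pq(1)])+
    have "(q - p) * (M^4 * (a\<^sup>2 / 3)) - (M\<^sup>2 * a\<^sup>2 / 3) * mu_R \<le> (q - p) * (M^4 * (a\<^sup>2 / 3)) - (M\<^sup>2 * a\<^sup>2 / 3) * (LINT x:{p..q}|lborel. (u e1 x)\<^sup>2)"
      using m by (intro diff_left_mono mult_left_mono) auto
    also have "\<dots> = (LINT x:{p..q}|lborel. M^4 * (a\<^sup>2 / 3)) - (LINT x:{p..q}|lborel. (M\<^sup>2 * a\<^sup>2 / 3) * (u e1 x)\<^sup>2)"
      by (simp only: c(2) set_integral_mult_right[where a = "M\<^sup>2 * a\<^sup>2 / 3"])
    also have "\<dots> = (LINT x:{p..q}|lborel. M^4 * (a\<^sup>2 / 3) - (M\<^sup>2 * a\<^sup>2 / 3) * (u e1 x)\<^sup>2)"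
      by (rule set_integral_diff(2)[symmetric, OF c(1) set_integrable_mult_right[OF u2]])
    also have "\<dots> \<le> K" unfolding K_def
    proof (rule set_integral_mono[OF _ ki])
      show "set_integrable lborel {p..q} (\<lambda>x. M^4 * (a\<^sup>2 / 3) - (M\<^sup>2 * a\<^sup>2 / 3) * (u e1 x)\<^sup>2)"
        by (rule set_integral_diff(1)[OF c(1) set_integrable_mult_right[OF u2]])
      fix x assume "x \<in> {p..q}"
      then have r: "0 \<le> u e1 x" "u e1 x \<le> M" using u_range[OF e1] pq(2) by auto
      have "(u e1 x)\<^sup>2 * (u e1 x)\<^sup>2 \<le> M\<^sup>2 * (u e1 x)\<^sup>2" using r by (intro mult_right_mono power_mono) auto
      then have "(u e1 x)^4 \<le> M\<^sup>2 * (u e1 x)\<^sup>2" by (simp add: power_add[symmetric])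
      then have "a\<^sup>2 / 3 * (u e1 x)^4 \<le> a\<^sup>2 / 3 * (M\<^sup>2 * (u e1 x)\<^sup>2)" by (intro mult_left_mono) auto
      then show "M^4 * (a\<^sup>2 / 3) - (M\<^sup>2 * a\<^sup>2 / 3) * (u e1 x)\<^sup>2 \<le> a\<^sup>2 * (M^4 - (u e1 x)^4) / 3"
        by (simp add: field_simps)
    qed
    finally have "(q - p) * (M^4 * (a\<^sup>2 / 3)) - (M\<^sup>2 * a\<^sup>2 / 3) * mu_R \<le> K" .
    moreover have "a\<^sup>2 * M\<^sup>2 * ((M\<^sup>2 * (q - p) - mu_R) / 3) = (q - p) * (M^4 * (a\<^sup>2 / 3)) - (M\<^sup>2 * a\<^sup>2 / 3) * mu_R"
      by (simp add: field_simps power2_eq_square power4_eq_xxxx)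
    ultimately show ?thesis by simp
  qed
  moreover have "M^4 / 3 * mass G u \<le> M^4 / 3 * mu_R" using mass M_pos by (intro mult_left_mono) auto
  moreover have "a\<^sup>2 * M\<^sup>2 * ((M\<^sup>2 * (q - p) - mu_R) / 3 - 4 / sqrt 3 * (1 / 2 + ln (M / a)))
     = a\<^sup>2 * M\<^sup>2 * ((M\<^sup>2 * (q - p) - mu_R) / 3) - a\<^sup>2 * M\<^sup>2 * (4 / sqrt 3 * (1 / 2 + ln (M / a)))"
    by (rule right_diff_distrib)
  ultimately show ?thesis using sum twice_energy_eq[OF order.refl] by linarith
qed

lemma ex_half_edge_min:
  obtains a e1 p q where "0 \<le> a" "a \<le> M" "low_ends a" "e1 \<in> Es G" "e1 \<noteq> h" "q - p = len G e1 / 2" "{p..q} \<subseteq> edom G e1"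
    "\<forall>x\<in>{p..q}. a \<le> u e1 x"
proof -
  \<comment> \<open>The Boolean selects the first or the second half of the edge.\<close>
  define I where "I = (\<lambda>(e, b). if b then {0..len G e / 2} else {len G e / 2..len G e})"
  define S where "S = (Es G - {h}) \<times> (UNIV :: bool set)"
  have S: "finite S" "S \<noteq> {}" unfolding S_def using finite_Es ex_bounded_edge by auto
  have I: "I (e, b) \<subseteq> edom G e" "compact (I (e, b))" "I (e, b) \<noteq> {}" if "e \<in> Es G" "e \<noteq> h" for e b
    using len_pos[OF that] edom_bounded[OF that(2)] unfolding I_def by auto
  have "\<exists>y\<in>I s. \<forall>x\<in>I s. u (fst s) y \<le> u (fst s) x" if s: "s \<in> S" for s
  proof -
    obtain e b where eb: "s = (e, b)" "e \<in> Es G" "e \<noteq> h" using s unfolding S_def by auto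
    have "continuous_on (I s) (u e)" using in_H1_edge(5)[OF H eb(2)] I[OF eb(2,3)] eb(1) continuous_on_subset by blast
    then show ?thesis using continuous_attains_inf[of "I s" "u e"] I[OF eb(2,3)] eb(1) by auto
  qed
  then obtain m where m: "\<And>s. s \<in> S \<Longrightarrow> m s \<in> I s" "\<And>s x. s \<in> S \<Longrightarrow> x \<in> I s \<Longrightarrow> u (fst s) (m s) \<le> u (fst s) x"
    by metis
  define V where "V = (\<lambda>s. u (fst s) (m s)) ` S"
  have V: "finite V" "V \<noteq> {}" unfolding V_def using S by auto
  obtain s1 where s1: "s1 \<in> S" "Max V = u (fst s1) (m s1)" using Max_in[OF V] unfolding V_def by auto
  have mx: "u (fst s) (m s) \<le> Max V" if "s \<in> S" for s using Max_ge[OF V(1)] that unfolding V_def by auto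
  obtain e1 b1 where eb: "s1 = (e1, b1)" "e1 \<in> Es G" "e1 \<noteq> h" using s1 unfolding S_def by auto
  have le: "low_ends (Max V)" unfolding low_ends_def
  proof (intro ballI impI conjI)
    fix e assume e: "e \<in> Es G" "e \<noteq> h"
    have "(e, True) \<in> S" "(e, False) \<in> S" using e unfolding S_def by auto
    then show "\<exists>y\<in>{0..len G e / 2}. u e y \<le> Max V" "\<exists>y\<in>{len G e / 2..len G e}. u e y \<le> Max V"
      using m(1)[of "(e, True)"] m(1)[of "(e, False)"] mx[of "(e, True)"] mx[of "(e, False)"] unfolding I_def by auto
  qed
  have "m s1 \<in> edom G e1" using m(1)[OF s1(1)] I(1)[OF eb(2,3)] eb(1) by blast
  then have r: "0 \<le> Max V" "Max V \<le> M" using u_range[OF eb(2)] s1(2) eb(1) by auto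
  define p where "p = (if b1 then 0 else len G e1 / 2)"
  define q where "q = (if b1 then len G e1 / 2 else len G e1)"
  have pq: "I s1 = {p..q}" "q - p = len G e1 / 2" unfolding I_def eb(1) p_def q_def by auto
  show ?thesis
    by (rule that[OF r le eb(2,3) pq(2)]) (use I(1)[OF eb(2,3), of b1] m(2)[OF s1(1)] s1(2) eb(1) pq(1) in auto)
qed

end

section \<open>Uniform bound on maxima\<close>

context one_halfline_graph
begin

text \<open>A negative energy makes the bracket in \<open>energy_ge_gain\<close> negative, which
  forces \<open>a^2 < M^2 exp (d - k M^2)\<close>. Then \<open>energy_ge_low\<close> bounds the
  energy below by a multiple of \<open>- M^4 exp (d - k M^2)\<close>; this tends to 0 as
  \<open>M\<close> grows and thus exceeds \<open>- \<epsilon>\<close> for large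
  \<open>M\<close>.\<close>

lemma max_bounded_of_negative_energy:
  assumes eps: "\<epsilon> > 0"
  shows "\<exists>B. \<forall>u u' M e0 x0. nonneg_profile G u u' M e0 x0 \<longrightarrow> mass G u \<le> mu_R \<longrightarrow> energy G u u' \<le> - \<epsilon> \<longrightarrow> M \<le> B"
proof -
  define l where "l = Min ((\<lambda>e. len G e / 2) ` (Es G - {h}))"
  have fin: "finite ((\<lambda>e. len G e / 2) ` (Es G - {h}))" "(\<lambda>e. len G e / 2) ` (Es G - {h}) \<noteq> {}"
    using finite_Es ex_bounded_edge by auto
  obtain e where e: "e \<in> Es G" "e \<noteq> h" "l = len G e / 2" using Min_in[OF fin, folded l_def] by blast
  have l: "l > 0" using len_pos[OF e(1,2)] e(3) by simp
  have ll: "l \<le> len G e / 2" if "e \<in> Es G" "e \<noteq> h" for e unfolding l_def using that by (intro Min_le fin) auto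
  \<comment> \<open>Multiplication by \<open>c\<close> turns \<open>4 / sqrt 3 * (1 / 2 + X)\<close>
    into \<open>1 + 2 * X\<close>; the constants \<open>k\<close> and \<open>d\<close> are what it
    makes of the other side.\<close>
  define c where "c = sqrt 3 / 2"
  have c: "c > 0" unfolding c_def by simp
  have c': "c * (4 / sqrt 3) = 2" unfolding c_def by simp
  define k where "k = c * l / 3"
  have k: "k > 0" unfolding k_def using c l by simp
  define d where "d = 1 + c * mu_R / 3"
  have "((\<lambda>M::real. 2 / sqrt 3 * (M^4 * exp (d - k * M\<^sup>2))) \<longlongrightarrow> 0) at_top" using k by real_asymp
  then have "eventually (\<lambda>M::real. 2 / sqrt 3 * (M^4 * exp (d - k * M\<^sup>2)) < 2 * \<epsilon>) at_top"
    using eps by (intro order_tendstoD(2)) auto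
  then obtain B where B: "\<And>M. M \<ge> B \<Longrightarrow> 2 / sqrt 3 * (M^4 * exp (d - k * M\<^sup>2)) < 2 * \<epsilon>"
    unfolding eventually_at_top_linorder by blast
  have "M \<le> B" if np: "nonneg_profile G u u' M e0 x0" and mass: "mass G u \<le> mu_R" and en: "energy G u u' \<le> - \<epsilon>" for u u' M e0 x0
  proof (rule ccontr)
    assume "\<not> M \<le> B"
    then have BM: "2 / sqrt 3 * (M^4 * exp (d - k * M\<^sup>2)) < 2 * \<epsilon>" by (intro B) simp
    interpret nonneg_profile G u u' M e0 x0 by (rule np)
    obtain a e1 p q where a: "0 \<le> a" "a \<le> M" "low_ends a" "e1 \<in> Es G" "e1 \<noteq> h" "q - p = len G e1 / 2" "{p..q} \<subseteq> edom G e1"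
      "\<forall>x\<in>{p..q}. a \<le> u e1 x" using ex_half_edge_min by metis
    show False
    proof (cases "a = 0")
      case True
      \<comment> \<open>For \<open>a = 0\<close> the ratio \<open>M / a\<close> has no meaning, but
        every positive level is then admissible; this one is so small that the loss is at most
        \<open>\<epsilon>\<close>.\<close>
      define a' where "a' = min M (sqrt (\<epsilon> / (2 / sqrt 3 * M\<^sup>2)))"
      have pos: "0 < \<epsilon> / (2 / sqrt 3 * M\<^sup>2)" using eps M_pos by simp
      have a': "0 < a'" "a' \<le> M" unfolding a'_def using M_pos pos by auto
      have "low_ends a'" using a(3) a'(1) True unfolding low_ends_def by (meson less_imp_le order_trans)
      then have "- (2 / sqrt 3 * (a'\<^sup>2 * M\<^sup>2)) \<le> 2 * energy G u u'" using a' mass by (intro energy_ge_low)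
      moreover have "a'\<^sup>2 \<le> (sqrt (\<epsilon> / (2 / sqrt 3 * M\<^sup>2)))\<^sup>2" using a' by (intro power_mono) (auto simp: a'_def)
      then have "a'\<^sup>2 \<le> \<epsilon> / (2 / sqrt 3 * M\<^sup>2)" using pos by simp
      then have "a'\<^sup>2 * (2 / sqrt 3 * M\<^sup>2) \<le> \<epsilon>" using M_pos by (subst (asm) pos_le_divide_eq) auto
      then have "2 / sqrt 3 * (a'\<^sup>2 * M\<^sup>2) \<le> \<epsilon>" by (simp add: mult.commute mult.left_commute)
      ultimately show False using en eps by linarith
    next
      case False
      then have a0: "0 < a" using a(1) by simp
      have pq: "p \<le> q" using a(6) len_pos[OF a(4,5)] by linarith
      define Lq where "Lq = (M\<^sup>2 * l - mu_R) / 3"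
      define X where "X = ln (M / a)"
      have g: "a\<^sup>2 * M\<^sup>2 * ((M\<^sup>2 * (q - p) - mu_R) / 3 - 4 / sqrt 3 * (1 / 2 + X)) \<le> 2 * energy G u u'"
        unfolding X_def by (rule energy_ge_gain[OF a0 a(2,3) mass a(4) pq a(7)]) (use a(8) in blast)
      have "M\<^sup>2 * l \<le> M\<^sup>2 * (q - p)" unfolding a(6) using ll[OF a(4,5)] by (intro mult_left_mono) auto
      then have "Lq \<le> (M\<^sup>2 * (q - p) - mu_R) / 3" unfolding Lq_def by (intro divide_right_mono) auto
      then have "a\<^sup>2 * M\<^sup>2 * (Lq - 4 / sqrt 3 * (1 / 2 + X)) \<le> a\<^sup>2 * M\<^sup>2 * ((M\<^sup>2 * (q - p) - mu_R) / 3 - 4 / sqrt 3 * (1 / 2 + X))"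
        by (intro mult_left_mono) auto
      then have "a\<^sup>2 * M\<^sup>2 * (Lq - 4 / sqrt 3 * (1 / 2 + X)) < 0" using g en eps by linarith
      then have "Lq < 4 / sqrt 3 * (1 / 2 + X)" using a0 M_pos by (simp add: mult_less_0_iff)
      then have "c * Lq < c * (4 / sqrt 3 * (1 / 2 + X))" using c by (rule mult_strict_left_mono)
      also have "\<dots> = 1 + 2 * X" unfolding mult.assoc[symmetric] c' by simp
      finally have X: "- 2 * X < 1 - c * Lq" by simp
      have e2: "1 - c * Lq = d - k * M\<^sup>2" unfolding Lq_def d_def k_def by (simp add: field_simps)
      have "a = M * exp (- X)" unfolding X_def exp_minus using a0 M_pos by (simp add: exp_ln)
      then have "a\<^sup>2 = M\<^sup>2 * exp (- 2 * X)" by (simp add: power_mult_distrib exp_double[symmetric] power2_eq_square exp_add[symmetric])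
      also have "\<dots> \<le> M\<^sup>2 * exp (d - k * M\<^sup>2)" using X e2 by (intro mult_left_mono) auto
      finally have "a\<^sup>2 * M\<^sup>2 \<le> (M\<^sup>2 * exp (d - k * M\<^sup>2)) * M\<^sup>2" by (intro mult_right_mono) auto
      also have "\<dots> = M^4 * exp (d - k * M\<^sup>2)" by (simp add: power2_eq_square power4_eq_xxxx)
      finally have "2 / sqrt 3 * (a\<^sup>2 * M\<^sup>2) \<le> 2 / sqrt 3 * (M^4 * exp (d - k * M\<^sup>2))" by (intro mult_left_mono) auto
      moreover have "- (2 / sqrt 3 * (a\<^sup>2 * M\<^sup>2)) \<le> 2 * energy G u u'" by (rule energy_ge_low[OF a0 a(2,3) mass])
      ultimately show False using BM en by linarith
    qed
  qed
  then show ?thesis by blast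
qed

end

text \<open>On the tail \<open>f\<close> rises from \<open>f R\<close> to its maximum and then
  decays to 0. Compared with a full soliton only the ascent from 0 to \<open>f R\<close> is missing,
  an error of order \<open>(f R)^2\<close>. Hence a part of mass at most \<open>mu_R\<close> that
  escapes along the halfline carries no negative energy in the limit.\<close>

lemma tail_energy_ge:
  assumes H: "H1_on {R..} f g" and nn: "\<And>x. x \<ge> R \<Longrightarrow> 0 \<le> f x" and fB: "\<And>x. x \<ge> R \<Longrightarrow> f x \<le> B"
    and mass: "(LINT x:{R..}|lborel. (f x)\<^sup>2) \<le> mu_R" and i6: "set_integrable lborel {R..} (\<lambda>x. (f x)^6)"
  shows "- ((f R)\<^sup>2 * B\<^sup>2 / sqrt 3) \<le> (LINT x:{R..}|lborel. (g x)\<^sup>2) - (LINT x:{R..}|lborel. (f x)^6) / 3"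
proof -
  have f2: "set_integrable lborel {R..} (\<lambda>x. (f x)\<^sup>2)" and g2: "set_integrable lborel {R..} (\<lambda>x. (g x)\<^sup>2)"
    and ac: "AC_on {R..} f g" using H by (auto simp: H1_on_iff)
  have fc: "continuous_on {R..} f" by (rule AC_on_continuous[OF ac g2 is_interval_ci])
  have lim: "(f \<longlongrightarrow> 0) at_top" by (rule H1_on_atLeast_tendsto_0[OF H])
  obtain x0 where x0: "x0 \<ge> R" "\<And>y. y \<ge> R \<Longrightarrow> f y \<le> f x0"
    using continuous_attains_max_atLeast[OF fc lim nn] by blast
  define M where "M = f x0"
  have MB: "0 \<le> M" "M \<le> B" unfolding M_def using nn fB x0 by auto
  have rhs0: "(f R)\<^sup>2 * M\<^sup>2 / sqrt 3 \<le> (f R)\<^sup>2 * B\<^sup>2 / sqrt 3"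
    using MB by (intro divide_right_mono mult_left_mono power_mono) auto
  show ?thesis
  proof (cases "M = 0")
    case True
    then have "f x = 0" if "x \<ge> R" for x using nn[OF that] x0(2)[OF that] unfolding M_def by simp
    then have "(LINT x:{R..}|lborel. (f x)^6) = (LINT x:{R..}|lborel. 0)" by (intro set_lebesgue_integral_cong) auto
    then have "(LINT x:{R..}|lborel. (f x)^6) = 0" by simp
    moreover have "0 \<le> (LINT x:{R..}|lborel. (g x)\<^sup>2)" by (rule set_integral_nonneg') simp
    moreover have "0 \<le> (f R)\<^sup>2 * B\<^sup>2 / sqrt 3" by simp
    ultimately show ?thesis by linarith
  next
    case False
    then have M0: "M > 0" using MB by simp
    have rng: "f x \<in> {0..M}" if "x \<ge> R" for x using nn[OF that] x0(2)[OF that] unfolding M_def by simp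
    define F where "F = soliton_slope M"
    define q where "q = (\<lambda>x. (g x)\<^sup>2 + (F (f x))\<^sup>2)"
    have Fsq: "(F (f x))\<^sup>2 = M^4 / 3 * (f x)\<^sup>2 - (f x)^6 / 3" if "x \<ge> R" for x
    proof -
      have "(F (f x))\<^sup>2 = (f x)\<^sup>2 * (M^4 - (f x)^4) / 3" unfolding F_def using rng[OF that] by (intro soliton_slope_sq) auto
      moreover have "(f x)\<^sup>2 * (f x)^4 = (f x)^6" unfolding power_add[symmetric] by simp
      ultimately show ?thesis by (simp add: field_simps)
    qed
    have qi': "set_integrable lborel {R..} (\<lambda>x. (g x)\<^sup>2 + (M^4 / 3 * (f x)\<^sup>2 - (f x)^6 / 3))"
      using g2 f2 i6 by (intro set_integral_add(1) set_integral_diff(1)) auto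
    have qi: "set_integrable lborel {R..} q"
      using qi' unfolding q_def by (rule set_integrable_cong[THEN iffD1, rotated -1]) (auto simp: Fsq)
    have qint: "(LINT x:{R..}|lborel. q x) = (LINT x:{R..}|lborel. (g x)\<^sup>2) + (M^4 / 3 * (LINT x:{R..}|lborel. (f x)\<^sup>2) - (LINT x:{R..}|lborel. (f x)^6) / 3)"
    proof -
      have "(LINT x:{R..}|lborel. q x) = (LINT x:{R..}|lborel. (g x)\<^sup>2 + (M^4 / 3 * (f x)\<^sup>2 - (f x)^6 / 3))"
        unfolding q_def by (rule set_lebesgue_integral_cong) (auto simp: Fsq)
      then show ?thesis using g2 f2 i6 by simp
    qed
    have Fc: "continuous_on {0..M} F" unfolding F_def by (rule continuous_on_soliton_slope)
    have seg: "2 * \<bar>Prim F (f y) - Prim F (f x)\<bar> \<le> (LINT t:{x..y}|lborel. q t)" if xy: "R \<le> x" "x \<le> y" for x y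
      unfolding q_def
    proof (rule calibration_le[OF xy(2) _ _ _ _ Fc])
      have sub: "{x..y} \<subseteq> {R..}" using xy by auto
      show "AC_on {x..y} f g" using ac sub by (rule AC_on_subset)
      show "continuous_on {x..y} f" using fc sub by (rule continuous_on_subset)
      show "set_integrable lborel {x..y} (\<lambda>t. (g t)\<^sup>2)" using g2 by (rule set_integrable_subset) (use sub in auto)
      show "f ` {x..y} \<subseteq> {0..M}" using rng xy by force
    qed (rule Prim_mvt[OF Fc])
    define P where "P = Prim F"
    \<comment> \<open>The value 0 is approached only at infinity, so the descent stops at a level
      \<open>a\<close> whose primitive costs at most \<open>\<eta>\<close>.\<close>
    have main: "4 * P M - 2 * P (f R) \<le> (LINT x:{R..}|lborel. q x) + \<eta>" if eta: "\<eta> > 0" for \<eta>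
    proof -
      define a where "a = min M (sqrt (\<eta> * (sqrt 3 / M\<^sup>2)))"
      have pos: "0 < \<eta> * (sqrt 3 / M\<^sup>2)" using eta M0 by simp
      have a: "0 < a" "a \<le> M" unfolding a_def using M0 pos by auto
      have "eventually (\<lambda>y. f y < a \<and> x0 \<le> y) at_top"
        using order_tendstoD(2)[OF lim a(1)] eventually_ge_at_top[of x0] by (rule eventually_conj)
      then obtain y where y: "f y < a" "x0 \<le> y" using eventually_happens'[OF trivial_limit_at_top_linorder] by blast
      have yR: "R \<le> y" using y x0 by simp
      have Py: "P (f y) \<le> P a" unfolding P_def
        by (rule Prim_mono[OF Fc]) (use rng[OF yR] y a soliton_slope_nonneg in \<open>auto simp: F_def\<close>)
      have "P a \<le> a\<^sup>2 * M\<^sup>2 / (2 * sqrt 3)" unfolding P_def F_def using a by (intro Prim_soliton_le) auto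
      moreover have "a\<^sup>2 * M\<^sup>2 / sqrt 3 \<le> \<eta>"
      proof -
        have "a\<^sup>2 \<le> (sqrt (\<eta> * (sqrt 3 / M\<^sup>2)))\<^sup>2" using a by (intro power_mono) (auto simp: a_def)
        then have "a\<^sup>2 \<le> \<eta> * (sqrt 3 / M\<^sup>2)" using pos by simp
        then have "a\<^sup>2 * (M\<^sup>2 / sqrt 3) \<le> \<eta> * (sqrt 3 / M\<^sup>2) * (M\<^sup>2 / sqrt 3)" by (intro mult_right_mono) auto
        also have "\<dots> = \<eta>" using M0 by simp
        finally show ?thesis by simp
      qed
      ultimately have Pa: "2 * P a \<le> \<eta>" by simp
      have 1: "2 * P M - 2 * P (f y) \<le> (LINT t:{x0..y}|lborel. q t)"
        using order_trans[OF mult_left_mono[OF abs_ge_minus_self] seg[OF x0(1) y(2), folded P_def]] unfolding M_def by simp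
      have 2: "2 * P M - 2 * P (f R) \<le> (LINT t:{R..x0}|lborel. q t)"
        using order_trans[OF mult_left_mono[OF abs_ge_self] seg[OF order.refl x0(1), folded P_def]] unfolding M_def by simp
      have "(LINT t:{R..x0}|lborel. q t) + (LINT t:{x0..y}|lborel. q t) \<le> (LINT t:{R..}|lborel. q t)"
        by (rule set_integral_split2[OF qi, where p = x0]) (use x0 y in \<open>auto simp: q_def\<close>)
      then show ?thesis using 1 2 Pa Py by linarith
    qed
    have "4 * P M - 2 * P (f R) \<le> (LINT x:{R..}|lborel. q x)" by (rule field_le_epsilon[OF main])
    moreover have "4 * P M = M^4 / 3 * mu_R" unfolding P_def F_def by (rule Prim_soliton_peak_mu_R[OF M0])
    moreover have "M^4 / 3 * (LINT x:{R..}|lborel. (f x)\<^sup>2) \<le> M^4 / 3 * mu_R" using mass M0 by (intro mult_left_mono) auto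
    moreover have "2 * P (f R) \<le> (f R)\<^sup>2 * M\<^sup>2 / sqrt 3"
      using mult_left_mono[OF Prim_soliton_le[of "f R" M], of 2] nn[of R] unfolding P_def F_def by simp
    ultimately show ?thesis using qint rhs0 by linarith
  qed
qed

section \<open>Soliton test functions\<close>

lemma set_integral_FTC_atLeast:
  fixes f :: "real \<Rightarrow> real"
  assumes c: "continuous_on UNIV f" and d: "\<And>x. (F has_real_derivative f x) (at x)" and nn: "\<And>x. 0 \<le> f x"
    and lim: "(F \<longlongrightarrow> T) at_top"
  shows "set_integrable lborel {a..} f" "(LINT x:{a..}|lborel. f x) = T - F a"
proof -
  have m: "f \<in> borel_measurable borel" using c by (rule borel_measurable_continuous_onI)
  have nni: "(\<integral>\<^sup>+x. ennreal (f x) * indicator {a..} x \<partial>lborel) = ennreal (T - F a)"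
    using nn_integral_FTC_atLeast[OF m d nn lim] by simp
  have mono: "F a \<le> F x" if "a \<le> x" for x
    using that by (intro DERIV_nonneg_imp_nondecreasing[of a x F]) (use d nn in blast)+
  have TF: "0 \<le> T - F a"
    using tendsto_lowerbound[OF lim, of "F a"] mono by (auto simp: eventually_at_top_linorder)
  have "has_bochner_integral lborel (\<lambda>x. indicator {a..} x *\<^sub>R f x) (T - F a)"
  proof (rule has_bochner_integral_nn_integral)
    show "(\<integral>\<^sup>+x. ennreal (indicator {a..} x *\<^sub>R f x) \<partial>lborel) = ennreal (T - F a)"
      unfolding nni[symmetric] by (intro nn_integral_cong) (auto split: split_indicator)
  qed (use m nn TF in \<open>auto split: split_indicator\<close>)
  then show "set_integrable lborel {a..} f" "(LINT x:{a..}|lborel. f x) = T - F a"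
    unfolding set_integrable_def set_lebesgue_integral_def has_bochner_integral_iff by auto
qed

context one_halfline_graph
begin

text \<open>A soliton profile with its peak at \<open>x0\<close> on the halfline, continued to the
  bounded edges by its value at the vertex. Amplitude \<open>A\<close> and scale \<open>b\<close>
  are independent, so that the mass can be prescribed; a true soliton would have
  \<open>A^4 = 3 / 4 * b^2\<close>.\<close>

definition test_fun :: "real \<Rightarrow> real \<Rightarrow> real \<Rightarrow> 'e \<Rightarrow> real \<Rightarrow> real" where
  "test_fun A b x0 e x = (if e = h then A / sqrt (cosh (b * (x - x0))) else A / sqrt (cosh (b * x0)))"

definition test_deriv :: "real \<Rightarrow> real \<Rightarrow> real \<Rightarrow> 'e \<Rightarrow> real \<Rightarrow> real" where
  "test_deriv A b x0 e x = (if e = h then - (A * b / 2) * sinh (b * (x - x0)) / (cosh (b * (x - x0)) * sqrt (cosh (b * (x - x0)))) else 0)"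

definition core_length :: real where "core_length = (\<Sum>e\<in>Es G - {h}. len G e)"

lemma core_length_nonneg: "0 \<le> core_length"
  unfolding core_length_def by (intro sum_nonneg) (auto intro: less_imp_le len_pos)

lemma sum_Es: "(\<Sum>e\<in>Es G. f e) = f h + (\<Sum>e\<in>Es G - {h}. f e)"
  using sum.remove[OF finite_Es h_in_Es] .

text \<open>All three integrands are combinations of the derivatives of
  \<open>arctan (sinh y)\<close> and \<open>sinh y / (cosh y)^2\<close>; \<open>\<theta>\<close> and
  \<open>\<tau>\<close> are minus their values at the vertex. The last claim is an inequality
  because the sextic integral over the bounded edges is dropped.\<close>

lemma test_fun_props:
  assumes b: "b > 0" and x0: "x0 \<ge> 0"
  defines "\<theta> \<equiv> arctan (sinh (b * x0))" and "\<tau> \<equiv> sinh (b * x0) / (cosh (b * x0))\<^sup>2"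
  shows "in_H1 G (test_fun A b x0) (test_deriv A b x0)"
    and "mass G (test_fun A b x0) = A\<^sup>2 * ((pi / 2 + \<theta>) / b + core_length / cosh (b * x0))"
    and "Lp_pow G 2 (test_deriv A b x0) = A\<^sup>2 * b / 8 * (pi / 2 + \<theta> - \<tau>)"
    and "A^6 / (2 * b) * (pi / 2 + \<theta> + \<tau>) \<le> Lp_pow G 6 (test_fun A b x0)"
proof -
  define y where "y = (\<lambda>x. b * (x - x0))"
  define f where "f = (\<lambda>x. A / sqrt (cosh (y x)))"
  define g where "g = (\<lambda>x. - (A * b / 2) * sinh (y x) / (cosh (y x) * sqrt (cosh (y x))))"
  have tf: "test_fun A b x0 h = f" "test_deriv A b x0 h = g" unfolding test_fun_def test_deriv_def f_def g_def y_def by auto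
  have tc: "test_fun A b x0 e = (\<lambda>_. A / sqrt (cosh (b * x0)))" "test_deriv A b x0 e = (\<lambda>_. 0)" if "e \<noteq> h" for e
    using that unfolding test_fun_def test_deriv_def by auto
  have cp: "cosh t > 0" "sqrt (cosh t) > 0" "cosh t \<noteq> 0" for t :: real by (simp_all add: cosh_real_pos less_imp_neq[symmetric])
  have ncp: "\<not> cosh t < 0" for t :: real using cp(1)[of t] by linarith
  have dy: "(y has_real_derivative b) (at x)" for x unfolding y_def by (auto intro!: derivative_eq_intros)
  have cy: "continuous_on S y" for S unfolding y_def by (intro continuous_intros)
  have cs: "(cosh t)\<^sup>2 = 1 + (sinh t)\<^sup>2" for t :: real using cosh_square_eq[of t] by simp
  have dat: "((\<lambda>t::real. arctan (sinh t)) has_real_derivative 1 / cosh t) (at t)" for t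
  proof -
    have "((\<lambda>t::real. arctan (sinh t)) has_real_derivative inverse (1 + (sinh t)\<^sup>2) * cosh t) (at t)"
      by (auto intro!: derivative_eq_intros)
    then show ?thesis unfolding cs[symmetric] using cp[of t] by (simp add: power2_eq_square field_simps)
  qed
  have dq: "((\<lambda>t::real. sinh t / (cosh t)\<^sup>2) has_real_derivative (1 / cosh t - 2 * (sinh t)\<^sup>2 / cosh t ^ 3)) (at t)" for t
  proof -
    have "((\<lambda>t::real. sinh t / (cosh t)\<^sup>2) has_real_derivative (cosh t * (cosh t)\<^sup>2 - sinh t * (2 * cosh t * sinh t)) / ((cosh t)\<^sup>2 * (cosh t)\<^sup>2)) (at t)"
      using cp(3)[of t] by (auto intro!: derivative_eq_intros)
    moreover have "(cosh t * (cosh t)\<^sup>2 - sinh t * (2 * cosh t * sinh t)) / ((cosh t)\<^sup>2 * (cosh t)\<^sup>2) = 1 / cosh t - 2 * (sinh t)\<^sup>2 / cosh t ^ 3"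
      using cp(3)[of t] by (simp add: field_simps power2_eq_square power3_eq_cube)
    ultimately show ?thesis by simp
  qed
  have ylim: "filterlim y at_top at_top" unfolding y_def
    using b by real_asymp
  have lat: "((\<lambda>x. arctan (sinh (y x))) \<longlongrightarrow> pi / 2) at_top"
    by (rule filterlim_compose[OF _ ylim]) real_asymp
  have lq: "((\<lambda>x. sinh (y x) / (cosh (y x))\<^sup>2) \<longlongrightarrow> 0) at_top"
    by (rule filterlim_compose[OF _ ylim]) real_asymp
  have y0: "y 0 = - (b * x0)" unfolding y_def by simp
  have at0: "arctan (sinh (y 0)) = - \<theta>" unfolding y0 \<theta>_def by (simp add: arctan_minus)
  have q0: "sinh (y 0) / (cosh (y 0))\<^sup>2 = - \<tau>" unfolding y0 \<tau>_def by simp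
  have f2: "(f x)\<^sup>2 = A\<^sup>2 * (1 / cosh (y x))" for x unfolding f_def using cp[of "y x"] by (simp add: power_divide)
  have f6: "(f x)^6 = A^6 * (1 / cosh (y x) ^ 3)" for x
  proof -
    have "(f x)^6 = A^6 / ((sqrt (cosh (y x)))\<^sup>2)^3" unfolding f_def power_divide power_mult[symmetric] by simp
    then show ?thesis using cp(1)[of "y x"] by simp
  qed
  have g2: "(g x)\<^sup>2 = A\<^sup>2 * b\<^sup>2 / 4 * ((sinh (y x))\<^sup>2 / cosh (y x) ^ 3)" for x
  proof -
    have "(g x)\<^sup>2 = (A * b / 2)\<^sup>2 * (sinh (y x))\<^sup>2 / ((cosh (y x))\<^sup>2 * (sqrt (cosh (y x)))\<^sup>2)"
      by (simp add: g_def power_divide power_mult_distrib)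
    moreover have "(A * b / 2)\<^sup>2 = A\<^sup>2 * b\<^sup>2 / 4" by (simp add: power_mult_distrib power_divide)
    moreover have "(cosh (y x))\<^sup>2 * (sqrt (cosh (y x)))\<^sup>2 = cosh (y x) ^ 3"
      using cp(1)[of "y x"] by (simp add: power2_eq_square power3_eq_cube)
    ultimately show ?thesis by simp
  qed
  have c: "continuous_on UNIV (\<lambda>x. (f x)\<^sup>2)" "continuous_on UNIV (\<lambda>x. (f x)^6)" "continuous_on UNIV (\<lambda>x. (g x)\<^sup>2)"
    unfolding f2 f6 g2 by (intro continuous_intros cy; use cp in simp)+
  have D1: "((\<lambda>x. A\<^sup>2 / b * arctan (sinh (y x))) has_real_derivative (f x)\<^sup>2) (at x)" for x
  proof -
    have "((\<lambda>x. A\<^sup>2 / b * arctan (sinh (y x))) has_real_derivative A\<^sup>2 / b * (1 / cosh (y x) * b)) (at x)"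
      by (intro DERIV_cmult DERIV_chain2[OF dat dy])
    then show ?thesis unfolding f2 using b by simp
  qed
  have L1: "((\<lambda>x. A\<^sup>2 / b * arctan (sinh (y x))) \<longlongrightarrow> A\<^sup>2 / b * (pi / 2)) at_top"
    by (intro tendsto_intros lat)
  have I1: "set_integrable lborel {0..} (\<lambda>x. (f x)\<^sup>2)" "(LINT x:{0..}|lborel. (f x)\<^sup>2) = A\<^sup>2 / b * (pi / 2) - A\<^sup>2 / b * arctan (sinh (y 0))"
    using set_integral_FTC_atLeast[OF c(1) D1 _ L1, of 0] by auto
  have D2: "((\<lambda>x. A\<^sup>2 * b / 8 * (arctan (sinh (y x)) - sinh (y x) / (cosh (y x))\<^sup>2)) has_real_derivative (g x)\<^sup>2) (at x)" for x
  proof -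
    have "((\<lambda>x. A\<^sup>2 * b / 8 * (arctan (sinh (y x)) - sinh (y x) / (cosh (y x))\<^sup>2)) has_real_derivative
        A\<^sup>2 * b / 8 * (1 / cosh (y x) * b - (1 / cosh (y x) - 2 * (sinh (y x))\<^sup>2 / cosh (y x) ^ 3) * b)) (at x)"
      by (intro DERIV_cmult DERIV_diff DERIV_chain2[OF dat dy] DERIV_chain2[OF dq dy])
    moreover have "A\<^sup>2 * b / 8 * (1 / cosh (y x) * b - (1 / cosh (y x) - 2 * (sinh (y x))\<^sup>2 / cosh (y x) ^ 3) * b) = (g x)\<^sup>2"
      unfolding g2 by (simp add: field_simps power2_eq_square)
    ultimately show ?thesis by simp
  qed
  have L2: "((\<lambda>x. A\<^sup>2 * b / 8 * (arctan (sinh (y x)) - sinh (y x) / (cosh (y x))\<^sup>2)) \<longlongrightarrow> A\<^sup>2 * b / 8 * (pi / 2 - 0)) at_top"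
    by (intro tendsto_intros lat lq)
  have I2: "set_integrable lborel {0..} (\<lambda>x. (g x)\<^sup>2)"
     "(LINT x:{0..}|lborel. (g x)\<^sup>2) = A\<^sup>2 * b / 8 * (pi / 2 - 0) - A\<^sup>2 * b / 8 * (arctan (sinh (y 0)) - sinh (y 0) / (cosh (y 0))\<^sup>2)"
    using set_integral_FTC_atLeast[OF c(3) D2 _ L2, of 0] by auto
  have D6: "((\<lambda>x. A^6 / (2 * b) * (arctan (sinh (y x)) + sinh (y x) / (cosh (y x))\<^sup>2)) has_real_derivative (f x)^6) (at x)" for x
  proof -
    have "((\<lambda>x. A^6 / (2 * b) * (arctan (sinh (y x)) + sinh (y x) / (cosh (y x))\<^sup>2)) has_real_derivative
        A^6 / (2 * b) * (1 / cosh (y x) * b + (1 / cosh (y x) - 2 * (sinh (y x))\<^sup>2 / cosh (y x) ^ 3) * b)) (at x)"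
      by (intro DERIV_cmult DERIV_add DERIV_chain2[OF dat dy] DERIV_chain2[OF dq dy])
    moreover have "A^6 / (2 * b) * (1 / cosh (y x) * b + (1 / cosh (y x) - 2 * (sinh (y x))\<^sup>2 / cosh (y x) ^ 3) * b) = (f x)^6"
    proof -
      have "(sinh (y x))\<^sup>2 = (cosh (y x))\<^sup>2 - 1" using cs[of "y x"] by simp
      then have "1 / cosh (y x) + (1 / cosh (y x) - 2 * (sinh (y x))\<^sup>2 / cosh (y x) ^ 3) = 2 / cosh (y x) ^ 3"
        using cp(3)[of "y x"] by (simp add: field_simps power2_eq_square power3_eq_cube)
      moreover have "A^6 / (2 * b) * (1 / cosh (y x) * b + (1 / cosh (y x) - 2 * (sinh (y x))\<^sup>2 / cosh (y x) ^ 3) * b)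
         = A^6 / 2 * (1 / cosh (y x) + (1 / cosh (y x) - 2 * (sinh (y x))\<^sup>2 / cosh (y x) ^ 3))"
        using b by (simp add: field_simps)
      ultimately show ?thesis unfolding f6 by simp
    qed
    ultimately show ?thesis by simp
  qed
  have L6: "((\<lambda>x. A^6 / (2 * b) * (arctan (sinh (y x)) + sinh (y x) / (cosh (y x))\<^sup>2)) \<longlongrightarrow> A^6 / (2 * b) * (pi / 2 + 0)) at_top"
    by (intro tendsto_intros lat lq)
  have I6: "set_integrable lborel {0..} (\<lambda>x. (f x)^6)"
     "(LINT x:{0..}|lborel. (f x)^6) = A^6 / (2 * b) * (pi / 2 + 0) - A^6 / (2 * b) * (arctan (sinh (y 0)) + sinh (y 0) / (cosh (y 0))\<^sup>2)"
    using set_integral_FTC_atLeast[OF c(2) D6 _ L6, of 0] by (auto simp: zero_le_even_power)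
  have gc: "continuous_on S g" for S unfolding g_def by (intro continuous_intros cy) (use cp in auto)
  have df: "(f has_real_derivative g x) (at x)" for x
  proof -
    have "((\<lambda>t. A / sqrt (cosh t)) has_real_derivative - (A / 2) * sinh t / (cosh t * sqrt (cosh t))) (at t)" for t
    proof -
      have "((\<lambda>t. A / sqrt (cosh t)) has_real_derivative (0 * sqrt (cosh t) - A * (sinh t * (inverse (sqrt (cosh t)) / 2))) / (sqrt (cosh t) * sqrt (cosh t))) (at t)"
        using cp[of t] ncp[of t] by (auto intro!: derivative_eq_intros simp: ncp)
      then show ?thesis using cp[of t] by (simp add: field_simps)
    qed
    from DERIV_chain2[OF this dy] have "(f has_real_derivative - (A / 2) * sinh (y x) / (cosh (y x) * sqrt (cosh (y x))) * b) (at x)"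
      unfolding f_def .
    then show ?thesis unfolding g_def by (simp add: mult.assoc mult.commute[of b] mult.left_commute[of b])
  qed
  have acf: "AC_on {0..} f g" unfolding AC_on_def
  proof (intro ballI impI)
    fix s t assume st: "s \<in> {0::real..}" "t \<in> {0..}" "s \<le> t"
    have "has_bochner_integral lborel (\<lambda>x. g x * indicator {s..t} x) (f t - f s)"
      by (rule has_bochner_integral_FTC_Icc_real[OF st(3)]) (use df gc[of UNIV] in \<open>auto simp: continuous_on_eq_continuous_at\<close>)
    then show "set_integrable lborel {s..t} g \<and> f t - f s = (LINT x:{s..t}|lborel. g x)"
      unfolding set_integrable_def set_lebesgue_integral_def has_bochner_integral_iff by (simp add: mult.commute)
  qed
  define v where "v = A / sqrt (cosh (b * x0))"
  have f0: "f 0 = v" unfolding f_def y0 v_def by simp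
  have H1c: "H1_on (edom G e) (\<lambda>_. v) (\<lambda>_. 0)" if "e \<in> Es G" "e \<noteq> h" for e
    unfolding H1_on_def edom_bounded[OF that(2)] using len_pos[OF that] set_integral_Icc_const(1)[of 0 "len G e"]
    by (auto simp: set_integrable_def)
  show "in_H1 G (test_fun A b x0) (test_deriv A b x0)"
    unfolding in_H1_def
  proof (intro conjI ballI exI[of _ "\<lambda>_. v"])
    fix e assume e: "e \<in> Es G"
    show "H1_on (edom G e) (test_fun A b x0 e) (test_deriv A b x0 e)"
    proof (cases "e = h")
      case True then show ?thesis unfolding True tf edom_h H1_on_iff using I1 I2 acf by simp
    next
      case False then show ?thesis using H1c[OF e False] tc[OF False] unfolding v_def by simp
    qed
    show "test_fun A b x0 e 0 = v"
      using f0 tf tc[of e] by (cases "e = h") (auto simp: v_def)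
  next
    fix e assume "e \<in> Es G - HL G"
    then show "test_fun A b x0 e (len G e) = v" using HL_eq tc[of e] by (auto simp: v_def)
  qed
  have cint: "(\<Sum>e\<in>Es G - {h}. LINT x:edom G e|lborel. (test_fun A b x0 e x)^n) = v^n * core_length" for n
  proof -
    have "(LINT x:edom G e|lborel. (test_fun A b x0 e x)^n) = v^n * len G e" if e: "e \<in> Es G - {h}" for e
      using e len_pos[of e] edom_bounded[of e] tc[of e] set_integral_Icc_const(2)[of 0 "len G e" "v^n"]
      by (simp add: v_def mult.commute)
    then show ?thesis unfolding core_length_def sum_distrib_left by (intro sum.cong) auto
  qed
  have v2: "v\<^sup>2 = A\<^sup>2 / cosh (b * x0)" unfolding v_def using cp[of "b * x0"] by (simp add: power_divide)
  show "mass G (test_fun A b x0) = A\<^sup>2 * ((pi / 2 + \<theta>) / b + core_length / cosh (b * x0))"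
    unfolding mass_eq sum_Es cint tf edom_h I1(2) at0 v2 using b by (simp add: field_simps)
  have cd: "(\<Sum>e\<in>Es G - {h}. LINT x:edom G e|lborel. (test_deriv A b x0 e x)\<^sup>2) = 0"
    by (intro sum.neutral ballI) (simp add: tc)
  show "Lp_pow G 2 (test_deriv A b x0) = A\<^sup>2 * b / 8 * (pi / 2 + \<theta> - \<tau>)"
    unfolding Lp_pow_even[OF even_numeral] sum_Es cd tf edom_h I2(2) at0 q0 by (simp add: field_simps)
  have "0 \<le> v^6 * core_length" using core_length_nonneg by (simp add: zero_le_even_power)
  moreover have "Lp_pow G 6 (test_fun A b x0) = A^6 / (2 * b) * (pi / 2 + \<theta> + \<tau>) + v^6 * core_length"
    unfolding Lp_pow_even[OF even_numeral] sum_Es cint tf edom_h I6(2) at0 q0 using b by (simp add: field_simps)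
  ultimately show "A^6 / (2 * b) * (pi / 2 + \<theta> + \<tau>) \<le> Lp_pow G 6 (test_fun A b x0)" by simp
qed

text \<open>With the peak at the vertex, half a soliton sits on the halfline. For small
  \<open>b\<close> it is so wide that the bounded edges take little of the mass, and the upper bound
  on the energy has the sign of \<open>3 / 4 * b^2 - A^4\<close>.\<close>

lemma ex_negative_energy:
  assumes "mu_Rplus < \<mu>"
  shows "\<exists>u u'. in_H1 G u u' \<and> mass G u = \<mu> \<and> energy G u u' < 0"
proof -
  define L where "L = core_length"
  have L: "0 \<le> L" unfolding L_def by (rule core_length_nonneg)
  have mu: "0 < \<mu>" using assms unfolding mu_Rplus_def using pi_gt_zero by (smt (verit) divide_pos_pos mult_pos_pos real_sqrt_gt_zero)
  \<comment> \<open>Here \<open>sqrt 3 / 2 * b * m = mu_Rplus + sqrt 3 / 2 * b * L\<close>, and this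
    \<open>b\<close> keeps the last term at most half of \<open>\<mu> - mu_Rplus\<close>.\<close>
  define b where "b = (\<mu> - mu_Rplus) / (sqrt 3 * (L + 1))"
  have b: "b > 0" unfolding b_def using assms L by simp
  define m where "m = pi / 2 / b + L"
  have m: "m > 0" unfolding m_def using b L by (intro add_pos_nonneg) auto
  define A where "A = sqrt (\<mu> / m)"
  have A2: "A\<^sup>2 = \<mu> / m" unfolding A_def using mu m by simp
  have A0: "A\<^sup>2 > 0" unfolding A2 using mu m by simp
  note t = test_fun_props[OF b order.refl, of A]
  have mass: "mass G (test_fun A b 0) = \<mu>" using t(2) A2 m unfolding m_def L_def by simp
  have key: "sqrt 3 / 2 * b < A\<^sup>2"
  proof -
    have "sqrt 3 / 2 * b * m = mu_Rplus + sqrt 3 / 2 * b * L" unfolding m_def mu_Rplus_def using b by (simp add: field_simps)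
    also have "sqrt 3 / 2 * b * L = (\<mu> - mu_Rplus) / 2 * (L / (L + 1))"
    proof -
      have "sqrt 3 * b = (\<mu> - mu_Rplus) / (L + 1)" unfolding b_def by simp
      moreover have "sqrt 3 / 2 * b * L = (sqrt 3 * b) * L / 2" by simp
      ultimately show ?thesis by simp
    qed
    also have "\<dots> \<le> (\<mu> - mu_Rplus) / 2 * 1" using assms L by (intro mult_left_mono) auto
    finally have "sqrt 3 / 2 * b * m \<le> mu_Rplus + (\<mu> - mu_Rplus) / 2 * 1" by simp
    moreover have "(\<mu> - mu_Rplus) / 2 * 1 < \<mu> - mu_Rplus" using assms by simp
    ultimately have "sqrt 3 / 2 * b * m < \<mu>" by linarith
    then show ?thesis unfolding A2 using m by (simp add: less_divide_eq)
  qed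
  have "(sqrt 3 / 2 * b)\<^sup>2 < (A\<^sup>2)\<^sup>2" using key b by (intro power_strict_mono) auto
  then have key2: "3 / 4 * b\<^sup>2 < A^4" by (simp add: power_mult_distrib power_divide)
  have "energy G (test_fun A b 0) (test_deriv A b 0) \<le> A\<^sup>2 * b / 8 * (pi / 2) / 2 - A^6 / (2 * b) * (pi / 2) / 6"
    using t(3,4) unfolding energy_def by simp
  also have "\<dots> = A\<^sup>2 * pi / (24 * b) * (3 / 4 * b\<^sup>2 - A^4)"
    using b by (simp add: field_simps power2_eq_square power4_eq_xxxx eval_nat_numeral)
  also have "\<dots> < 0" using key2 b A0 by (intro mult_pos_neg) auto
  finally show ?thesis using t(1) mass by blast
qed

text \<open>Spreading the profile makes its kinetic part at most \<open>\<mu> * b^2 / 16\<close>.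
  Together with positivity of the energy this excludes ground states for small masses.\<close>

lemma ex_small_energy:
  assumes mu: "0 < \<mu>" and eps: "0 < \<epsilon>"
  shows "\<exists>u u'. in_H1 G u u' \<and> mass G u = \<mu> \<and> energy G u u' < \<epsilon>"
proof -
  define L where "L = core_length"
  have L: "0 \<le> L" unfolding L_def by (rule core_length_nonneg)
  define b where "b = sqrt (\<epsilon> / \<mu>)"
  have b: "b > 0" and b2: "b\<^sup>2 = \<epsilon> / \<mu>" unfolding b_def using assms by auto
  define m where "m = pi / 2 / b + L"
  have m: "m > 0" unfolding m_def using b L by (intro add_pos_nonneg) auto
  define A where "A = sqrt (\<mu> / m)"
  have A2: "A\<^sup>2 = \<mu> / m" unfolding A_def using mu m by simp
  note t = test_fun_props[OF b order.refl, of A]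
  have mass: "mass G (test_fun A b 0) = \<mu>" using t(2) A2 m unfolding m_def L_def by simp
  have "A\<^sup>2 \<le> \<mu> / (pi / 2 / b)" unfolding A2 m_def using mu b L by (intro divide_left_mono mult_pos_pos add_pos_nonneg) auto
  then have A2': "A\<^sup>2 * pi \<le> 2 * \<mu> * b" using b by (simp add: field_simps)
  have "energy G (test_fun A b 0) (test_deriv A b 0) \<le> A\<^sup>2 * b / 8 * (pi / 2) / 2"
    using t(3) Lp_pow_even_nonneg[of 6 "test_fun A b 0"] unfolding energy_def by simp
  also have "\<dots> = b / 32 * (A\<^sup>2 * pi)" by simp
  also have "\<dots> \<le> b / 32 * (2 * \<mu> * b)" using A2' b by (intro mult_left_mono) auto
  also have "\<dots> = \<epsilon> / 16" using b2 mu by (simp add: field_simps power2_eq_square)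
  also have "\<dots> < \<epsilon>" using eps by simp
  finally show ?thesis using t(1) mass by blast
qed

text \<open>The peak is placed inside the halfline, so a sharply concentrated profile sees the line
  rather than the halfline. The share of the bounded edges decays exponentially, and the energy
  tends to minus infinity like \<open>- b^2\<close>.\<close>

lemma ex_energy_below:
  assumes "mu_R < \<mu>"
  shows "\<exists>u u'. in_H1 G u u' \<and> mass G u = \<mu> \<and> energy G u u' < K"
proof -
  define L where "L = core_length"
  have L: "0 \<le> L" unfolding L_def by (rule core_length_nonneg)
  have mR: "0 < mu_R" unfolding mu_R_def by simp
  then have mu: "0 < \<mu>" using assms by simp
  define th where "th = (\<lambda>b::real. pi / 2 + arctan (sinh b))"
  \<comment> \<open>\<open>w b / b\<close> is the mass at amplitude 1, and \<open>br b\<close> is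
    the upper bound on the energy in units of \<open>\<mu> * b^2 / w b\<close>.\<close>
  define w where "w = (\<lambda>b::real. th b + L * (b / cosh b))"
  define br where "br = (\<lambda>b. pi / 16 - (\<mu> / w b)\<^sup>2 * th b / 12)"
  have "((\<lambda>b::real. arctan (sinh b)) \<longlongrightarrow> pi / 2) at_top" by real_asymp
  then have "(th \<longlongrightarrow> pi / 2 + pi / 2) at_top" unfolding th_def by (intro tendsto_intros)
  then have thl: "(th \<longlongrightarrow> pi) at_top" by simp
  have "((\<lambda>b::real. b / cosh b) \<longlongrightarrow> 0) at_top" by real_asymp
  then have "(w \<longlongrightarrow> pi + L * 0) at_top" unfolding w_def by (intro tendsto_intros thl)
  then have wl: "(w \<longlongrightarrow> pi) at_top" by simp
  \<comment> \<open>Minus the limit of \<open>br\<close>; it is positive exactly when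
    \<open>\<mu>^2\<close> exceeds \<open>mu_R^2 = 3 * pi^2 / 4\<close>.\<close>
  define \<delta> where "\<delta> = \<mu>\<^sup>2 / (12 * pi) - pi / 16"
  have "(br \<longlongrightarrow> pi / 16 - (\<mu> / pi)\<^sup>2 * pi / 12) at_top" unfolding br_def by (intro tendsto_intros wl thl) auto
  moreover have "pi / 16 - (\<mu> / pi)\<^sup>2 * pi / 12 = - \<delta>" unfolding \<delta>_def by (simp add: field_simps power2_eq_square)
  ultimately have bl: "(br \<longlongrightarrow> - \<delta>) at_top" by simp
  have del: "\<delta> > 0"
  proof -
    have "mu_R\<^sup>2 < \<mu>\<^sup>2" using assms mR by (intro power_strict_mono) auto
    moreover have "mu_R\<^sup>2 = 3 * pi\<^sup>2 / 4" unfolding mu_R_def by (simp add: power_divide power_mult_distrib)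
    ultimately have "3 * pi\<^sup>2 / 4 / (12 * pi) < \<mu>\<^sup>2 / (12 * pi)" by (intro divide_strict_right_mono) auto
    then show ?thesis unfolding \<delta>_def by (simp add: power2_eq_square)
  qed
  have e1: "eventually (\<lambda>b. br b < - \<delta> / 2) at_top" using del by (intro order_tendstoD(2)[OF bl]) simp
  have e2: "eventually (\<lambda>b. w b < 4) at_top" using pi_less_4 by (intro order_tendstoD(2)[OF wl])
  have "filterlim (\<lambda>b::real. \<mu> * b\<^sup>2 / 4 * (- \<delta> / 2)) at_bot at_top" using mu del by real_asymp
  then have e3: "eventually (\<lambda>b::real. \<mu> * b\<^sup>2 / 4 * (- \<delta> / 2) < K) at_top"
    by (simp add: filterlim_at_bot_dense)
  have "eventually (\<lambda>b::real. br b < - \<delta> / 2 \<and> w b < 4 \<and> \<mu> * b\<^sup>2 / 4 * (- \<delta> / 2) < K \<and> b > 0) at_top"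
    using e1 e2 e3 eventually_gt_at_top[of "0::real"] by eventually_elim auto
  then obtain b where b: "br b < - \<delta> / 2" "w b < 4" "\<mu> * b\<^sup>2 / 4 * (- \<delta> / 2) < K" "b > 0"
    using eventually_happens'[OF trivial_limit_at_top_linorder] by blast
  have th0: "0 < th b" "th b \<le> pi" unfolding th_def using arctan_lbound[of "sinh b"] arctan_ubound[of "sinh b"] by auto
  have w0: "0 < w b" unfolding w_def using th0 L b(4) cosh_real_pos[of b] by (intro add_pos_nonneg mult_nonneg_nonneg) auto
  define A where "A = sqrt (\<mu> * b / w b)"
  have A2: "A\<^sup>2 = \<mu> * b / w b" unfolding A_def using mu b(4) w0 by simp
  note t = test_fun_props[OF b(4) zero_le_one, of A]
  have mass: "mass G (test_fun A b 1) = \<mu>"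
  proof -
    have "mass G (test_fun A b 1) = A\<^sup>2 * (th b / b + L / cosh b)" using t(2) unfolding th_def L_def by simp
    also have "th b / b + L / cosh b = w b / b" unfolding w_def using b(4) by (simp add: field_simps)
    finally show ?thesis unfolding A2 using b(4) w0 by simp
  qed
  have tau: "0 \<le> sinh (b * 1) / (cosh (b * 1))\<^sup>2" using b(4) by simp
  have T: "Lp_pow G 2 (test_deriv A b 1) \<le> A\<^sup>2 * b / 8 * pi"
    unfolding t(3)
  proof (rule mult_left_mono)
    show "pi / 2 + arctan (sinh (b * 1)) - sinh (b * 1) / (cosh (b * 1))\<^sup>2 \<le> pi"
      using tau th0(2) unfolding th_def mult_1_right by linarith
  qed (use b(4) in simp)
  have S: "A^6 / (2 * b) * th b \<le> Lp_pow G 6 (test_fun A b 1)"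
  proof (rule order_trans[OF _ t(4)])
    have "0 \<le> A^6 / (2 * b)" using b(4) by (simp add: zero_le_even_power)
    then show "A^6 / (2 * b) * th b \<le> A^6 / (2 * b) * (pi / 2 + arctan (sinh (b * 1)) + sinh (b * 1) / (cosh (b * 1))\<^sup>2)"
      using tau unfolding th_def by (intro mult_left_mono) auto
  qed
  have "energy G (test_fun A b 1) (test_deriv A b 1) \<le> A\<^sup>2 * b / 8 * pi / 2 - A^6 / (2 * b) * th b / 6"
    using T S unfolding energy_def by simp
  also have "\<dots> = A\<^sup>2 * b * (pi / 16 - (A\<^sup>2 / b)\<^sup>2 * th b / 12)"
    using b(4) by (simp add: field_simps power2_eq_square eval_nat_numeral)
  also have "A\<^sup>2 / b = \<mu> / w b" unfolding A2 using b(4) by simp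
  also have "A\<^sup>2 * b * (pi / 16 - (\<mu> / w b)\<^sup>2 * th b / 12) = \<mu> * b\<^sup>2 / w b * br b"
    unfolding br_def A2 by (simp add: power2_eq_square)
  also have "\<dots> \<le> \<mu> * b\<^sup>2 / w b * (- \<delta> / 2)" using b mu w0 by (intro mult_left_mono) auto
  also have "\<dots> \<le> \<mu> * b\<^sup>2 / 4 * (- \<delta> / 2)"
    using b mu w0 del by (intro mult_right_mono_neg divide_left_mono mult_pos_pos) auto
  also have "\<dots> < K" by (rule b(3))
  finally show ?thesis using t(1) mass by blast
qed

end

section \<open>Critical mass and ground states\<close>

text \<open>If the bound failed infinitely often, Fatou along a subsequence of failures would be
  contradictory. The eventual form can be combined over finitely many edges.\<close>

lemma eventually_Fatou_real:
  fixes f :: "nat \<Rightarrow> 'a \<Rightarrow> real"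
  assumes int: "\<And>i. integrable M (f i)" and nn: "\<And>i x. 0 \<le> f i x" and Fm: "F \<in> borel_measurable M"
    and lim: "AE x in M. (\<lambda>i. f i x) \<longlonglongrightarrow> F x" and C: "\<And>i. integral\<^sup>L M (f i) \<le> C"
  shows "integrable M F" "\<And>\<epsilon>. \<epsilon> > 0 \<Longrightarrow> eventually (\<lambda>i. integral\<^sup>L M F - \<epsilon> \<le> integral\<^sup>L M (f i)) sequentially"
proof -
  show "integrable M F" by (rule Fatou_real(1)[OF int nn Fm lim, of C]) (use C in simp)
  fix \<epsilon> :: real assume eps: "\<epsilon> > 0"
  show "eventually (\<lambda>i. integral\<^sup>L M F - \<epsilon> \<le> integral\<^sup>L M (f i)) sequentially"
  proof (rule ccontr)
    assume "\<not> ?thesis"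
    then obtain r :: "nat \<Rightarrow> nat" where r: "strict_mono r" "\<forall>i. \<not> integral\<^sup>L M F - \<epsilon> \<le> integral\<^sup>L M (f (r i))"
      using not_eventually_sequentiallyD by blast
    have l: "AE x in M. (\<lambda>i. f (r i) x) \<longlonglongrightarrow> F x"
      using lim by eventually_elim (rule LIMSEQ_subseq_LIMSEQ[OF _ r(1), unfolded o_def])
    have "integral\<^sup>L M F \<le> integral\<^sup>L M F - \<epsilon>"
      by (rule Fatou_real(2)[of M "\<lambda>i. f (r i)", OF int nn Fm l]) (rule always_eventually, use r(2) in \<open>auto simp: not_le intro: less_imp_le\<close>)
    then show False using eps by simp
  qed
qed

text \<open>Freezing a function beyond \<open>R\<close> removes its derivative there. Lower
  semicontinuity on the whole halfline then applies with norms that see only \<open>{0..R}\<close>,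
  even when \<open>R\<close> varies along the sequence.\<close>

lemma AC_on_truncate:
  assumes ac: "AC_on {0..} f g" and R: "0 \<le> R"
  shows "AC_on {0..} (\<lambda>x. f (min x R)) (\<lambda>x. indicat_real {0..R} x * g x)"
  unfolding AC_on_def
proof (intro ballI impI)
  fix x y :: real assume xy: "x \<in> {0..}" "y \<in> {0..}" "x \<le> y"
  show "set_integrable lborel {x..y} (\<lambda>x. indicat_real {0..R} x * g x) \<and>
      f (min y R) - f (min x R) = (LINT t:{x..y}|lborel. indicat_real {0..R} t * g t)"
  proof (cases "x \<le> R")
    case True
    have i: "indicat_real {x..y} t *\<^sub>R (indicat_real {0..R} t * g t) = indicat_real {x..min y R} t *\<^sub>R g t" for t
      using xy by (auto split: split_indicator)
    show ?thesis using AC_onD[OF ac, of x "min y R"] xy True R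
      unfolding set_integrable_def set_lebesgue_integral_def i by (auto simp: min_def)
  next
    case False
    have i: "indicat_real {x..y} t *\<^sub>R (indicat_real {0..R} t * g t) = 0" for t
      using False by (auto split: split_indicator)
    show ?thesis using False xy unfolding set_integrable_def set_lebesgue_integral_def i by (auto simp: min_def)
  qed
qed

section \<open>Gagliardo-Nirenberg constant and critical mass\<close>

context one_halfline_graph
begin

lemma energy_scale:
  "energy G (\<lambda>e x. c * u e x) (\<lambda>e x. c * u' e x) = c\<^sup>2 * (Lp_pow G 2 u' / 2) - c^6 * (Lp_pow G 6 u / 6)"
  "mass G (\<lambda>e x. c * u e x) = c\<^sup>2 * mass G u"
  unfolding energy_def mass_def by (simp_all add: Lp_pow_scale power_even_abs)

lemma ex_nonneg_profile:
  assumes H: "in_H1 G u u'" and m: "0 < mass G u"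
  shows "\<exists>v v' M e0 x0. nonneg_profile G v v' M e0 x0 \<and> mass G v = mass G u \<and> energy G v v' \<le> energy G u u'"
proof -
  define v where "v = (\<lambda>e x. \<bar>u e x\<bar>)"
  define v' where "v' = (\<lambda>e x. sgn (u e x) * u' e x)"
  have Hv: "in_H1 G v v'" unfolding v_def v'_def by (rule in_H1_abs(1)[OF H])
  have mass: "mass G v = mass G u" unfolding mass_def v_def by (rule in_H1_abs(3)[OF H])
  have en: "energy G v v' \<le> energy G u u'"
    using in_H1_abs(2)[OF H] in_H1_abs(3)[OF H, of 6] unfolding energy_def v_def v'_def by simp
  obtain e0 x0 where e0: "e0 \<in> Es G" "x0 \<in> edom G e0" and mx: "\<And>e x. e \<in> Es G \<Longrightarrow> x \<in> edom G e \<Longrightarrow> v e x \<le> v e0 x0"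
    using ex_max[OF Hv] unfolding v_def by (metis abs_ge_zero)
  have "v e0 x0 > 0"
  proof (rule ccontr)
    assume "\<not> v e0 x0 > 0"
    then have z: "v e x = 0" if "e \<in> Es G" "x \<in> edom G e" for e x
      using mx[OF that] unfolding v_def by (smt (verit) abs_ge_zero)
    have "mass G v = (\<Sum>e\<in>Es G. LINT x:edom G e|lborel. 0)"
      unfolding mass_eq by (intro sum.cong refl set_lebesgue_integral_cong sets_edom) (use z in auto)
    then show False using mass m by simp
  qed
  then have "nonneg_profile G v v' (v e0 x0) e0 x0"
    by unfold_locales (use Hv e0 mx in \<open>auto simp: v_def\<close>)
  then show ?thesis using mass en by blast
qed

lemma critical_energy_pos:
  assumes H: "in_H1 G u u'" and m: "mass G u = mu_Rplus"
  shows "0 < energy G u u'"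
proof -
  have "0 < mass G u" unfolding m mu_Rplus_def by simp
  then obtain v v' M e0 x0 where v: "nonneg_profile G v v' M e0 x0" "mass G v = mass G u" "energy G v v' \<le> energy G u u'"
    using ex_nonneg_profile[OF H] by blast
  have "0 < energy G v v'" using nonneg_profile.energy_pos_of_critical_mass[OF v(1)] v(2) m by simp
  then show ?thesis using v(3) by simp
qed

lemma mu_Rplus_pos: "0 < mu_Rplus" unfolding mu_Rplus_def by simp

text \<open>The function is rescaled to mass \<open>mu_Rplus\<close>, where its energy is positive;
  the two parts of the energy scale with \<open>c^2\<close> and \<open>c^6\<close>.\<close>

lemma Gagliardo_Nirenberg_strict:
  assumes H: "in_H1 G u u'" and m: "0 < mass G u"
  shows "Lp_pow G 6 u < 3 / mu_Rplus\<^sup>2 * ((mass G u)\<^sup>2 * Lp_pow G 2 u')"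
proof -
  define c where "c = sqrt (mu_Rplus / mass G u)"
  have c2: "c\<^sup>2 = mu_Rplus / mass G u" unfolding c_def using m mu_Rplus_pos by simp
  have c0: "0 < c\<^sup>2" unfolding c2 using m mu_Rplus_pos by simp
  have "0 < energy G (\<lambda>e x. c * u e x) (\<lambda>e x. c * u' e x)"
    by (rule critical_energy_pos[OF in_H1_scale[OF H]]) (use m c2 in \<open>simp add: energy_scale\<close>)
  then have "c^6 * (Lp_pow G 6 u / 6) < c\<^sup>2 * (Lp_pow G 2 u' / 2)" unfolding energy_scale by simp
  moreover have "c^6 = c\<^sup>2 * c^4" unfolding power_add[symmetric] by simp
  ultimately have "c\<^sup>2 * (c^4 * (Lp_pow G 6 u / 6)) < c\<^sup>2 * (Lp_pow G 2 u' / 2)" by (simp only: mult.assoc)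
  then have "c^4 * (Lp_pow G 6 u / 6) < Lp_pow G 2 u' / 2" using c0 by (simp only: mult_less_cancel_left_pos)
  then have "c^4 * Lp_pow G 6 u < 3 * Lp_pow G 2 u'" by simp
  moreover have "c^4 = mu_Rplus\<^sup>2 / (mass G u)\<^sup>2"
  proof -
    have "c^4 = (c\<^sup>2)\<^sup>2" by simp
    then show ?thesis unfolding c2 by (simp add: power_divide)
  qed
  ultimately show ?thesis using m mu_Rplus_pos by (simp add: field_simps)
qed

lemma energy_pos_subcritical:
  assumes H: "in_H1 G u u'" and m: "0 < mass G u" "mass G u \<le> mu_Rplus"
  shows "0 < energy G u u'"
proof -
  have "(mass G u)\<^sup>2 \<le> mu_Rplus\<^sup>2" using m by (intro power_mono) auto
  then have "3 / mu_Rplus\<^sup>2 * (mass G u)\<^sup>2 \<le> 3" using mu_Rplus_pos by (simp add: field_simps)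
  then have "(3 / mu_Rplus\<^sup>2 * (mass G u)\<^sup>2) * Lp_pow G 2 u' \<le> 3 * Lp_pow G 2 u'"
    by (rule mult_right_mono) (rule Lp_pow_even_nonneg, simp)
  then have "Lp_pow G 6 u < 3 * Lp_pow G 2 u'" using Gagliardo_Nirenberg_strict[OF H m(1)] by (simp add: mult.assoc)
  then show ?thesis unfolding energy_def by simp
qed

text \<open>For the lower bound, a negative energy at mass \<open>\<mu>\<close> means a quotient
  above \<open>3 / \<mu>^2\<close>, and \<open>\<mu>\<close> may approach \<open>mu_Rplus\<close>
  from the right. The supremum itself is not attained.\<close>

lemma GN_const_eq: "GN_const G = ereal (3 / mu_Rplus\<^sup>2)"
proof (rule antisym)
  show "GN_const G \<le> ereal (3 / mu_Rplus\<^sup>2)"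
    unfolding GN_const_def
  proof (rule SUP_least)
    fix p assume "p \<in> {(u, u'). in_H1 G u u' \<and> 0 < mass G u}"
    then have p: "in_H1 G (fst p) (snd p)" "0 < mass G (fst p)" by auto
    note gn = Gagliardo_Nirenberg_strict[OF p]
    have "0 \<le> (mass G (fst p))\<^sup>2 * Lp_pow G 2 (snd p)" using Lp_pow_even_nonneg[of 2 "snd p"] by simp
    then show "ereal (Lp_pow G 6 (fst p) / ((mass G (fst p))\<^sup>2 * Lp_pow G 2 (snd p))) \<le> ereal (3 / mu_Rplus\<^sup>2)"
      \<comment> \<open>A vanishing denominator gives the quotient 0 by the convention for
        division.\<close>
      using gn by (cases "(mass G (fst p))\<^sup>2 * Lp_pow G 2 (snd p) = 0") (auto simp: pos_divide_le_eq less_le)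
  qed
  have ge: "ereal (3 / \<mu>\<^sup>2) \<le> GN_const G" if mu: "mu_Rplus < \<mu>" for \<mu>
  proof -
    obtain u u' where u: "in_H1 G u u'" "mass G u = \<mu>" "energy G u u' < 0" using ex_negative_energy[OF mu] by blast
    have m: "0 < \<mu>" using mu mu_Rplus_pos by simp
    have S: "3 * Lp_pow G 2 u' < Lp_pow G 6 u" using u(3) unfolding energy_def by simp
    have T: "0 < Lp_pow G 2 u'"
    proof (rule ccontr)
      assume "\<not> ?thesis"
      then have "Lp_pow G 2 u' = 0" using Lp_pow_even_nonneg[of 2 u'] by simp
      then show False using Gagliardo_Nirenberg_strict[OF u(1)] u(2) m Lp_pow_even_nonneg[of 6 u] by simp
    qed
    have "3 / \<mu>\<^sup>2 \<le> Lp_pow G 6 u / ((mass G u)\<^sup>2 * Lp_pow G 2 u')"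
      unfolding u(2) using S T m by (simp add: field_simps)
    then have "ereal (3 / \<mu>\<^sup>2) \<le> ereal (Lp_pow G 6 (fst (u, u')) / ((mass G (fst (u, u')))\<^sup>2 * Lp_pow G 2 (snd (u, u'))))" by simp
    also have "\<dots> \<le> GN_const G" unfolding GN_const_def by (rule SUP_upper) (use u m in auto)
    finally show ?thesis .
  qed
  have "((\<lambda>\<mu>. ereal (3 / \<mu>\<^sup>2)) \<longlongrightarrow> ereal (3 / mu_Rplus\<^sup>2)) (at_right mu_Rplus)"
    using mu_Rplus_pos by (intro tendsto_intros) auto
  then show "ereal (3 / mu_Rplus\<^sup>2) \<le> GN_const G"
    by (rule tendsto_upperbound) (auto simp: eventually_at_right_less ge eventually_at_filter intro!: always_eventually)
qed

lemma crit_mass_eq: "crit_mass G = mu_Rplus"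
  unfolding crit_mass_def GN_const_eq using mu_Rplus_pos by simp

section \<open>Masses without ground state and sign of the level\<close>

lemma gs_level_le: "in_H1 G u u' \<Longrightarrow> mass G u = \<mu> \<Longrightarrow> gs_level G \<mu> \<le> ereal (energy G u u')"
  unfolding gs_level_def H1_mu_def by (rule INF_lower2[of "(u, u')"]) auto

lemma not_attained_subcritical:
  assumes "0 < \<mu>" "\<mu> \<le> mu_Rplus"
  shows "\<not> gs_attained G \<mu>"
proof
  assume "gs_attained G \<mu>"
  then obtain u u' where u: "in_H1 G u u'" "mass G u = \<mu>" "ereal (energy G u u') = gs_level G \<mu>"
    unfolding gs_attained_def H1_mu_def by auto
  have pos: "0 < energy G u u'" using energy_pos_subcritical[OF u(1)] u(2) assms by simp
  obtain w w' where "in_H1 G w w'" "mass G w = \<mu>" "energy G w w' < energy G u u'"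
    using ex_small_energy[OF assms(1) pos] by blast
  then show False using gs_level_le[of w w' \<mu>] u(3) by (metis ereal_less_eq(3) not_le)
qed

lemma not_attained_supercritical:
  assumes "mu_R < \<mu>"
  shows "\<not> gs_attained G \<mu>"
proof
  assume "gs_attained G \<mu>"
  then obtain u u' where u: "in_H1 G u u'" "mass G u = \<mu>" "ereal (energy G u u') = gs_level G \<mu>"
    unfolding gs_attained_def H1_mu_def by auto
  obtain w w' where "in_H1 G w w'" "mass G w = \<mu>" "energy G w w' < energy G u u'"
    using ex_energy_below[OF assms] by blast
  then show False using gs_level_le[of w w' \<mu>] u(3) by (metis ereal_less_eq(3) not_le)
qed

lemma gs_level_neg:
  assumes "mu_Rplus < \<mu>"
  shows "gs_level G \<mu> < 0"
proof -
  obtain u u' where u: "in_H1 G u u'" "mass G u = \<mu>" "energy G u u' < 0" using ex_negative_energy[OF assms] by blast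
  then show ?thesis using gs_level_le[OF u(1,2)] by (metis ereal_less(1) ereal_less_eq(3) le_less_trans less_ereal.simps(1) zero_ereal_def)
qed

section \<open>Finiteness of the level and existence of ground states\<close>

lemma profile_power6_le:
  assumes "nonneg_profile G u u' M e0 x0" "M \<le> B"
  shows "Lp_pow G 6 u \<le> B^4 * mass G u"
proof -
  interpret nonneg_profile G u u' M e0 x0 by (rule assms(1))
  have "Lp_pow G 6 u = (\<Sum>e\<in>Es G. LINT x:edom G e|lborel. (u e x)^6)" by (rule Lp_pow_even) simp
  also have "\<dots> \<le> (\<Sum>e\<in>Es G. LINT x:edom G e|lborel. B^4 * (u e x)\<^sup>2)"
  proof (intro sum_mono set_integral_mono)
    fix e x assume e: "e \<in> Es G" and x: "x \<in> edom G e"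
    have "(u e x)^4 * (u e x)\<^sup>2 \<le> B^4 * (u e x)\<^sup>2"
      using u_range[OF e x] assms(2) by (intro mult_right_mono power_mono) auto
    then show "(u e x)^6 \<le> B^4 * (u e x)\<^sup>2" by (simp add: power_add[symmetric])
  qed (use in_H1_integrable_power6[OF H] in_H1_edge(2)[OF H] in auto)
  also have "\<dots> = B^4 * mass G u" unfolding mass_eq by (simp add: sum_distrib_left)
  finally show ?thesis .
qed

text \<open>Either the energy exceeds -1, or the uniform bound on maxima controls the sextic
  integral by \<open>B^4 * \<mu>\<close>.\<close>

lemma gs_level_bounded_below:
  assumes mu: "0 < \<mu>" "\<mu> \<le> mu_R"
  shows "\<exists>K. ereal K \<le> gs_level G \<mu>"
proof -
  obtain B where B: "\<forall>u u' M e0 x0. nonneg_profile G u u' M e0 x0 \<longrightarrow> mass G u \<le> mu_R \<longrightarrow> energy G u u' \<le> - 1 \<longrightarrow> M \<le> B"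
    using max_bounded_of_negative_energy[OF zero_less_one] by blast
  define K where "K = min (- 1) (- (B^4 * \<mu>) / 6)"
  have "ereal K \<le> gs_level G \<mu>"
    unfolding gs_level_def
  proof (rule INF_greatest)
    fix p assume "p \<in> H1_mu G \<mu>"
    then have p: "in_H1 G (fst p) (snd p)" "mass G (fst p) = \<mu>" unfolding H1_mu_def by auto
    obtain v v' M e0 x0 where v: "nonneg_profile G v v' M e0 x0" "mass G v = mass G (fst p)" "energy G v v' \<le> energy G (fst p) (snd p)"
      using ex_nonneg_profile[OF p(1)] p(2) mu by auto
    have "K \<le> energy G v v'"
    proof (cases "energy G v v' \<le> - 1")
      case True
      then have "M \<le> B" using B[rule_format, OF v(1)] v(2) p(2) mu by simp
      then have "Lp_pow G 6 v \<le> B^4 * \<mu>" using profile_power6_le[OF v(1)] v(2) p(2) by simp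
      then have "- (B^4 * \<mu>) / 6 \<le> energy G v v'" using Lp_pow_even_nonneg[of 2 v'] unfolding energy_def by simp
      then show ?thesis unfolding K_def by simp
    qed (simp add: K_def)
    then show "ereal K \<le> ereal (energy G (fst p) (snd p))" using v(3) by simp
  qed
  then show ?thesis by blast
qed

text \<open>Rational points carry the diagonal argument. The right end of a bounded edge may be
  irrational and is approximated from the left.\<close>

lemma edom_rational_dense:
  assumes e: "e \<in> Es G" and x: "x \<in> edom G e" and d: "d > 0"
  obtains q where "q \<in> \<rat>" "q \<in> edom G e" "\<bar>x - q\<bar> < d"
proof (cases "e = h \<or> x < len G e")
  case True
  define z where "z = (if e = h then x + d else min (x + d) (len G e))"
  have z: "x < z" "z \<le> x + d" unfolding z_def using True d by auto
  obtain q where q: "q \<in> \<rat>" "x < q" "q < z" using Rats_dense_in_real[OF z(1)] by blast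
  have "q \<in> edom G e" using q x edom_h edom_bounded[of e] unfolding z_def by (cases "e = h") auto
  then show ?thesis using q z by (intro that[of q]) auto
next
  case False
  then have xl: "x = len G e" "e \<noteq> h" using x edom_bounded[of e] by auto
  have z: "max 0 (x - d) < x" using xl len_pos[OF e] d by auto
  obtain q where q: "q \<in> \<rat>" "max 0 (x - d) < q" "q < x" using Rats_dense_in_real[OF z] by blast
  have "q \<in> edom G e" using q xl edom_bounded[of e] by auto
  then show ?thesis using q by (intro that[of q]) auto
qed

lemma gs_attained_intermediate:
  assumes mu: "mu_Rplus < \<mu>" "\<mu> \<le> mu_R"
  shows "gs_attained G \<mu>"
proof -
  have mu0: "0 < \<mu>" using mu mu_Rplus_pos by simp
  obtain K where K: "ereal K \<le> gs_level G \<mu>" using gs_level_bounded_below[OF mu0 mu(2)] by blast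
  have neg: "gs_level G \<mu> < 0" by (rule gs_level_neg[OF mu(1)])
  obtain l where l: "gs_level G \<mu> = ereal l" using K neg by (cases "gs_level G \<mu>") auto
  have l0: "l < 0" using neg unfolding l by simp
  have lev: "l \<le> energy G u u'" if "in_H1 G u u'" "mass G u = \<mu>" for u u'
    using gs_level_le[OF that] unfolding l by simp
  \<comment> \<open>The minimum with \<open>- l / 2\<close> keeps all energies at most
    \<open>l / 2 < 0\<close>, as the uniform bound on maxima requires.\<close>
  define \<delta> where "\<delta> = (\<lambda>n::nat. min (1 / (real n + 1)) (- l / 2))"
  have "\<exists>v v' M e0 x0. nonneg_profile G v v' M e0 x0 \<and> mass G v = \<mu> \<and> energy G v v' \<le> l + \<delta> n" for n
  proof -
    have "gs_level G \<mu> < ereal (l + \<delta> n)" unfolding l \<delta>_def using l0 by simp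
    then obtain p where p: "p \<in> H1_mu G \<mu>" "ereal (energy G (fst p) (snd p)) < ereal (l + \<delta> n)"
      unfolding gs_level_def INF_less_iff by blast
    have p': "in_H1 G (fst p) (snd p)" "mass G (fst p) = \<mu>" using p(1) unfolding H1_mu_def by auto
    obtain v v' M e0 x0 where "nonneg_profile G v v' M e0 x0" "mass G v = mass G (fst p)" "energy G v v' \<le> energy G (fst p) (snd p)"
      using ex_nonneg_profile[OF p'(1)] p'(2) mu0 by auto
    moreover from this have "energy G v v' \<le> l + \<delta> n" using p(2) by simp
    ultimately show ?thesis using p'(2) by metis
  qed
  then obtain v0 v0' M0 e0 x0 where np0: "\<And>n. nonneg_profile G (v0 n) (v0' n) (M0 n) (e0 n) (x0 n)"
    and m0: "\<And>n. mass G (v0 n) = \<mu>" and en0: "\<And>n. energy G (v0 n) (v0' n) \<le> l + \<delta> n" by metis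
  have en0': "energy G (v0 n) (v0' n) \<le> - (- l / 2)" for n using en0[of n] unfolding \<delta>_def by simp
  have l2: "0 < - l / 2" using l0 by simp
  obtain B where B0: "\<forall>u u' M e0 x0. nonneg_profile G u u' M e0 x0 \<longrightarrow> mass G u \<le> mu_R \<longrightarrow> energy G u u' \<le> - (- l / 2) \<longrightarrow> M \<le> B"
    using max_bounded_of_negative_energy[OF l2] by blast
  have M0B: "M0 n \<le> B" for n by (rule B0[rule_format, OF np0]) (use m0 mu en0' in auto)
  have H0: "in_H1 G (v0 n) (v0' n)" for n using np0[of n] by (simp add: nonneg_profile.H)
  have r0: "v0 n e x \<in> {0..B}" if "e \<in> Es G" "x \<in> edom G e" for n e x
    using nonneg_profile.u_range[OF np0[of n] that] M0B[of n] by auto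
  have B: "B > 0" using M0B[of 0] nonneg_profile.M_pos[OF np0[of 0]] by simp
  \<comment> \<open>A negative energy bounds the squared norm of the derivative by a third of the
    sextic integral, hence by this constant.\<close>
  define TT where "TT = B^4 * \<mu> / 3"
  have TT: "(LINT x:edom G e|lborel. (v0' n e x)\<^sup>2) \<le> TT" if e: "e \<in> Es G" for n e
  proof -
    have "(LINT x:edom G e|lborel. (v0' n e x)\<^sup>2) \<le> Lp_pow G 2 (v0' n)"
      unfolding Lp_pow_even[OF even_numeral] by (rule member_le_sum[OF e _ finite_Es]) (auto intro: set_integral_nonneg')
    also have "\<dots> \<le> Lp_pow G 6 (v0 n) / 3" using en0'[of n] l0 unfolding energy_def by simp
    also have "\<dots> \<le> TT" unfolding TT_def using profile_power6_le[OF np0 M0B, of n] m0[of n] by simp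
    finally show ?thesis .
  qed
  \<comment> \<open>Convergence on this countable set extends to all points by the uniform Hoelder
    bound.\<close>
  define S where "S = {(e, q). e \<in> Es G \<and> q \<in> \<rat> \<inter> edom G e}"
  have "countable (Es G \<times> (\<rat> :: real set))" by (intro countable_SIGMA countable_finite finite_Es countable_rat)
  then have cS: "countable S" by (rule countable_subset[rotated]) (auto simp: S_def)
  have fb: "norm (v0 n (fst s) (snd s)) \<le> B" if "s \<in> S" for n s
    using r0[of "fst s" "snd s" n] that unfolding S_def by auto
  have "\<exists>k::nat \<Rightarrow> nat. strict_mono k \<and> (\<forall>s\<in>S. \<exists>L. (\<lambda>n. v0 (k n) (fst s) (snd s)) \<longlonglongrightarrow> L)"
  proof (rule function_convergent_subsequence[OF cS, of "\<lambda>n s. v0 n (fst s) (snd s)" B], rule fb)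
    fix k :: "nat \<Rightarrow> nat"
    assume "strict_mono k" "\<And>s. s \<in> S \<Longrightarrow> \<exists>L. (\<lambda>n. v0 (k n) (fst s) (snd s)) \<longlonglongrightarrow> L"
    then show ?thesis by blast
  qed
  then obtain k :: "nat \<Rightarrow> nat" where k: "strict_mono k" "\<forall>s\<in>S. \<exists>L. (\<lambda>n. v0 (k n) (fst s) (snd s)) \<longlonglongrightarrow> L"
    by blast
  define v where "v = (\<lambda>n. v0 (k n))"
  define v' where "v' = (\<lambda>n. v0' (k n))"
  have H: "in_H1 G (v n) (v' n)" and r: "e \<in> Es G \<Longrightarrow> x \<in> edom G e \<Longrightarrow> v n e x \<in> {0..B}"
    and m: "mass G (v n) = \<mu>" for n e x unfolding v_def v'_def using H0 r0 m0 by auto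
  have T: "(LINT x:edom G e|lborel. (v' n e x)\<^sup>2) \<le> TT" if "e \<in> Es G" for n e unfolding v'_def using TT[OF that] .
  have en: "energy G (v n) (v' n) \<le> l + 1 / (real n + 1)" for n
  proof -
    have "n \<le> k n" using k(1) by (rule seq_suble)
    then have "1 / (real (k n) + 1) \<le> 1 / (real n + 1)" by (intro divide_left_mono) auto
    then show ?thesis using en0[of "k n"] unfolding v_def v'_def \<delta>_def by simp
  qed
  have TT0: "0 \<le> TT" unfolding TT_def using mu0 B by simp
  have conv: "convergent (\<lambda>n. v n e x)" if e: "e \<in> Es G" and x: "x \<in> edom G e" for e x
  proof (rule Cauchy_convergent, rule metric_CauchyI)
    fix \<epsilon> :: real assume eps: "\<epsilon> > 0"
    \<comment> \<open>Chosen so that the Hoelder modulus over distance \<open>d\<close> stays below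
      \<open>\<epsilon> / 3\<close>; the summand 1 covers \<open>TT = 0\<close>.\<close>
    define d where "d = (\<epsilon> / 3)\<^sup>2 / (TT + 1)"
    have d: "d > 0" unfolding d_def using eps TT0 by simp
    obtain q where q: "q \<in> \<rat>" "q \<in> edom G e" "\<bar>x - q\<bar> < d" using edom_rational_dense[OF e x d] .
    have near: "\<bar>v n e x - v n e q\<bar> < \<epsilon> / 3" for n
    proof -
      have "\<bar>v n e x - v n e q\<bar> \<le> sqrt (\<bar>x - q\<bar> * TT)"
        by (rule AC_on_Holder[OF in_H1_edge(4,3)[OF H e] is_interval_edom q(2) x T[OF e]])
      also have "\<dots> < sqrt ((\<epsilon> / 3)\<^sup>2)"
      proof (rule real_sqrt_less_mono)
        have "\<bar>x - q\<bar> * TT \<le> d * TT" using q(3) TT0 by (intro mult_right_mono) auto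
        also have "\<dots> < d * (TT + 1)" using d by simp
        also have "\<dots> = (\<epsilon> / 3)\<^sup>2" unfolding d_def using TT0 by simp
        finally show "\<bar>x - q\<bar> * TT < (\<epsilon> / 3)\<^sup>2" .
      qed
      finally show ?thesis using eps by simp
    qed
    have "\<exists>L. (\<lambda>n. v n e q) \<longlonglongrightarrow> L" using k(2)[rule_format, of "(e, q)"] e q unfolding S_def v_def by auto
    then have "Cauchy (\<lambda>n. v n e q)" using LIMSEQ_imp_Cauchy by blast
    then obtain N where N: "\<And>i j. i \<ge> N \<Longrightarrow> j \<ge> N \<Longrightarrow> dist (v i e q) (v j e q) < \<epsilon> / 3"
      using metric_CauchyD[of _ "\<epsilon> / 3"] eps by (metis divide_pos_pos zero_less_numeral)
    show "\<exists>N. \<forall>i\<ge>N. \<forall>j\<ge>N. dist (v i e x) (v j e x) < \<epsilon>"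
    proof (intro exI[of _ N] allI impI)
      fix i j assume ij: "i \<ge> N" "j \<ge> N"
      show "dist (v i e x) (v j e x) < \<epsilon>" using N[OF ij] near[of i] near[of j] unfolding dist_real_def by linarith
    qed
  qed
  define W where "W = (\<lambda>e x. lim (\<lambda>n. v n e x))"
  have lim: "(\<lambda>n. v n e x) \<longlonglongrightarrow> W e x" if "e \<in> Es G" "x \<in> edom G e" for e x
    using conv[OF that] unfolding W_def by (simp add: convergent_LIMSEQ_iff)
  have WB: "W e x \<in> {0..B}" if "e \<in> Es G" "x \<in> edom G e" for e x
  proof -
    have "0 \<le> W e x" by (rule LIMSEQ_le_const[OF lim[OF that]]) (use r[OF that] in auto)
    moreover have "W e x \<le> B" by (rule LIMSEQ_le_const2[OF lim[OF that]]) (use r[OF that] in auto)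
    ultimately show ?thesis by simp
  qed
  have vm: "(\<lambda>x. indicat_real (edom G e) x * v n e x) \<in> borel_measurable borel" if "e \<in> Es G" for n e
    using borel_measurable_continuous_on_indicator[OF edge_intervalD(3)[OF edge_interval_edom] in_H1_edge(5)[OF H that]] by simp
  have ilim: "(\<lambda>n. indicat_real (edom G e) x * v n e x) \<longlonglongrightarrow> indicat_real (edom G e) x * W e x" if "e \<in> Es G" for e x
    by (cases "x \<in> edom G e") (auto intro: lim[OF that])
  have Wm: "(\<lambda>x. indicat_real (edom G e) x * W e x) \<in> borel_measurable borel" if "e \<in> Es G" for e
    by (rule borel_measurable_LIMSEQ_real[OF ilim[OF that] vm[OF that]])
  have ind: "indicat_real A x *\<^sub>R (c ^ j) = (indicat_real A x * c) ^ j" if "j > 0" for A x c and j :: nat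
    using that by (auto split: split_indicator)
  have W2: "set_integrable lborel (edom G e) (\<lambda>x. (W e x)\<^sup>2)"
    and W2le: "\<And>\<epsilon>. \<epsilon> > 0 \<Longrightarrow> eventually (\<lambda>n. (LINT x:edom G e|lborel. (W e x)\<^sup>2) - \<epsilon> \<le> (LINT x:edom G e|lborel. (v n e x)\<^sup>2)) sequentially"
    if e: "e \<in> Es G" for e
  proof -
    have i: "integrable lborel (\<lambda>x. (indicat_real (edom G e) x * v n e x)\<^sup>2)" for n
      using in_H1_edge(2)[OF H e] unfolding set_integrable_def by (simp only: ind[OF pos2])
    have C: "(LINT x|lborel. (indicat_real (edom G e) x * v n e x)\<^sup>2) \<le> \<mu>" for n
    proof -
      have "(LINT x|lborel. (indicat_real (edom G e) x * v n e x)\<^sup>2) = (LINT x:edom G e|lborel. (v n e x)\<^sup>2)"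
        unfolding set_lebesgue_integral_def by (simp only: ind[OF pos2])
      also have "\<dots> \<le> mass G (v n)" unfolding mass_eq by (rule member_le_sum[OF e _ finite_Es]) (auto intro: set_integral_nonneg')
      finally show ?thesis using m by simp
    qed
    have mm: "(\<lambda>x. (indicat_real (edom G e) x * W e x)\<^sup>2) \<in> borel_measurable lborel" using Wm[OF e] by simp
    have ll: "AE x in lborel. (\<lambda>n. (indicat_real (edom G e) x * v n e x)\<^sup>2) \<longlonglongrightarrow> (indicat_real (edom G e) x * W e x)\<^sup>2"
      by (intro AE_I2 tendsto_intros ilim[OF e])
    note F = eventually_Fatou_real[OF i _ mm ll C]
    show "set_integrable lborel (edom G e) (\<lambda>x. (W e x)\<^sup>2)"
      unfolding set_integrable_def ind[OF pos2] by (rule F(1)) simp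
    show "eventually (\<lambda>n. (LINT x:edom G e|lborel. (W e x)\<^sup>2) - \<epsilon> \<le> (LINT x:edom G e|lborel. (v n e x)\<^sup>2)) sequentially" if "\<epsilon> > 0" for \<epsilon>
      unfolding set_lebesgue_integral_def ind[OF pos2] by (rule F(2)[OF _ that]) simp
  qed
  have mW: "mass G W \<le> \<mu>"
  proof (rule field_le_epsilon)
    fix \<epsilon> :: real assume eps: "\<epsilon> > 0"
    define c where "c = real (card (Es G)) + 1"
    have "eventually (\<lambda>n. \<forall>e\<in>Es G. (LINT x:edom G e|lborel. (W e x)\<^sup>2) - \<epsilon> / c \<le> (LINT x:edom G e|lborel. (v n e x)\<^sup>2)) sequentially"
      by (intro eventually_ball_finite finite_Es ballI W2le) (use eps in \<open>auto simp: c_def\<close>)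
    then obtain n where n: "\<forall>e\<in>Es G. (LINT x:edom G e|lborel. (W e x)\<^sup>2) - \<epsilon> / c \<le> (LINT x:edom G e|lborel. (v n e x)\<^sup>2)"
      using eventually_happens'[OF sequentially_bot] by blast
    have "(\<Sum>e\<in>Es G. (LINT x:edom G e|lborel. (W e x)\<^sup>2) - \<epsilon> / c) \<le> mass G (v n)"
      unfolding mass_eq by (intro sum_mono) (use n in blast)
    then have "mass G W - real (card (Es G)) * (\<epsilon> / c) \<le> \<mu>" unfolding m by (simp add: mass_eq sum_subtractf)
    moreover have "real (card (Es G)) * (\<epsilon> / c) \<le> \<epsilon>"
    proof -
      have "real (card (Es G)) * (\<epsilon> / c) = \<epsilon> * (real (card (Es G)) / c)" by simp
      also have "\<dots> \<le> \<epsilon> * 1" using eps by (intro mult_left_mono) (auto simp: c_def)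
      finally show ?thesis by simp
    qed
    ultimately show "mass G W \<le> \<mu> + \<epsilon>" by linarith
  qed
  have dct6: "(\<lambda>n. LINT x:A|lborel. (v n e x)^6) \<longlonglongrightarrow> (LINT x:A|lborel. (W e x)^6)"
    if e: "e \<in> Es G" and A: "A = {0..b}" "A \<subseteq> edom G e" "0 \<le> b" for e A b
  proof -
    have sub: "indicat_real A x *\<^sub>R (c ^ 6) = indicat_real A x * (indicat_real (edom G e) x * c) ^ 6" for x c
      using A(2) by (auto split: split_indicator)
    have Ab: "A \<in> sets borel" using A by simp
    show ?thesis
      unfolding set_lebesgue_integral_def
    proof (rule integral_dominated_convergence[where w = "\<lambda>x. indicat_real A x *\<^sub>R B^6"])
      show "(\<lambda>x. indicat_real A x *\<^sub>R (W e x)^6) \<in> borel_measurable lborel"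
        unfolding sub using Wm[OF e] Ab by simp
      show "(\<lambda>x. indicat_real A x *\<^sub>R (v n e x)^6) \<in> borel_measurable lborel" for n
        unfolding sub using vm[OF e] Ab by simp
      show "integrable lborel (\<lambda>x. indicat_real A x *\<^sub>R B^6)"
        using set_integral_Icc_const(1)[OF A(3), of "B^6"] A(1) unfolding set_integrable_def by simp
      show "AE x in lborel. (\<lambda>n. indicat_real A x *\<^sub>R (v n e x)^6) \<longlonglongrightarrow> indicat_real A x *\<^sub>R (W e x)^6"
        unfolding sub by (intro AE_I2 tendsto_intros ilim[OF e])
      show "AE x in lborel. norm (indicat_real A x *\<^sub>R (v n e x)^6) \<le> indicat_real A x *\<^sub>R B^6" for n
      proof (rule AE_I2)
        fix x
        show "norm (indicat_real A x *\<^sub>R (v n e x)^6) \<le> indicat_real A x *\<^sub>R B^6"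
        proof (cases "x \<in> A")
          case True
          then have "v n e x \<in> {0..B}" using r[OF e] A(2) by blast
          then have "(v n e x)^6 \<le> B^6" "0 \<le> (v n e x)^6" by (auto intro: power_mono)
          then show ?thesis using True by simp
        qed simp
      qed
    qed
  qed
  \<comment> \<open>The cut on the halfline moves to infinity along with the sequence. For each cut
    \<open>j\<close> an index is taken so late that the function is close to \<open>W\<close> at the
    cut and its sextic integral up to the cut hardly exceeds that of \<open>W\<close>.\<close>
  have hN: "\<exists>N\<ge>j. \<bar>v N h (real j) - W h (real j)\<bar> \<le> 1 / (real j + 1)
      \<and> (LINT x:{0..real j}|lborel. (v N h x)^6) \<le> (LINT x:{0..real j}|lborel. (W h x)^6) + 1 / (real j + 1)" for j :: nat
  proof -
    have p: "0 < 1 / (real j + 1)" by simp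
    have j: "real j \<in> edom G h" "{0..real j} \<subseteq> edom G h" using edom_h by auto
    have "eventually (\<lambda>n. dist (v n h (real j)) (W h (real j)) < 1 / (real j + 1)) sequentially"
      by (rule tendstoD[OF lim[OF h_in_Es j(1)] p])
    moreover have "eventually (\<lambda>n. dist (LINT x:{0..real j}|lborel. (v n h x)^6) (LINT x:{0..real j}|lborel. (W h x)^6) < 1 / (real j + 1)) sequentially"
      by (rule tendstoD[OF dct6[OF h_in_Es refl j(2)] p]) simp
    ultimately have "eventually (\<lambda>n. j \<le> n \<and> \<bar>v n h (real j) - W h (real j)\<bar> \<le> 1 / (real j + 1)
      \<and> (LINT x:{0..real j}|lborel. (v n h x)^6) \<le> (LINT x:{0..real j}|lborel. (W h x)^6) + 1 / (real j + 1)) sequentially"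
      using eventually_ge_at_top[of j]
    proof eventually_elim
      case (elim n)
      then show ?case unfolding dist_real_def by linarith
    qed
    then show ?thesis using eventually_happens'[OF sequentially_bot] by blast
  qed
  then obtain N where N: "\<And>j. j \<le> N j" "\<And>j. \<bar>v (N j) h (real j) - W h (real j)\<bar> \<le> 1 / (real j + 1)"
    "\<And>j. (LINT x:{0..real j}|lborel. (v (N j) h x)^6) \<le> (LINT x:{0..real j}|lborel. (W h x)^6) + 1 / (real j + 1)" by metis
  have Ninf: "filterlim N sequentially sequentially"
    by (rule filterlim_at_top_mono[OF filterlim_ident]) (use N(1) in auto)
  have Nlim: "(\<lambda>j. v (N j) e x) \<longlonglongrightarrow> W e x" if "e \<in> Es G" "x \<in> edom G e" for e x
    by (rule filterlim_compose[OF lim[OF that] Ninf])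
  have core: "\<exists>D. AC_on (edom G e) (W e) D \<and> set_integrable lborel (edom G e) (\<lambda>x. (D x)\<^sup>2) \<and>
      (\<forall>\<epsilon>>0. eventually (\<lambda>j. (LINT x:edom G e|lborel. (D x)\<^sup>2) - \<epsilon> \<le> (LINT x:edom G e|lborel. (v' (N j) e x)\<^sup>2)) sequentially)"
    if e: "e \<in> Es G" "e \<noteq> h" for e
    by (rule AC_on_lower_semicontinuous[OF edge_interval_edom in_H1_edge(4)[OF H e(1)] in_H1_edge(3)[OF H e(1)] T[OF e(1)] Nlim[OF e(1)]])
  \<comment> \<open>The derivative of the function frozen at the cut; its norm ignores the tail,
    whose energy is estimated separately.\<close>
  define trunc where "trunc = (\<lambda>j x. indicat_real {0..real j} x * v' (N j) h x)"
  have tsq: "indicat_real {0..} x *\<^sub>R (trunc j x)\<^sup>2 = indicat_real {0..real j} x *\<^sub>R (v' (N j) h x)\<^sup>2" for j x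
    unfolding trunc_def by (auto split: split_indicator)
  have g2h: "set_integrable lborel {0..} (\<lambda>x. (v' n h x)\<^sup>2)" for n using in_H1_edge(3)[OF H h_in_Es] edom_h by simp
  have t2: "set_integrable lborel {0..} (\<lambda>x. (trunc j x)\<^sup>2)" for j
    unfolding set_integrable_def tsq using set_integrable_subset[OF g2h, of "{0..real j}"] unfolding set_integrable_def by simp
  have t2i: "(LINT x:{0..}|lborel. (trunc j x)\<^sup>2) = (LINT x:{0..real j}|lborel. (v' (N j) h x)\<^sup>2)" for j
    unfolding set_lebesgue_integral_def tsq ..
  have t2T: "(LINT x:{0..}|lborel. (trunc j x)\<^sup>2) \<le> TT" for j
  proof -
    have "(LINT x:{0..real j}|lborel. (v' (N j) h x)\<^sup>2) \<le> (LINT x:{0..}|lborel. (v' (N j) h x)\<^sup>2)"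
      by (rule set_integral_subset_le[OF g2h]) auto
    then show ?thesis unfolding t2i using T[OF h_in_Es, of "N j"] edom_h by simp
  qed
  have tac: "AC_on {0..} (\<lambda>x. v (N j) h (min x (real j))) (trunc j)" for j
    unfolding trunc_def using in_H1_edge(4)[OF H h_in_Es] edom_h by (intro AC_on_truncate) auto
  have tlim: "(\<lambda>j. v (N j) h (min x (real j))) \<longlonglongrightarrow> W h x" if "x \<in> {0..}" for x
  proof (rule Lim_transform_eventually[OF Nlim[OF h_in_Es]])
    show "x \<in> edom G h" using that edom_h by simp
    obtain J :: nat where J: "x \<le> real J" using real_arch_simple by blast
    show "eventually (\<lambda>j. v (N j) h x = v (N j) h (min x (real j))) sequentially"
      using eventually_ge_at_top[of J]
    proof eventually_elim
      case (elim j)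
      then have "real J \<le> real j" by simp
      then show ?case using J by (simp add: min_def)
    qed
  qed
  have ei: "edge_interval {0::real..}" unfolding edge_interval_def by blast
  have half: "\<exists>D. AC_on {0..} (W h) D \<and> set_integrable lborel {0..} (\<lambda>x. (D x)\<^sup>2) \<and>
      (\<forall>\<epsilon>>0. eventually (\<lambda>j. (LINT x:{0..}|lborel. (D x)\<^sup>2) - \<epsilon> \<le> (LINT x:{0..}|lborel. (trunc j x)\<^sup>2)) sequentially)"
    by (rule AC_on_lower_semicontinuous[OF ei tac t2 t2T tlim])
  \<comment> \<open>The portion of each edge that is kept at stage \<open>j\<close>; only the
    halfline is cut.\<close>
  define part where "part = (\<lambda>j e. if e = h then {0..real j} else edom G e)"
  have part_h: "part j h = {0..real j}" and part_core: "e \<noteq> h \<Longrightarrow> part j e = edom G e" for j e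
    unfolding part_def by simp_all
  define good where "good = (\<lambda>e D. AC_on (edom G e) (W e) D \<and> set_integrable lborel (edom G e) (\<lambda>x. (D x)\<^sup>2) \<and>
      (\<forall>\<epsilon>>0. eventually (\<lambda>j. (LINT x:edom G e|lborel. (D x)\<^sup>2) - \<epsilon> \<le> (LINT x:part j e|lborel. (v' (N j) e x)\<^sup>2)) sequentially))"
  have "\<exists>D. good e D" if e: "e \<in> Es G" for e
  proof (cases "e = h")
    case True
    show ?thesis unfolding True good_def part_h edom_h by (rule half[unfolded t2i])
  next
    case False
    show ?thesis unfolding good_def part_core[OF False] by (rule core[OF e False])
  qed
  then have "\<forall>e\<in>Es G. \<exists>D. good e D" by (intro ballI)
  from bchoice[OF this] obtain W' where gW: "\<forall>e\<in>Es G. good e (W' e)" by (elim exE)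
  have W': "AC_on (edom G e) (W e) (W' e)" "set_integrable lborel (edom G e) (\<lambda>x. (W' e x)\<^sup>2)"
    "\<epsilon> > 0 \<Longrightarrow> eventually (\<lambda>j. (LINT x:edom G e|lborel. (W' e x)\<^sup>2) - \<epsilon> \<le> (LINT x:part j e|lborel. (v' (N j) e x)\<^sup>2)) sequentially"
    if "e \<in> Es G" for e \<epsilon>
    using bspec[OF gW that] unfolding good_def by simp_all
  have HW: "in_H1 G W W'"
  proof -
    have "\<forall>n. \<exists>\<phi>. (\<forall>e\<in>Es G. v n e 0 = \<phi> (src G e)) \<and> (\<forall>e\<in>Es G - HL G. v n e (len G e) = \<phi> (tgt G e))"
      using H unfolding in_H1_def by blast
    from choice[OF this] obtain \<phi> where \<phi>: "\<forall>n. (\<forall>e\<in>Es G. v n e 0 = \<phi> n (src G e)) \<and> (\<forall>e\<in>Es G - HL G. v n e (len G e) = \<phi> n (tgt G e))"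
      by (elim exE)
    have "H1_on (edom G e) (W e) (W' e)" if "e \<in> Es G" for e
      unfolding H1_on_iff using W2[OF that] W'(1,2)[OF that] by simp
    moreover have "W e 0 = lim (\<lambda>n. \<phi> n (src G e))" if "e \<in> Es G" for e
      using \<phi> that unfolding W_def by simp
    moreover have "W e (len G e) = lim (\<lambda>n. \<phi> n (tgt G e))" if "e \<in> Es G - HL G" for e
      using \<phi> that unfolding W_def by simp
    ultimately show ?thesis unfolding in_H1_def by (intro conjI ballI exI[of _ "\<lambda>w. lim (\<lambda>n. \<phi> n w)"])
  qed
  have W6: "set_integrable lborel (edom G e) (\<lambda>x. (W e x)^6)" if "e \<in> Es G" for e
    by (rule in_H1_integrable_power6[OF HW that])
  have W6le: "eventually (\<lambda>j. (LINT x:part j e|lborel. (v (N j) e x)^6) \<le> (LINT x:edom G e|lborel. (W e x)^6) + \<epsilon>) sequentially"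
    if e: "e \<in> Es G" and eps: "\<epsilon> > 0" for e \<epsilon>
  proof (cases "e = h")
    case True
    have "(\<lambda>j. 1 / (real j + 1)) \<longlonglongrightarrow> 0" by real_asymp
    then have "eventually (\<lambda>j. 1 / (real j + 1) < \<epsilon>) sequentially" using eps by (rule order_tendstoD(2))
    then show ?thesis
    proof eventually_elim
      case (elim j)
      have "(LINT x:{0..real j}|lborel. (W h x)^6) \<le> (LINT x:edom G h|lborel. (W h x)^6)"
        by (rule set_integral_subset_le[OF W6[OF h_in_Es]]) (auto simp: edom_h zero_le_even_power)
      then show ?case using N(3)[of j] elim unfolding True part_def by simp
    qed
  next
    case False
    have "(\<lambda>n. LINT x:edom G e|lborel. (v n e x)^6) \<longlonglongrightarrow> (LINT x:edom G e|lborel. (W e x)^6)"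
      by (rule dct6[OF e edom_bounded[OF False]]) (use len_pos[OF e False] in auto)
    then have "(\<lambda>j. LINT x:edom G e|lborel. (v (N j) e x)^6) \<longlonglongrightarrow> (LINT x:edom G e|lborel. (W e x)^6)"
      using Ninf by (rule filterlim_compose)
    then have "eventually (\<lambda>j. (LINT x:edom G e|lborel. (v (N j) e x)^6) < (LINT x:edom G e|lborel. (W e x)^6) + \<epsilon>) sequentially"
      using eps by (intro order_tendstoD(2)) auto
    then show ?thesis unfolding part_def using False by (auto elim!: eventually_mono)
  qed
  \<comment> \<open>The value at the cut controls the error of \<open>tail_energy_ge\<close>. It
    tends to 0 because it is close to \<open>W\<close> there and \<open>W\<close> decays.\<close>
  define s where "s = (\<lambda>j. v (N j) h (real j))"
  have slim: "s \<longlonglongrightarrow> 0"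
  proof -
    have "H1_on {0..} (W h) (W' h)" using in_H1_edge(1)[OF HW h_in_Es] edom_h by simp
    then have "(W h \<longlongrightarrow> 0) at_top" by (rule H1_on_atLeast_tendsto_0)
    then have 1: "(\<lambda>j. W h (real j)) \<longlonglongrightarrow> 0" using filterlim_real_sequentially by (rule filterlim_compose)
    have "(\<lambda>j. 1 / (real j + 1)) \<longlonglongrightarrow> 0" by real_asymp
    then have "(\<lambda>j. s j - W h (real j)) \<longlonglongrightarrow> 0"
      by (rule Lim_null_comparison[rotated]) (use N(2) in \<open>auto simp: s_def\<close>)
    then show ?thesis using tendsto_add[OF _ 1] by fastforce
  qed
  \<comment> \<open>The left side without its last term is twice the energy of the kept part;
    discarding the tail costs at most that term.\<close>
  have ge: "(\<Sum>e\<in>Es G. LINT x:part j e|lborel. (v' (N j) e x)\<^sup>2) - (\<Sum>e\<in>Es G. LINT x:part j e|lborel. (v (N j) e x)^6) / 3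
      - (s j)\<^sup>2 * B\<^sup>2 / sqrt 3 \<le> 2 * l + 2 * (1 / (real j + 1))" for j
  proof -
    define n where "n = N j"
    define f where "f = v n h"
    define g where "g = v' n h"
    have fi: "set_integrable lborel {0..} (\<lambda>x. (f x)\<^sup>2)" "set_integrable lborel {0..} (\<lambda>x. (g x)\<^sup>2)" "AC_on {0..} f g"
      "set_integrable lborel {0..} (\<lambda>x. (f x)^6)"
      unfolding f_def g_def using in_H1_edge[OF H h_in_Es, of n] in_H1_integrable_power6[OF H h_in_Es, of n] edom_h by auto
    have sub: "{real j..} \<subseteq> {0..}" by auto
    have tail: "- ((f (real j))\<^sup>2 * B\<^sup>2 / sqrt 3) \<le> (LINT x:{real j..}|lborel. (g x)\<^sup>2) - (LINT x:{real j..}|lborel. (f x)^6) / 3"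
    proof (rule tail_energy_ge)
      show "H1_on {real j..} f g" unfolding H1_on_iff
        using set_integrable_subset[OF fi(1) _ sub] set_integrable_subset[OF fi(2) _ sub] AC_on_subset[OF fi(3) sub] by simp
      show "0 \<le> f x" "f x \<le> B" if "real j \<le> x" for x
        using r[OF h_in_Es, of x n] that edom_h unfolding f_def by auto
      show "set_integrable lborel {real j..} (\<lambda>x. (f x)^6)" using set_integrable_subset[OF fi(4) _ sub] by simp
      have "(LINT x:{real j..}|lborel. (f x)\<^sup>2) \<le> (LINT x:{0..}|lborel. (f x)\<^sup>2)"
        by (rule set_integral_subset_le[OF fi(1) _ sub]) auto
      also have "\<dots> \<le> mass G (v n)" unfolding mass_eq f_def edom_h[symmetric]
        by (rule member_le_sum[OF h_in_Es _ finite_Es]) (auto intro: set_integral_nonneg')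
      finally show "(LINT x:{real j..}|lborel. (f x)\<^sup>2) \<le> mu_R" using m[of n] mu(2) by simp
    qed
    have sp: "(LINT x:{0..}|lborel. (g x)\<^sup>2) = (LINT x:{0..real j}|lborel. (g x)\<^sup>2) + (LINT x:{real j..}|lborel. (g x)\<^sup>2)"
      "(LINT x:{0..}|lborel. (f x)^6) = (LINT x:{0..real j}|lborel. (f x)^6) + (LINT x:{real j..}|lborel. (f x)^6)"
      by (rule set_integral_atLeast_add, simp, rule fi)+
    have pc: "part j e = edom G e" if "e \<in> Es G - {h}" for e using that unfolding part_def by simp
    have "2 * energy G (v n) (v' n) = (\<Sum>e\<in>Es G. LINT x:edom G e|lborel. (v' n e x)\<^sup>2) - (\<Sum>e\<in>Es G. LINT x:edom G e|lborel. (v n e x)^6) / 3"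
      unfolding energy_def Lp_pow_even[OF even_numeral] by simp
    moreover have "(\<Sum>e\<in>Es G. LINT x:edom G e|lborel. (v' n e x)\<^sup>2) = (\<Sum>e\<in>Es G. LINT x:part j e|lborel. (v' n e x)\<^sup>2) + (LINT x:{real j..}|lborel. (g x)\<^sup>2)"
      unfolding sum_Es using sp(1) pc by (simp add: edom_h g_def part_def)
    moreover have "(\<Sum>e\<in>Es G. LINT x:edom G e|lborel. (v n e x)^6) = (\<Sum>e\<in>Es G. LINT x:part j e|lborel. (v n e x)^6) + (LINT x:{real j..}|lborel. (f x)^6)"
      unfolding sum_Es using sp(2) pc by (simp add: edom_h f_def part_def)
    moreover have "energy G (v n) (v' n) \<le> l + 1 / (real j + 1)"
    proof -
      have "real j \<le> real n" using N(1)[of j] unfolding n_def by simp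
      then have "1 / (real n + 1) \<le> 1 / (real j + 1)" by (intro divide_left_mono) auto
      then show ?thesis using en[of n] by linarith
    qed
    moreover have sj: "f (real j) = s j" unfolding f_def s_def n_def ..
    ultimately show ?thesis using tail[unfolded sj] unfolding n_def by linarith
  qed
  have EW: "energy G W W' \<le> l"
  proof -
    define c where "c = real (card (Es G))"
    have "2 * energy G W W' \<le> 2 * l + \<epsilon>" if "\<epsilon> > 0" for \<epsilon>
    proof -
      \<comment> \<open>On each edge the derivative contributes an error \<open>\<eta>\<close> and
        the sextic term \<open>\<eta> / 3\<close>; the tail adds \<open>\<eta>\<close> and the
        minimizing slack \<open>2 * \<eta>\<close>. The sum is at most
        \<open>(2 * c + 3) * \<eta>\<close>.\<close>
      define \<eta> where "\<eta> = \<epsilon> / (2 * c + 3)"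
      have c0: "0 \<le> c" unfolding c_def by simp
      have eta: "\<eta> > 0" unfolding \<eta>_def using that c0 by simp
      have e1: "eventually (\<lambda>j. \<forall>e\<in>Es G. (LINT x:edom G e|lborel. (W' e x)\<^sup>2) - \<eta> \<le> (LINT x:part j e|lborel. (v' (N j) e x)\<^sup>2)) sequentially"
        by (intro eventually_ball_finite finite_Es ballI W' eta)
      have e2: "eventually (\<lambda>j. \<forall>e\<in>Es G. (LINT x:part j e|lborel. (v (N j) e x)^6) \<le> (LINT x:edom G e|lborel. (W e x)^6) + \<eta>) sequentially"
        by (intro eventually_ball_finite finite_Es ballI W6le eta)
      have "(\<lambda>j. (s j)\<^sup>2 * B\<^sup>2 / sqrt 3) \<longlonglongrightarrow> 0\<^sup>2 * B\<^sup>2 / sqrt 3" by (intro tendsto_intros slim) simp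
      then have e3: "eventually (\<lambda>j. (s j)\<^sup>2 * B\<^sup>2 / sqrt 3 < \<eta>) sequentially" using eta by (intro order_tendstoD(2)) auto
      have "(\<lambda>j. 1 / (real j + 1)) \<longlonglongrightarrow> 0" by real_asymp
      then have e4: "eventually (\<lambda>j. 1 / (real j + 1) < \<eta>) sequentially" using eta by (rule order_tendstoD(2))
      obtain j where j: "\<forall>e\<in>Es G. (LINT x:edom G e|lborel. (W' e x)\<^sup>2) - \<eta> \<le> (LINT x:part j e|lborel. (v' (N j) e x)\<^sup>2)"
        "\<forall>e\<in>Es G. (LINT x:part j e|lborel. (v (N j) e x)^6) \<le> (LINT x:edom G e|lborel. (W e x)^6) + \<eta>"
        "(s j)\<^sup>2 * B\<^sup>2 / sqrt 3 < \<eta>" "1 / (real j + 1) < \<eta>"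
        using eventually_happens'[OF sequentially_bot eventually_conj[OF e1 eventually_conj[OF e2 eventually_conj[OF e3 e4]]]] by blast
      have "(\<Sum>e\<in>Es G. (LINT x:edom G e|lborel. (W' e x)\<^sup>2) - \<eta>) \<le> (\<Sum>e\<in>Es G. LINT x:part j e|lborel. (v' (N j) e x)\<^sup>2)"
        by (intro sum_mono) (use j(1) in blast)
      then have 1: "Lp_pow G 2 W' - c * \<eta> \<le> (\<Sum>e\<in>Es G. LINT x:part j e|lborel. (v' (N j) e x)\<^sup>2)"
        unfolding Lp_pow_even[OF even_numeral] c_def by (simp add: sum_subtractf)
      have "(\<Sum>e\<in>Es G. LINT x:part j e|lborel. (v (N j) e x)^6) \<le> (\<Sum>e\<in>Es G. (LINT x:edom G e|lborel. (W e x)^6) + \<eta>)"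
        by (intro sum_mono) (use j(2) in blast)
      then have 2: "(\<Sum>e\<in>Es G. LINT x:part j e|lborel. (v (N j) e x)^6) \<le> Lp_pow G 6 W + c * \<eta>"
        unfolding Lp_pow_even[OF even_numeral] c_def by (simp add: sum.distrib)
      have 3: "2 * energy G W W' = Lp_pow G 2 W' - Lp_pow G 6 W / 3" unfolding energy_def by simp
      have ce: "0 \<le> c * \<eta>" using c0 eta by simp
      have "2 * energy G W W' \<le> 2 * l + (2 * (c * \<eta>) + 3 * \<eta>)" using ge[of j] 1 2 3 ce j(3,4) by linarith
      also have "2 * (c * \<eta>) + 3 * \<eta> = (2 * c + 3) * \<eta>" by (simp add: distrib_right)
      also have "\<dots> = \<epsilon>" unfolding \<eta>_def using c0 by simp
      finally show ?thesis .
    qed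
    then have "2 * energy G W W' \<le> 2 * l" by (rule field_le_epsilon)
    then show ?thesis by simp
  qed
  \<comment> \<open>A zero limit would have energy 0, against the negative bound
    \<open>l\<close>.\<close>
  have mWpos: "0 < mass G W"
  proof -
    have "0 < Lp_pow G 6 W" using EW l0 Lp_pow_even_nonneg[of 2 W'] unfolding energy_def by simp
    moreover have "Lp_pow G 6 W \<le> B^4 * mass G W"
    proof -
      have "Lp_pow G 6 W \<le> (\<Sum>e\<in>Es G. LINT x:edom G e|lborel. B^4 * (W e x)\<^sup>2)"
        unfolding Lp_pow_even[OF even_numeral]
      proof (intro sum_mono set_integral_mono W6)
        fix e x assume e: "e \<in> Es G" and x: "x \<in> edom G e"
        have "(W e x)^4 * (W e x)\<^sup>2 \<le> B^4 * (W e x)\<^sup>2"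
          using WB[OF e x] by (intro mult_right_mono power_mono) auto
        then show "(W e x)^6 \<le> B^4 * (W e x)\<^sup>2" by (simp add: power_add[symmetric])
      qed (use W2 in auto)
      also have "\<dots> = B^4 * mass G W" unfolding mass_eq by (simp add: sum_distrib_left)
      finally show ?thesis .
    qed
    ultimately have "0 < B^4 * mass G W" by linarith
    then show ?thesis using B by (simp add: zero_less_mult_iff)
  qed
  define c where "c = sqrt (\<mu> / mass G W)"
  have c2: "c\<^sup>2 = \<mu> / mass G W" unfolding c_def using mu0 mWpos by simp
  have c1: "1 \<le> c\<^sup>2" unfolding c2 using mW mWpos by simp
  define Z where "Z = (\<lambda>e x. c * W e x)"
  define Z' where "Z' = (\<lambda>e x. c * W' e x)"
  have HZ: "in_H1 G Z Z'" unfolding Z_def Z'_def by (rule in_H1_scale[OF HW])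
  have mZ: "mass G Z = \<mu>" unfolding Z_def energy_scale c2 using mWpos by simp
  \<comment> \<open>Since \<open>c^2 \<ge> 1\<close>, the sextic term grows at least as fast as the
    kinetic one, so the energy becomes at most \<open>c^2\<close> times a negative number.\<close>
  have "c\<^sup>2 \<le> c^6"
  proof -
    have "c^6 = c\<^sup>2 * (c\<^sup>2 * c\<^sup>2)" unfolding power_add[symmetric] by simp
    moreover have "1 * 1 \<le> c\<^sup>2 * c\<^sup>2" using c1 by (intro mult_mono) auto
    ultimately show ?thesis using mult_left_mono[of 1 "c\<^sup>2 * c\<^sup>2" "c\<^sup>2"] by simp
  qed
  then have "c\<^sup>2 * (Lp_pow G 6 W / 6) \<le> c^6 * (Lp_pow G 6 W / 6)"
    using Lp_pow_even_nonneg[of 6 W] by (intro mult_right_mono) auto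
  then have "energy G Z Z' \<le> c\<^sup>2 * energy G W W'" unfolding Z_def Z'_def energy_scale by (simp add: energy_def right_diff_distrib)
  also have "\<dots> \<le> 1 * energy G W W'" using c1 EW l0 by (intro mult_right_mono_neg) auto
  also have "\<dots> \<le> l" using EW by simp
  finally have "energy G Z Z' = l" using lev[OF HZ mZ] by simp
  then show ?thesis unfolding gs_attained_def l using HZ mZ by (intro bexI[of _ "(Z, Z')"]) (auto simp: H1_mu_def)
qed

end

theorem theorem7p3:
  fixes G :: "('v, 'e) mgraph"
  assumes "wf_mgraph G" and "mg_connected G" and "noncompact G"
    and "card (HL G) = 1" and "\<not> has_terminal_point G"
  shows "crit_mass G = mu_Rplus
    \<and> (\<forall>\<mu>. mu_Rplus < \<mu> \<and> \<mu> \<le> mu_R \<longrightarrow> - \<infinity> < gs_level G \<mu> \<and> gs_level G \<mu> < 0)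
    \<and> (\<forall>\<mu>>0. gs_attained G \<mu> \<longleftrightarrow> mu_Rplus < \<mu> \<and> \<mu> \<le> mu_R)"
proof -
  interpret one_halfline_graph G by unfold_locales (use assms in auto)
  have "- \<infinity> < gs_level G \<mu>" if mu: "mu_Rplus < \<mu>" "\<mu> \<le> mu_R" for \<mu>
  proof -
    have "0 < \<mu>" using mu mu_Rplus_pos by simp
    then obtain K where K: "ereal K \<le> gs_level G \<mu>" using gs_level_bounded_below mu(2) by blast
    have "- \<infinity> < ereal K" by simp
    then show ?thesis using K by (rule less_le_trans)
  qed
  moreover have "gs_attained G \<mu> \<longleftrightarrow> mu_Rplus < \<mu> \<and> \<mu> \<le> mu_R" if "\<mu> > 0" for \<mu>
    using gs_attained_intermediate[of \<mu>] not_attained_subcritical[OF that] not_attained_supercritical[of \<mu>]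
    by (meson not_le)
  ultimately show ?thesis using crit_mass_eq gs_level_neg by simp
qed

end
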